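(* Let $F\subset\mathrm{Sym}^2(\mathbb{R}^n)$ be a cone subequation with $-P_e\notin F$ for every unit vector $e$, let $\Omega\subset\mathbb{R}^n$ be a bounded domain with smooth strictly $F$-convex boundary, $x_0\in\Omega$, and $\varphi\in C(\partial\Omega)$. Let $h\in C(\overline\Omega)$ be $F$-harmonic on $\Omega\setminus\{x_0\}$, with a downward-pointing singularity at $x_0$ (i.e. $h$ is $F$-subharmonic near $x_0$, $h(x)>h(x_0)$ for $x\neq x_0$ near $x_0$, and $h$ has no test functions at $x_0$), normalized so that $h(x_0)=0<\inf_{\partial\Omega}h$ and $\sup_{\partial\Omega}h=1$. Let $H^0\in C(\overline\Omega)$ be the function which is $F$-harmonic on $\Omega$ with $H^0|_{\partial\Omega}=\varphi$, and assume that $H^0+th$ is $F$-subharmonic on $\Omega$ for every $t\ge0$. For $t\ge0$ and $\lambda\in\mathbb{R}$ put $\underline\psi_t=H^0+t(h-1)$ and $\overline h_t=\lambda h+H^0(x_0)+t(h-1)$. Then for each $t\ge0$ there exists $H^t$ such that: (1) $H^t\in C(\overline\Omega)$; (2) $H^t$ is $F$-harmonic on $\Omega\setminus\{x_0\}$; (3) $H^t|_{\partial\Omega}=\varphi$; (4a) $\underline\psi_t\le H^t$ on $\overline\Omega$ with equality at $x_0$; (4b) $H^t\le\overline h_t$ on $\overline\Omega$ for all sufficiently large $\lambda$, with equality at $x_0$.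
   Context: A cone subequation is a closed $F\subset\mathrm{Sym}^2(\mathbb{R}^n)$ with $A\in F,P\ge0\Rightarrow A+P\in F$ and $tF=F$ for $t>0$; $\tilde F=\{A:-A\notin\mathrm{Int}F\}$; $P_e$ is orthogonal projection onto $\mathbb{R}e$. $F$-subharmonic: upper semicontinuous $[-\infty,\infty)$-valued $u$ with $D^2\phi(y)\in F$ for every $C^2$ test function $\phi$ at $y$ ($u\le\phi$ near $y$, equality at $y$); $F$-harmonic: finite, continuous, $F$-subharmonic with $-u$ $\tilde F$-subharmonic. Smooth boundary strictly $F$-convex: for each $x\in\partial\Omega$ and local defining function $\rho$, $D^2\rho(x)+tP_\nu\in\mathrm{Int}F$ for all large $t$, $\nu$ the unit normal. *)

theory Defs
  imports "HOL-Analysis.Analysis"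
begin

definition sym_mats :: "(real^'n^'n) set" where
  "sym_mats = {A. transpose A = A}"

definition psd :: "real^'n^'n \<Rightarrow> bool" where
  "psd P \<longleftrightarrow> P \<in> sym_mats \<and> (\<forall>x. x \<bullet> (P *v x) \<ge> 0)"

definition proj_line :: "real^'n \<Rightarrow> real^'n^'n" where
  "proj_line e = (\<chi> i j. e$i * e$j)"

definition sym_interior :: "(real^'n^'n) set \<Rightarrow> (real^'n^'n) set" where
  "sym_interior F = {A \<in> sym_mats. \<exists>e>0. \<forall>B\<in>sym_mats. dist B A < e \<longrightarrow> B \<in> F}"

definition cone_subequation :: "(real^'n^'n) set \<Rightarrow> bool" where
  "cone_subequation F \<longleftrightarrow> F \<subseteq> sym_mats \<and> closed F
     \<and> (\<forall>A\<in>F. \<forall>P. psd P \<longrightarrow> A + P \<in> F)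
     \<and> (\<forall>t>0. (\<lambda>A. t *\<^sub>R A) ` F = F)"

definition dual_subeq :: "(real^'n^'n) set \<Rightarrow> (real^'n^'n) set" where
  "dual_subeq F = {A \<in> sym_mats. - A \<notin> sym_interior F}"

definition pd :: "'n \<Rightarrow> (real^'n \<Rightarrow> real) \<Rightarrow> real^'n \<Rightarrow> real" where
  "pd i f x = deriv (\<lambda>t. f (x + t *\<^sub>R axis i 1)) 0"

fun iter_pd :: "'n list \<Rightarrow> (real^'n \<Rightarrow> real) \<Rightarrow> real^'n \<Rightarrow> real" where
  "iter_pd [] f = f"
| "iter_pd (i # is) f = pd i (iter_pd is f)"

definition Ck_on :: "nat \<Rightarrow> (real^'n) set \<Rightarrow> (real^'n \<Rightarrow> real) \<Rightarrow> bool" where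
  "Ck_on k U f \<longleftrightarrow> (\<forall>is. length is \<le> k \<longrightarrow>
      continuous_on U (iter_pd is f) \<and>
      (length is < k \<longrightarrow> (\<forall>i. \<forall>x\<in>U. (\<lambda>t. iter_pd is f (x + t *\<^sub>R axis i 1)) differentiable (at 0))))"

definition smooth_on :: "(real^'n) set \<Rightarrow> (real^'n \<Rightarrow> real) \<Rightarrow> bool" where
  "smooth_on U f \<longleftrightarrow> (\<forall>k. Ck_on k U f)"

definition grad :: "(real^'n \<Rightarrow> real) \<Rightarrow> real^'n \<Rightarrow> real^'n" where
  "grad f x = (\<chi> i. pd i f x)"

definition hess :: "(real^'n \<Rightarrow> real) \<Rightarrow> real^'n \<Rightarrow> real^'n^'n" where
  "hess f x = (\<chi> i j. iter_pd [i, j] f x)"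

definition upper_test :: "(real^'n \<Rightarrow> real) \<Rightarrow> (real^'n) set \<Rightarrow> real^'n \<Rightarrow> (real^'n \<Rightarrow> real) \<Rightarrow> bool" where
  "upper_test u X y phi \<longleftrightarrow> (\<exists>r>0. Ck_on 2 (ball y r) phi \<and>
      (\<forall>x\<in>ball y r \<inter> X. u x \<le> phi x)) \<and> u y = phi y"

definition usc_on :: "(real^'n) set \<Rightarrow> (real^'n \<Rightarrow> real) \<Rightarrow> bool" where
  "usc_on X u \<longleftrightarrow> (\<forall>x\<in>X. \<forall>e>0. \<exists>d>0. \<forall>y\<in>X. dist y x < d \<longrightarrow> u y < u x + e)"

definition F_subharmonic :: "(real^'n^'n) set \<Rightarrow> (real^'n) set \<Rightarrow> (real^'n \<Rightarrow> real) \<Rightarrow> bool" where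
  "F_subharmonic F X u \<longleftrightarrow> usc_on X u \<and>
     (\<forall>y\<in>X. \<forall>phi. upper_test u X y phi \<longrightarrow> hess phi y \<in> F)"

definition F_harmonic :: "(real^'n^'n) set \<Rightarrow> (real^'n) set \<Rightarrow> (real^'n \<Rightarrow> real) \<Rightarrow> bool" where
  "F_harmonic F X u \<longleftrightarrow> continuous_on X u \<and> F_subharmonic F X u
     \<and> F_subharmonic (dual_subeq F) X (\<lambda>x. - u x)"

definition local_defining_fun :: "(real^'n) set \<Rightarrow> real^'n \<Rightarrow> (real^'n) set \<Rightarrow> (real^'n \<Rightarrow> real) \<Rightarrow> bool" where
  "local_defining_fun \<Omega> x U \<rho> \<longleftrightarrow> open U \<and> x \<in> U \<and> smooth_on U \<rho>
     \<and> \<Omega> \<inter> U = {y\<in>U. \<rho> y < 0}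
     \<and> (\<forall>y\<in>U \<inter> frontier \<Omega>. grad \<rho> y \<noteq> 0)"

definition smooth_boundary :: "(real^'n) set \<Rightarrow> bool" where
  "smooth_boundary \<Omega> \<longleftrightarrow> (\<forall>x\<in>frontier \<Omega>. \<exists>U \<rho>. local_defining_fun \<Omega> x U \<rho>)"

definition strictly_F_convex_boundary :: "(real^'n^'n) set \<Rightarrow> (real^'n) set \<Rightarrow> bool" where
  "strictly_F_convex_boundary F \<Omega> \<longleftrightarrow> smooth_boundary \<Omega> \<and>
     (\<forall>x\<in>frontier \<Omega>. \<forall>U \<rho>. local_defining_fun \<Omega> x U \<rho> \<longrightarrow>
        (\<exists>T. \<forall>t\<ge>T. hess \<rho> x + t *\<^sub>R proj_line ((1 / norm (grad \<rho> x)) *\<^sub>R grad \<rho> x)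
                     \<in> sym_interior F))"

end

theory Submission
  imports Defs
begin

text \<open>The solution is the Perron supremum over the subharmonic functions below
  \<open>G = min H\<^sup>0 (\<Lambda> h + H\<^sup>0(x\<^sub>0) + t (h - 1))\<close>, which is superharmonic off \<open>x\<^sub>0\<close> and, for \<open>\<Lambda>\<close> large,
  equal to \<open>\<phi>\<close> on the boundary. Comparison of \<open>H\<^sup>0 - H\<^sup>0(x\<^sub>0)\<close> with \<open>\<Lambda> h\<close> on the punctured domain, together
  with \<open>h \<le> 1\<close>, puts \<open>H\<^sup>0 + t (h - 1)\<close> below \<open>G\<close>; both agree at \<open>x\<^sub>0\<close>, which pinches the Perron function
  there, while strict F-convexity supplies lower barriers on the boundary. Since F has constant
  coefficients, Walsh's translation argument gives continuity without using comparison.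

  Comparison itself is proved by sup-convolution: two semiconvex functions whose sum has a strict
  interior maximum are, by the arguments of Jensen and Alexandrov (resting on Rademacher's theorem
  for the resolvent of a subdifferential), both twice differentiable at some point
  where the sum of the Hessians is nonpositive.\<close>

section \<open>Rademacher's theorem\<close>

text \<open>The functions compared are only continuous, so \<open>F\<close> and its dual cannot be
  played off against each other until second derivatives exist at a common point; this is why
  comparison reaches back to measure theory. Second order differentiability is proved at points
  where a convex function is touched from above by a paraboloid. These are exactly the points that
  Jensen's argument produces, and the contact is what makes the derivative of the resolvent
  invertible.

  The singular point x0 is treated as a boundary point: Perron's method runs on the punctured
  domain, with \<open>G\<close> both as upper obstacle and as boundary datum. The barriers from
  strict convexity belong to the outer boundary and do not reach x0; there the subharmonic function
  \<open>H\<^sup>0 + t (h - 1)\<close> is the lower barrier. The Perron function may adhere to its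
  obstacle; where it does, the superharmonicity of \<open>G\<close> supplies the missing half of
  harmonicity.

  The size of \<open>\<Lambda>\<close> is dictated by the outer boundary, where \<open>h\<close> has
  a positive minimum, while at x0 the term \<open>\<Lambda> h\<close> vanishes.\<close>

text \<open>A linear term makes the function strictly increasing; its Stieltjes measure is then
  absolutely continuous, and the Radon-Nikodym density is the derivative almost everywhere by
  Lebesgue differentiation.\<close>

lemma Lipschitz_real_ae_differentiable:
  fixes F :: "real \<Rightarrow> real"
  assumes L: "\<And>s t. \<bar>F s - F t\<bar> \<le> L * \<bar>s - t\<bar>"
  shows "\<exists>N. negligible N \<and> (\<forall>t. t \<notin> N \<longrightarrow> F differentiable (at t))"
proof -
  have L0: "L \<ge> 0" using L[of 1 0] by simp
  \<comment> \<open>The slope \<open>L + 1\<close> makes every increment of \<open>G\<close> at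
    least the length of the interval, so \<open>G\<close> is a bijection of the line with
    1-Lipschitz inverse.\<close>
  define G where "G = (\<lambda>t. F t + (L + 1) * t)"
  have Glow: "G q - G p \<ge> q - p" if "p \<le> q" for p q
    using L[of q p] that by (simp add: G_def algebra_simps)
  have Gmono: "p \<le> q \<longleftrightarrow> G p \<le> G q" for p q
    using Glow[of p q] Glow[of q p] by linarith
  have injG: "inj G" by (rule injI) (metis Gmono order_antisym order_refl)
  have contF: "isCont F t" for t
  proof -
    have "L-lipschitz_on UNIV F" using L L0 by (auto intro!: lipschitz_onI simp: dist_real_def)
    then show ?thesis using lipschitz_on_continuous_on continuous_on_eq_continuous_at open_UNIV by blast
  qed
  have contG: "continuous_on UNIV G" unfolding G_def
    by (intro continuous_intros continuous_at_imp_continuous_on) (use contF in auto)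
  have surjG: "\<exists>t. G t = y" for y
  proof -
    define r where "r = \<bar>y - G 0\<bar>"
    have "G (-r) \<le> y" "y \<le> G r" using Glow[of "-r" 0] Glow[of 0 r] by (auto simp: r_def)
    then show ?thesis using IVT'[of G "-r" y r] contG continuous_on_subset r_def by fastforce
  qed
  define H where "H = inv G"
  have GH: "G (H y) = y" for y unfolding H_def using surjG by (metis f_inv_into_f rangeI)
  have HG: "H (G y) = y" for y unfolding H_def using injG by simp
  have Hlip: "\<bar>H a - H b\<bar> \<le> \<bar>a - b\<bar>" for a b
    using Glow[of "H a" "H b"] Glow[of "H b" "H a"] GH by (smt (verit, ccfv_SIG))
  have "1-lipschitz_on UNIV H" using Hlip by (auto intro!: lipschitz_onI simp: dist_real_def)
  then have "continuous_on UNIV H" using lipschitz_on_continuous_on by blast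
  then have Hm[measurable]: "H \<in> borel_measurable borel" by (rule borel_measurable_continuous_onI)
  have Gm[measurable]: "G \<in> borel_measurable borel" using contG by (rule borel_measurable_continuous_onI)
  \<comment> \<open>The image of Lebesgue measure under the inverse of \<open>G\<close> gives
    \<open>{p..q}\<close> the mass \<open>G q - G p\<close>; it is absolutely continuous because the
    Lipschitz map \<open>G\<close> preserves null sets.\<close>
  define \<mu> where "\<mu> = distr lborel borel H"
  have sets\<mu>: "sets \<mu> = sets lborel" by (simp add: \<mu>_def)
  have ac: "absolutely_continuous lborel \<mu>"
    unfolding absolutely_continuous_def
  proof
    fix A :: "real set" assume A: "A \<in> null_sets lborel"
    then have Ab: "A \<in> sets borel" by auto
    have "negligible A" using A null_sets_completionI negligible_iff_null_sets by blast
    then have "negligible (G ` A)"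
    proof (rule negligible_locally_Lipschitz_image[rotated])
      show "\<exists>T B. open T \<and> x \<in> T \<and> (\<forall>y\<in>A \<inter> T. norm (G y - G x) \<le> B * norm (y - x))" for x
      proof (intro exI[of _ UNIV] exI[of _ "2 * L + 1"] conjI ballI)
        fix y
        have "norm (G y - G x) \<le> \<bar>F y - F x\<bar> + \<bar>(L + 1) * (y - x)\<bar>" by (simp add: G_def algebra_simps)
        also have "\<dots> \<le> (2*L+1) * norm (y - x)"
        proof -
          have "\<bar>(L + 1) * (y - x)\<bar> = (L + 1) * \<bar>y - x\<bar>" using L0 by (simp add: abs_mult)
          then show ?thesis using L[of y x] by (simp add: algebra_simps)
        qed
        finally show "norm (G y - G x) \<le> (2*L+1) * norm (y - x)" .
      qed auto
    qed simp
    moreover have "G ` A = H -` A" using GH HG by (auto simp: image_iff) metis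
    ultimately have "negligible (H -` A)" by simp
    moreover have "H -` A \<in> sets borel" using measurable_sets[OF Hm Ab] by simp
    ultimately have "emeasure lborel (H -` A) = 0"
      using null_sets_completion_iff[of "H -` A" lborel] by (simp add: negligible_iff_null_sets null_sets_def)
    then show "A \<in> null_sets \<mu>" using Ab by (auto simp: \<mu>_def null_sets_def emeasure_distr)
  qed
  obtain g0 where g0[measurable]: "g0 \<in> borel_measurable borel" and dens: "density lborel g0 = \<mu>"
    using sigma_finite_measure.Radon_Nikodym[OF sigma_finite_lborel ac sets\<mu>] by auto
  have int0: "(\<integral>\<^sup>+x. g0 x * indicator {p..q} x \<partial>lborel) = ennreal (G q - G p)" if "p \<le> q" for p q
  proof -
    have "(\<integral>\<^sup>+x. g0 x * indicator {p..q} x \<partial>lborel) = emeasure \<mu> {p..q}"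
      unfolding dens[symmetric] by (subst emeasure_density) auto
    also have "\<dots> = emeasure lborel (H -` {p..q})" by (simp add: \<mu>_def emeasure_distr)
    also have "H -` {p..q} = {G p..G q}"
    proof -
      have "p \<le> H x \<longleftrightarrow> G p \<le> x" "H x \<le> q \<longleftrightarrow> x \<le> G q" for x
        using Gmono[of p "H x"] Gmono[of "H x" q] by (simp_all only: GH)
      then show ?thesis by (simp add: vimage_def atLeastAtMost_def Int_def)
    qed
    finally show ?thesis using Glow[OF that] that by simp
  qed
  have fin: "AE x in lborel. g0 x \<noteq> \<infinity>"
  proof -
    have "AE x in lborel. \<forall>n::nat. g0 x * indicator {- real n..real n} x \<noteq> \<infinity>"
    proof (subst AE_all_countable, rule)
      fix n :: nat
      show "AE x in lborel. g0 x * indicator {- real n..real n} x \<noteq> \<infinity>"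
        by (rule nn_integral_PInf_AE) (auto simp: int0)
    qed
    then show ?thesis
    proof eventually_elim
      case (elim x)
      obtain n :: nat where "\<bar>x\<bar> \<le> real n" using real_arch_simple by blast
      then show ?case using elim[rule_format, of n] by (auto simp: indicator_def abs_le_iff split: if_splits)
    qed
  qed
  define g where "g = (\<lambda>x. enn2real (g0 x))"
  have hi: "(g has_integral (G q - G p)) {p..q}" if "p \<le> q" for p q
  proof -
    have "(\<integral>\<^sup>+x. ennreal (g x * indicator {p..q} x) \<partial>lborel) = (\<integral>\<^sup>+x. g0 x * indicator {p..q} x \<partial>lborel)"
      by (rule nn_integral_cong_AE, rule AE_mp[OF fin])
         (auto intro!: AE_I2 simp: g_def indicator_def less_top)
    note I = this
    have "((\<lambda>x. g x * indicator {p..q} x) has_integral (G q - G p)) UNIV"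

    proof (intro nn_integral_has_integral)
      show "0 \<le> G q - G p" using Glow[OF that] that by linarith
    qed (use I int0[OF that] in \<open>simp_all add: g_def\<close>)
    moreover have "(\<lambda>x. g x * indicator {p..q} x) = (\<lambda>x. if x \<in> {p..q} then g x else 0)"
      by (auto simp: indicator_def)
    ultimately show ?thesis using has_integral_restrict_UNIV by metis
  qed
  have gi: "g integrable_on cbox a b" for a b
    by (cases "a \<le> b") (use hi in \<open>auto simp: has_integral_iff\<close>)
  \<comment> \<open>Differentiation over \<open>[x, x + h]\<close> yields the derivative from the
    right; the reflected density yields the one from the left.\<close>
  have gr: "((\<lambda>x. g (- x)) has_integral (G q - G p)) {- q..- p}" if "p \<le> q" for p q
    using hi[OF that] by simp
  have gri: "(\<lambda>x. g (- x)) integrable_on cbox a b" for a b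
    by (cases "a \<le> b") (use gr[of "-b" "-a"] in \<open>auto simp: has_integral_iff\<close>)
  obtain N1 where N1: "negligible N1"
    "\<And>x e. \<lbrakk>x \<notin> N1; 0 < e\<rbrakk> \<Longrightarrow> \<exists>d>0. \<forall>h. 0 < h \<and> h < d \<longrightarrow>
        norm (integral (cbox x (x + h *\<^sub>R One)) g /\<^sub>R h ^ DIM(real) - g x) < e"
    using integrable_ccontinuous_explicit[of g] gi by blast
  obtain N2 where N2: "negligible N2"
    "\<And>x e. \<lbrakk>x \<notin> N2; 0 < e\<rbrakk> \<Longrightarrow> \<exists>d>0. \<forall>h. 0 < h \<and> h < d \<longrightarrow>
        norm (integral (cbox x (x + h *\<^sub>R One)) (\<lambda>x. g (- x)) /\<^sub>R h ^ DIM(real) - g (- x)) < e"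
    using integrable_ccontinuous_explicit[of "\<lambda>x. g (- x)"] gri by blast
  define N where "N = N1 \<union> uminus ` N2"
  have "negligible (uminus ` N2)"
  proof (rule negligible_locally_Lipschitz_image[OF _ N2(1)])
    show "\<exists>T B. open T \<and> x \<in> T \<and> (\<forall>y\<in>N2 \<inter> T. norm (- y - - x) \<le> B * norm (y - x))" for x
      by (intro exI[of _ UNIV] exI[of _ "1::real"]) auto
  qed simp
  then have "negligible N" using N1 by (simp add: N_def)
  moreover have "F differentiable (at t)" if t: "t \<notin> N" for t
  proof -
    have "(G has_field_derivative g t) (at t)"
      unfolding has_field_derivative_iff
    proof (rule LIM_I)
      fix e :: real assume e: "e > 0"
      obtain d1 where d1: "d1 > 0" "\<And>h. 0 < h \<Longrightarrow> h < d1 \<Longrightarrow>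
          norm (integral (cbox t (t + h *\<^sub>R One)) g /\<^sub>R h ^ DIM(real) - g t) < e"
        using N1(2)[of t e] t e by (auto simp: N_def)
      have "- t \<notin> N2" using t by (force simp: N_def)
      then obtain d2 where d2: "d2 > 0" "\<And>h. 0 < h \<Longrightarrow> h < d2 \<Longrightarrow>
          norm (integral (cbox (-t) (-t + h *\<^sub>R One)) (\<lambda>x. g (- x)) /\<^sub>R h ^ DIM(real) - g t) < e"
        using N2(2)[of "-t" e] e by auto
      show "\<exists>s>0. \<forall>x. x \<noteq> t \<and> norm (x - t) < s \<longrightarrow> norm ((G x - G t) / (x - t) - g t) < e"
      proof (intro exI[of _ "min d1 d2"] conjI allI impI)
        fix y assume y: "y \<noteq> t \<and> norm (y - t) < min d1 d2"
        show "norm ((G y - G t) / (y - t) - g t) < e"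
        proof (cases "y > t")
          case True
          then show ?thesis using d1(2)[of "y - t"] y integral_unique[OF hi[of t y]]
            by (simp add: divide_inverse mult.commute)
        next
          case False
          have "integral {- t..- y} (\<lambda>x. g (- x)) = G t - G y"
            using integral_unique[OF gr[of y t]] False by simp
          then have "norm ((G t - G y) / (t - y) - g t) < e"
            using d2(2)[of "t - y"] y False by (simp add: divide_inverse mult.commute)
          moreover have "(G t - G y) / (t - y) = (G y - G t) / (y - t)"
            by (metis minus_diff_eq minus_divide_divide)
          ultimately show ?thesis by simp
        qed
      qed (use d1 d2 in auto)
    qed
    then have "((\<lambda>x. G x - (L + 1) * x) has_field_derivative g t - (L + 1)) (at t)"
      by (auto intro!: derivative_eq_intros)
    then have "(F has_field_derivative g t - (L + 1)) (at t)" by (simp add: G_def)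
    then show ?thesis using real_differentiable_def by blast
  qed
  ultimately show ?thesis by blast
qed

text \<open>Tonelli and translation invariance: averaging the measure of the translates of
  \<open>N\<close> along \<open>v\<close> over unit time gives the measure of \<open>N\<close>,
  while for fixed x the inner integral runs along a line and vanishes.\<close>

lemma negligible_if_negligible_on_lines:
  fixes N :: "'a::euclidean_space set"
  assumes N[measurable]: "N \<in> sets borel"
    and lines: "\<And>x. negligible {t::real. x + t *\<^sub>R v \<in> N}"
  shows "negligible N"
proof -
  have trans: "(\<integral>\<^sup>+x. indicator N (x + t *\<^sub>R v) \<partial>lborel) = emeasure lborel N" for t :: real
  proof -
    have "emeasure lborel N = (\<integral>\<^sup>+x. indicator N x \<partial>distr lborel borel ((+) (t *\<^sub>R v)))"
      by (simp add: lborel_distr_plus)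
    also have "\<dots> = (\<integral>\<^sup>+x. indicator N (x + t *\<^sub>R v) \<partial>lborel)"
      by (subst nn_integral_distr) (auto simp: add.commute)
    finally show ?thesis by simp
  qed
  have line0: "(\<integral>\<^sup>+t. indicator {0..1} t * indicator N (x + t *\<^sub>R v) \<partial>lborel) = 0" for x
  proof -
    let ?S = "{t::real. x + t *\<^sub>R v \<in> N}"
    have S: "?S \<in> sets borel" by measurable
    have "emeasure lborel ?S = 0"
      using lines[of x] S null_sets_completion_iff[of ?S lborel]
      by (simp add: negligible_iff_null_sets null_sets_def)
    moreover have "(\<integral>\<^sup>+t. indicator {0..1} t * indicator N (x + t *\<^sub>R v) \<partial>lborel) \<le> (\<integral>\<^sup>+t. indicator ?S t \<partial>lborel)"
      by (intro nn_integral_mono) (auto simp: indicator_def)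
    ultimately show ?thesis using S by simp
  qed
  have "emeasure lborel N = (\<integral>\<^sup>+t. indicator {0..1::real} t * emeasure lborel N \<partial>lborel)"
    by (simp add: nn_integral_multc)
  also have "\<dots> = (\<integral>\<^sup>+t. (\<integral>\<^sup>+x. indicator {0..1} t * indicator N (x + t *\<^sub>R v) \<partial>lborel) \<partial>lborel)"
    by (subst nn_integral_cmult) (auto simp: trans)
  also have "\<dots> = (\<integral>\<^sup>+x. (\<integral>\<^sup>+t. indicator {0..1} t * indicator N (x + t *\<^sub>R v) \<partial>lborel) \<partial>lborel)"
    by (rule lborel_pair.Fubini') measurable
  also have "\<dots> = 0" by (simp add: line0)
  finally show ?thesis
    by (simp add: negligible_iff_null_sets null_sets_def null_sets_completion_iff)
qed

section \<open>Directional derivatives of Lipschitz functions of several variables\<close>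

definition quot :: "('a::real_vector \<Rightarrow> real) \<Rightarrow> 'a \<Rightarrow> 'a \<Rightarrow> real \<Rightarrow> real" where
  "quot f v x t = (f (x + t *\<^sub>R v) - f x) / t"

lemma Lipschitz_bound_nonneg:
  fixes f :: "'a::euclidean_space \<Rightarrow> real"
  assumes L: "\<And>x y. \<bar>f x - f y\<bar> \<le> L * norm (x - y)"
  shows "L \<ge> 0"
  using L[of "SOME i. i \<in> Basis" 0] by (smt (verit) SOME_Basis norm_Basis diff_zero mult_cancel_left2)

lemma Lipschitz_bound_imp_continuous_on:
  fixes f :: "'a::euclidean_space \<Rightarrow> real"
  assumes L: "\<And>x y. \<bar>f x - f y\<bar> \<le> L * norm (x - y)"
  shows "continuous_on S f"
proof -
  have "L-lipschitz_on S f" using L Lipschitz_bound_nonneg[OF L] by (auto intro!: lipschitz_onI simp: dist_norm)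
  then show ?thesis using lipschitz_on_continuous_on by blast
qed

text \<open>The Cauchy criterion for difference quotients makes the exceptional set Borel; the
  one-dimensional theorem on each line parallel to \<open>v\<close> then makes it null.\<close>

lemma Lipschitz_ae_directional_derivative:
  fixes f :: "'a::euclidean_space \<Rightarrow> real"
  assumes L: "\<And>x y. \<bar>f x - f y\<bar> \<le> L * norm (x - y)"
  shows "{x. \<exists>l. (quot f v x \<longlongrightarrow> l) (at 0)} \<in> sets borel" (is "?D \<in> _")
    and "negligible {x. \<nexists>l. (quot f v x \<longlongrightarrow> l) (at 0)}"
proof -
  note cont = Lipschitz_bound_imp_continuous_on[OF L, of UNIV]
  \<comment> \<open>For fixed \<open>s\<close> and \<open>t\<close> the condition is closed in x, so
    \<open>K m k\<close> is an intersection of closed sets. The limit exists exactly on the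
    intersection over \<open>m\<close> of the unions over \<open>k\<close>.\<close>
  define K where "K m k = {x. \<forall>s t. 0 < \<bar>s\<bar> \<and> \<bar>s\<bar> < 1 / Suc k \<and> 0 < \<bar>t\<bar> \<and> \<bar>t\<bar> < 1 / Suc k \<longrightarrow>
    \<bar>quot f v x s - quot f v x t\<bar> \<le> 1 / Suc m}" for m k :: nat
  have K: "closed (K m k)" for m k
    unfolding K_def quot_def divide_inverse
    by (intro closed_Collect_all closed_Collect_imp open_Collect_const closed_Collect_le continuous_intros
        continuous_on_compose2[OF cont]) auto
  define N where "N = - (\<Inter>m. \<Union>k. K m k)"
  have Nb: "N \<in> sets borel" unfolding N_def using K by (auto intro!: sets.countable_INT sets.countable_UN)
  have iff: "x \<notin> N \<longleftrightarrow> (\<exists>l. (quot f v x \<longlongrightarrow> l) (at 0))" for x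
  proof
    assume "x \<notin> N"
    then have K': "\<exists>k. x \<in> K m k" for m by (auto simp: N_def)
    have cau: "\<exists>d>0. \<forall>s t. 0 < \<bar>s\<bar> \<and> \<bar>s\<bar> < d \<and> 0 < \<bar>t\<bar> \<and> \<bar>t\<bar> < d \<longrightarrow> \<bar>quot f v x s - quot f v x t\<bar> < e" if e: "e > 0" for e
    proof -
      obtain m :: nat where m: "1 / Suc m < e" using nat_approx_posE[OF e] by blast
      obtain k where "x \<in> K m k" using K' by blast
      then show ?thesis using m by (intro exI[of _ "1 / Suc k"]) (fastforce simp: K_def)
    qed
    have "Cauchy (\<lambda>n. quot f v x (1 / Suc n))"
    proof (rule metric_CauchyI)
      fix e :: real assume "e > 0"
      then obtain d where d: "d > 0" "\<forall>s t. 0 < \<bar>s\<bar> \<and> \<bar>s\<bar> < d \<and> 0 < \<bar>t\<bar> \<and> \<bar>t\<bar> < d \<longrightarrow> \<bar>quot f v x s - quot f v x t\<bar> < e"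
        using cau by blast
      obtain M :: nat where M: "1 / Suc M < d" using nat_approx_posE[OF d(1)] by blast
      have "1 / Suc n < d" if "n \<ge> M" for n
      proof -
        have "1 / real (Suc n) \<le> 1 / real (Suc M)" using that by (intro divide_left_mono) auto
        then show ?thesis using M by linarith
      qed
      then show "\<exists>M. \<forall>m\<ge>M. \<forall>n\<ge>M. dist (quot f v x (1 / Suc m)) (quot f v x (1 / Suc n)) < e"
        by (intro exI[of _ M]) (auto simp: dist_real_def intro!: d(2)[rule_format])
    qed
    then obtain l where l: "(\<lambda>n. quot f v x (1 / Suc n)) \<longlonglongrightarrow> l"
      using Cauchy_convergent convergent_def by blast
    have "(quot f v x \<longlongrightarrow> l) (at 0)"
    proof (rule LIM_I)
      fix e :: real assume "e > 0"
      then obtain d where d: "d > 0" "\<forall>s t. 0 < \<bar>s\<bar> \<and> \<bar>s\<bar> < d \<and> 0 < \<bar>t\<bar> \<and> \<bar>t\<bar> < d \<longrightarrow> \<bar>quot f v x s - quot f v x t\<bar> < e/2"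
        using cau[of "e/2"] by auto
      obtain n0 where n0: "\<And>n. n \<ge> n0 \<Longrightarrow> \<bar>quot f v x (1 / Suc n) - l\<bar> < e/2"
        using LIMSEQ_D[OF l, of "e/2"] \<open>e > 0\<close> by (metis half_gt_zero real_norm_def)
      obtain M :: nat where M: "1 / Suc M < d" using nat_approx_posE[OF d(1)] by blast
      have "1 / real (Suc (max n0 M)) \<le> 1 / real (Suc M)" by (intro divide_left_mono) auto
      then have M': "1 / real (Suc (max n0 M)) < d" using M by linarith
      show "\<exists>s>0. \<forall>t. t \<noteq> 0 \<and> norm (t - 0) < s \<longrightarrow> norm (quot f v x t - l) < e"
      proof (intro exI[of _ d] conjI allI impI d(1))
        fix t :: real assume "t \<noteq> 0 \<and> norm (t - 0) < d"
        then have "\<bar>quot f v x t - quot f v x (1 / Suc (max n0 M))\<bar> < e/2"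
          using M' by (intro d(2)[rule_format]) auto
        moreover have "\<bar>quot f v x (1 / Suc (max n0 M)) - l\<bar> < e/2" by (rule n0) simp
        ultimately show "norm (quot f v x t - l) < e" unfolding real_norm_def by linarith
      qed
    qed
    then show "\<exists>l. (quot f v x \<longlongrightarrow> l) (at 0)" by blast
  next
    assume "\<exists>l. (quot f v x \<longlongrightarrow> l) (at 0)"
    then obtain l where l: "(quot f v x \<longlongrightarrow> l) (at 0)" by blast
    have "\<exists>k. x \<in> K m k" for m
    proof -
      define e where "e = 1 / real (Suc m)"
      have e: "e > 0" by (simp add: e_def)
      obtain d where d: "d > 0" "\<And>t. t \<noteq> 0 \<Longrightarrow> \<bar>t\<bar> < d \<Longrightarrow> \<bar>quot f v x t - l\<bar> < e / 2"
        using LIM_D[OF l, of "e / 2"] e by auto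
      obtain k :: nat where k: "1 / Suc k < d" using nat_approx_posE[OF d(1)] by blast
      have "\<bar>quot f v x s - quot f v x t\<bar> \<le> e"
        if "0 < \<bar>s\<bar>" "\<bar>s\<bar> < 1 / Suc k" "0 < \<bar>t\<bar>" "\<bar>t\<bar> < 1 / Suc k" for s t
      proof -
        have "\<bar>quot f v x s - l\<bar> < e / 2" "\<bar>quot f v x t - l\<bar> < e / 2"
          using that k d(2) by auto
        then show ?thesis by linarith
      qed
      then show ?thesis by (auto simp: K_def e_def)
    qed
    then show "x \<notin> N" by (auto simp: N_def)
  qed
  have "negligible N"
  proof (rule negligible_if_negligible_on_lines[OF Nb, of v])
    fix x
    have "\<bar>f (x + s *\<^sub>R v) - f (x + t *\<^sub>R v)\<bar> \<le> (L * norm v) * \<bar>s - t\<bar>" for s t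
      using L[of "x + s *\<^sub>R v" "x + t *\<^sub>R v"]
      by (simp add: algebra_simps flip: scaleR_diff_left)
    from Lipschitz_real_ae_differentiable[of "\<lambda>t. f (x + t *\<^sub>R v)", OF this]
    obtain N' where N': "negligible N'" "\<And>t. t \<notin> N' \<Longrightarrow> (\<lambda>t. f (x + t *\<^sub>R v)) differentiable (at t)"
      by blast
    have "{t. x + t *\<^sub>R v \<in> N} \<subseteq> N'"
    proof (rule ccontr)
      assume "\<not> ?thesis"
      then obtain t where t: "x + t *\<^sub>R v \<in> N" "t \<notin> N'" by auto
      obtain l where "((\<lambda>t. f (x + t *\<^sub>R v)) has_field_derivative l) (at t)"
        using N'(2)[OF t(2)] real_differentiable_def by blast
      then have "((\<lambda>h. (f (x + (t + h) *\<^sub>R v) - f (x + t *\<^sub>R v)) / h) \<longlongrightarrow> l) (at 0)"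
        by (simp add: DERIV_def)
      then have "(quot f v (x + t *\<^sub>R v) \<longlongrightarrow> l) (at 0)"
        by (simp add: quot_def[abs_def] scaleR_add_left add.assoc)
      then show False using iff t(1) by blast
    qed
    then show "negligible {t. x + t *\<^sub>R v \<in> N}" using N'(1) negligible_subset by blast
  qed
  moreover have "{x. \<nexists>l. (quot f v x \<longlongrightarrow> l) (at 0)} = N" using iff by blast
  ultimately show "negligible {x. \<nexists>l. (quot f v x \<longlongrightarrow> l) (at 0)}" by simp
  have "?D = - N" using iff by blast
  then show "?D \<in> sets borel" using Nb by simp
qed

text \<open>A count takes the place of the usual integration by parts. The defect
  \<open>e x t\<close> of additivity equals
  \<open>quot f v (x + t *\<^sub>R u) t - quot f v x t\<close>, so where it does not tend to 0 the
  quotients along \<open>v\<close> jump under small steps along \<open>u\<close>. On each line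
  parallel to \<open>u\<close> this happens only countably often.\<close>

lemma Lipschitz_ae_additive_derivative:
  fixes f :: "'a::euclidean_space \<Rightarrow> real"
  assumes L: "\<And>x y. \<bar>f x - f y\<bar> \<le> L * norm (x - y)"
  shows "negligible {x. \<exists>a b c. (quot f u x \<longlongrightarrow> a) (at 0) \<and> (quot f v x \<longlongrightarrow> b) (at 0)
    \<and> (quot f (u + v) x \<longlongrightarrow> c) (at 0) \<and> c \<noteq> a + b}" (is "negligible ?N")
proof -
  define e where "e x t = quot f (u + v) x t - quot f u x t - quot f v x t" for x t
  define D where "D w = {x. \<exists>l. (quot f w x \<longlongrightarrow> l) (at 0)}" for w
  have D: "D w \<in> sets borel" for w unfolding D_def using Lipschitz_ae_directional_derivative(1)[OF L] .
  note cont = Lipschitz_bound_imp_continuous_on[OF L, of UNIV]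
  define E where "E m k = {x. \<forall>t. 0 < \<bar>t\<bar> \<and> \<bar>t\<bar> < 1 / Suc k \<longrightarrow> \<bar>e x t\<bar> \<le> 1 / Suc m}" for m k :: nat
  have "closed (E m k)" for m k
    unfolding E_def e_def quot_def divide_inverse
    by (intro closed_Collect_all closed_Collect_imp open_Collect_const closed_Collect_le continuous_intros
        continuous_on_compose2[OF cont]) auto
  then have Z: "(\<Inter>m. \<Union>k. E m k) \<in> sets borel" by (auto intro!: sets.countable_INT sets.countable_UN)
  have e0: "x \<in> (\<Inter>m. \<Union>k. E m k)" if ex: "(e x \<longlongrightarrow> 0) (at 0)" for x
  proof -
    have "\<exists>k. x \<in> E m k" for m
    proof -
      define d where "d = 1 / real (Suc m)"
      have d: "d > 0" by (simp add: d_def)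
      obtain r where r: "r > 0" "\<And>t. t \<noteq> 0 \<Longrightarrow> \<bar>t\<bar> < r \<Longrightarrow> \<bar>e x t\<bar> < d"
        using LIM_D[OF ex d] by auto
      obtain k :: nat where k: "1 / Suc k < r" using nat_approx_posE[OF r(1)] by blast
      have "x \<in> E m k" unfolding E_def mem_Collect_eq d_def[symmetric]
        using r(2) k by (metis abs_zero less_irrefl less_le_trans less_imp_le)
      then show ?thesis by blast
    qed
    then show ?thesis by blast
  qed
  have e1: "(e x \<longlongrightarrow> 0) (at 0)" if x: "x \<in> (\<Inter>m. \<Union>k. E m k)" for x
  proof (rule LIM_I)
    fix r :: real assume r: "r > 0"
    obtain m :: nat where m: "1 / Suc m < r" using nat_approx_posE[OF r] by blast
    obtain k where "x \<in> E m k" using x by blast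
    then show "\<exists>s>0. \<forall>t. t \<noteq> 0 \<and> norm (t - 0) < s \<longrightarrow> norm (e x t - 0) < r"
      using m by (intro exI[of _ "1 / Suc k"]) (fastforce simp: E_def)
  qed
  define M where "M = D u \<inter> D v \<inter> D (u + v) - (\<Inter>m. \<Union>k. E m k)"
  have "?N = M"
  proof (rule set_eqI)
    fix x
    have lim: "(e x \<longlongrightarrow> c - a - b) (at 0)" if "(quot f u x \<longlongrightarrow> a) (at 0)" "(quot f v x \<longlongrightarrow> b) (at 0)"
      "(quot f (u + v) x \<longlongrightarrow> c) (at 0)" for a b c
      unfolding e_def using that by (intro tendsto_intros)
    have "x \<in> ?N" if x: "x \<in> M"
    proof -
      obtain a b c where abc: "(quot f u x \<longlongrightarrow> a) (at 0)" "(quot f v x \<longlongrightarrow> b) (at 0)" "(quot f (u + v) x \<longlongrightarrow> c) (at 0)"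
        using x by (auto simp: M_def D_def)
      have "c \<noteq> a + b"
      proof
        assume "c = a + b"
        then have "(e x \<longlongrightarrow> 0) (at 0)" using lim[OF abc] by simp
        then show False using e0 x by (auto simp: M_def)
      qed
      then show ?thesis using abc by blast
    qed
    moreover have "x \<in> M" if x: "x \<in> ?N"
    proof -
      obtain a b c where abc: "(quot f u x \<longlongrightarrow> a) (at 0)" "(quot f v x \<longlongrightarrow> b) (at 0)" "(quot f (u + v) x \<longlongrightarrow> c) (at 0)"
        "c \<noteq> a + b"
        using x by blast
      have "\<not> (e x \<longlongrightarrow> 0) (at 0)"
        using LIM_unique[OF lim[OF abc(1-3)], of 0] abc(4) by auto
      then have "x \<notin> (\<Inter>m. \<Union>k. E m k)" using e1 by blast
      then show ?thesis using abc unfolding M_def D_def by blast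
    qed
    ultimately show "x \<in> ?N \<longleftrightarrow> x \<in> M" by blast
  qed
  moreover have "negligible M"
  proof (rule negligible_if_negligible_on_lines[of _ u])
    show "M \<in> sets borel" unfolding M_def using D Z by auto
    fix x0
    \<comment> \<open>The rational \<open>z\<close> pins the quotient along \<open>v\<close> down to
      a third of the bound on the defect, at all scales below \<open>1 / Suc k\<close>. Countably
      many triples \<open>m\<close>, \<open>k\<close>, \<open>z\<close> exhaust the bad points of
      the line.\<close>
    define S where "S m k z = {\<tau>::real. \<forall>t. 0 < \<bar>t\<bar> \<and> \<bar>t\<bar> < 1 / Suc k \<longrightarrow>
        \<bar>quot f v (x0 + \<tau> *\<^sub>R u) t - of_rat z\<bar> \<le> 1 / Suc m / 3 \<and> \<bar>e (x0 + \<tau> *\<^sub>R u) t\<bar> > 1 / Suc m}"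
      for m k :: nat and z :: rat
    \<comment> \<open>Two close points of S m k z differ by a step t u, along which the derivative in direction v
        hardly changes; this bounds the defect of additivity e by 2/3 of its assumed lower bound.\<close>
    have sep: "1 / Suc k \<le> \<bar>\<tau> - \<sigma>\<bar>" if st: "\<sigma> \<in> S m k z" "\<tau> \<in> S m k z" "\<sigma> \<noteq> \<tau>" for m k z \<sigma> \<tau>
    proof (rule ccontr)
      assume not_le: "\<not> 1 / real (Suc k) \<le> \<bar>\<tau> - \<sigma>\<bar>"
      define t where "t = \<tau> - \<sigma>"
      define d where "d = 1 / real (Suc m)"
      have t: "0 < \<bar>t\<bar>" "\<bar>t\<bar> < 1 / Suc k" using not_le st(3) by (auto simp: t_def)
      define x where "x = x0 + \<sigma> *\<^sub>R u"
      have x': "x0 + \<tau> *\<^sub>R u = x + t *\<^sub>R u" by (simp add: x_def t_def algebra_simps)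
      have "\<bar>quot f v x t - of_rat z\<bar> \<le> d / 3 \<and> \<bar>e x t\<bar> > d"
        using st(1) t unfolding S_def mem_Collect_eq d_def x_def by blast
      moreover have "\<bar>quot f v (x + t *\<^sub>R u) t - of_rat z\<bar> \<le> d / 3"
        using st(2) t unfolding S_def mem_Collect_eq d_def x'[symmetric] by blast
      moreover have "e x t = quot f v (x + t *\<^sub>R u) t - quot f v x t"
        unfolding e_def quot_def by (simp add: algebra_simps add_divide_distrib diff_divide_distrib)
      moreover have "d > 0" by (simp add: d_def)
      ultimately show False by linarith
    qed
    have "countable (S m k z)" for m k z
    proof (rule countableI'[where f = "\<lambda>\<tau>::real. \<lfloor>\<tau> * real (Suc k)\<rfloor>"])
      show "inj_on (\<lambda>\<tau>::real. \<lfloor>\<tau> * real (Suc k)\<rfloor>) (S m k z)"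
      proof (rule inj_onI, rule ccontr)
        fix \<sigma> \<tau> assume st: "\<sigma> \<in> S m k z" "\<tau> \<in> S m k z" "\<lfloor>\<sigma> * real (Suc k)\<rfloor> = \<lfloor>\<tau> * real (Suc k)\<rfloor>" "\<sigma> \<noteq> \<tau>"
        have "1 \<le> \<bar>\<tau> - \<sigma>\<bar> * real (Suc k)" using sep[OF st(1,2,4)] by (simp add: field_simps)
        also have "\<dots> = \<bar>\<tau> * real (Suc k) - \<sigma> * real (Suc k)\<bar>"
          by (simp only: left_diff_distrib[symmetric] abs_mult)
        finally show False
          using st(3) floor_correct[of "\<sigma> * real (Suc k)"] floor_correct[of "\<tau> * real (Suc k)"] by linarith
      qed
    qed
    moreover have "{\<tau>. x0 + \<tau> *\<^sub>R u \<in> M} \<subseteq> (\<Union>m. \<Union>k. \<Union>z. S m k z)"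
    proof
      fix \<tau> assume "\<tau> \<in> {\<tau>. x0 + \<tau> *\<^sub>R u \<in> M}"
      then have "x0 + \<tau> *\<^sub>R u \<in> ?N" using \<open>?N = M\<close> by simp
      then obtain a b c where abc: "(quot f u (x0 + \<tau> *\<^sub>R u) \<longlongrightarrow> a) (at 0)"
        "(quot f v (x0 + \<tau> *\<^sub>R u) \<longlongrightarrow> b) (at 0)" "(quot f (u + v) (x0 + \<tau> *\<^sub>R u) \<longlongrightarrow> c) (at 0)" "c \<noteq> a + b"
        by blast
      have lim: "(e (x0 + \<tau> *\<^sub>R u) \<longlongrightarrow> c - a - b) (at 0)"
        unfolding e_def using abc by (intro tendsto_intros)
      have "\<bar>c - a - b\<bar> > 0" using abc(4) by simp
      then obtain m :: nat where m: "1 / Suc m < \<bar>c - a - b\<bar>" by (rule nat_approx_posE)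
      define d where "d = 1 / real (Suc m)"
      have d: "d > 0" by (simp add: d_def)
      obtain z where "b - d / 6 < of_rat z" "of_rat z < b + d / 6"
        using of_rat_dense[of "b - d / 6" "b + d / 6"] d by auto
      then have z: "\<bar>b - of_rat z\<bar> < d / 6" by linarith
      obtain r1 where r1: "r1 > 0" "\<And>t. t \<noteq> 0 \<Longrightarrow> \<bar>t\<bar> < r1 \<Longrightarrow> \<bar>quot f v (x0 + \<tau> *\<^sub>R u) t - b\<bar> < d / 6"
        using LIM_D[OF abc(2), of "d/6"] d by auto
      obtain r2 where r2: "r2 > 0" "\<And>t. t \<noteq> 0 \<Longrightarrow> \<bar>t\<bar> < r2 \<Longrightarrow> \<bar>e (x0 + \<tau> *\<^sub>R u) t - (c - a - b)\<bar> < \<bar>c - a - b\<bar> - d"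
        using LIM_D[OF lim, of "\<bar>c - a - b\<bar> - d"] m by (auto simp: d_def)
      have "min r1 r2 > 0" using r1 r2 by simp
      then obtain k :: nat where k: "1 / Suc k < min r1 r2" by (rule nat_approx_posE)
      have "\<tau> \<in> S m k z"
        unfolding S_def mem_Collect_eq d_def[symmetric]
      proof (intro allI impI)
        fix t assume t: "0 < \<bar>t\<bar> \<and> \<bar>t\<bar> < 1 / Suc k"
        have "\<bar>quot f v (x0 + \<tau> *\<^sub>R u) t - b\<bar> < d / 6" by (rule r1(2)) (use t k in auto)
        moreover have "\<bar>e (x0 + \<tau> *\<^sub>R u) t - (c - a - b)\<bar> < \<bar>c - a - b\<bar> - d" by (rule r2(2)) (use t k in auto)
        ultimately show "\<bar>quot f v (x0 + \<tau> *\<^sub>R u) t - of_rat z\<bar> \<le> d / 3 \<and> d < \<bar>e (x0 + \<tau> *\<^sub>R u) t\<bar>"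
          using z by linarith
      qed
      then show "\<tau> \<in> (\<Union>m. \<Union>k. \<Union>z. S m k z)" by blast
    qed
    ultimately have "countable {\<tau>. x0 + \<tau> *\<^sub>R u \<in> M}"
      by (meson countable_UN countable_subset countableI_type)
    then show "negligible {\<tau>. x0 + \<tau> *\<^sub>R u \<in> M}"
      using countable_imp_null_set_lborel null_sets_completionI negligible_iff_null_sets by blast
  qed
  ultimately show ?thesis by simp
qed

text \<open>Countable, dense and closed under addition: countably many exceptional null sets then
  cover all the directions and pairs of directions that matter.\<close>

definition rat_vecs :: "'a::euclidean_space set" where
  "rat_vecs = {v. \<forall>i\<in>Basis. v \<bullet> i \<in> \<rat>}"

lemma countable_rat_vecs: "countable (rat_vecs :: 'a::euclidean_space set)"
proof (rule countable_subset)
  show "(rat_vecs :: 'a set) \<subseteq> (\<lambda>g. \<Sum>i\<in>Basis. g i *\<^sub>R i) ` (Basis \<rightarrow>\<^sub>E (\<rat>::real set))"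
  proof
    fix v :: 'a assume v: "v \<in> rat_vecs"
    have "v = (\<Sum>i\<in>Basis. restrict (\<lambda>i. v \<bullet> i) Basis i *\<^sub>R i)"
      by (simp add: euclidean_representation)
    moreover have "restrict (\<lambda>i. v \<bullet> i) Basis \<in> Basis \<rightarrow>\<^sub>E \<rat>" using v by (auto simp: rat_vecs_def)
    ultimately show "v \<in> (\<lambda>g. \<Sum>i\<in>Basis. g i *\<^sub>R i) ` (Basis \<rightarrow>\<^sub>E (\<rat>::real set))" by blast
  qed
  show "countable ((\<lambda>g. \<Sum>i\<in>Basis. g i *\<^sub>R i :: 'a) ` (Basis \<rightarrow>\<^sub>E (\<rat>::real set)))"
    by (intro countable_image countable_PiE countable_rat finite_Basis)
qed

lemma rat_vecs_dense:
  fixes x :: "'a::euclidean_space"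
  assumes "e > 0"
  shows "\<exists>v\<in>rat_vecs. norm (x - v) < e"
proof -
  define d where "d = e / (2 * DIM('a))"
  have d: "d > 0" using assms by (simp add: d_def)
  have "\<exists>q::rat. \<bar>x \<bullet> i - of_rat q\<bar> < d" for i
  proof -
    obtain q where "x \<bullet> i - d < of_rat q" "of_rat q < x \<bullet> i + d" using of_rat_dense[of "x \<bullet> i - d" "x \<bullet> i + d"] d by auto
    then show ?thesis by (intro exI[of _ q]) auto
  qed
  then obtain q :: "'a \<Rightarrow> rat" where q: "\<And>i. \<bar>x \<bullet> i - of_rat (q i)\<bar> < d" by metis
  define v where "v = (\<Sum>i\<in>Basis. of_rat (q i) *\<^sub>R i :: 'a)"
  have vi: "v \<bullet> i = of_rat (q i)" if "i \<in> Basis" for i using that by (simp add: v_def)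
  have "norm (x - v) \<le> (\<Sum>i\<in>Basis. \<bar>(x - v) \<bullet> i\<bar>)" by (rule norm_le_l1)
  also have "\<dots> \<le> (\<Sum>i\<in>(Basis::'a set). d)"
    using q vi by (intro sum_mono) (simp add: inner_diff_left less_imp_le)
  also have "\<dots> < e" using assms by (simp add: d_def)
  finally have "norm (x - v) < e" .
  moreover have "v \<in> rat_vecs" by (simp add: rat_vecs_def vi)
  ultimately show ?thesis by blast
qed

text \<open>Additivity on rational directions forces linearity there, since homogeneity holds
  wherever both vectors are rational. Uniformity in the direction comes from a finite rational net
  of the unit sphere; the Lipschitz bound transfers the estimate to directions off the net.\<close>

lemma differentiable_if_directional_derivatives_additive:
  fixes f :: "'a::euclidean_space \<Rightarrow> real"
  assumes L: "\<And>x y. \<bar>f x - f y\<bar> \<le> L * norm (x - y)"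
    and l: "\<And>v. v \<in> rat_vecs \<Longrightarrow> (quot f v x \<longlongrightarrow> l v) (at 0)"
    and add: "\<And>u v. u \<in> rat_vecs \<Longrightarrow> v \<in> rat_vecs \<Longrightarrow> l (u + v) = l u + l v"
  shows "f differentiable (at x)"
proof -
  note L0 = Lipschitz_bound_nonneg[OF L]
  have zero: "(0::'a) \<in> rat_vecs" by (simp add: rat_vecs_def)
  then have l0: "l 0 = 0" using add[of 0 0] by simp
  have basis: "c *\<^sub>R i \<in> rat_vecs" if "i \<in> Basis" "c \<in> \<rat>" for i :: 'a and c
    using that by (auto simp: rat_vecs_def inner_Basis)
  have scale: "l (c *\<^sub>R v) = c * l v" if v: "v \<in> rat_vecs" "c *\<^sub>R v \<in> rat_vecs" for c v
  proof (cases "c = 0")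
    case False
    have "((\<lambda>t. c * quot f v x (c * t)) \<longlongrightarrow> c * l v) (at 0)"
    proof (rule tendsto_mult_left)
      have "filterlim (\<lambda>t. c * t) (at 0) (at 0)"
        using False by (intro filterlim_atI tendsto_eq_intros) (auto simp: eventually_at_filter intro!: tendsto_eq_intros)
      then show "((\<lambda>t. quot f v x (c * t)) \<longlongrightarrow> l v) (at 0)"
        using l[OF v(1)] filterlim_compose by blast
    qed
    moreover have "c * quot f v x (c * t) = quot f (c *\<^sub>R v) x t" for t
      using False by (simp add: quot_def mult.commute)
    ultimately have "(quot f (c *\<^sub>R v) x \<longlongrightarrow> c * l v) (at 0)" by simp
    then show ?thesis using l[OF v(2)] LIM_unique by blast
  qed (simp add: l0)
  define T where "T w = (\<Sum>i\<in>Basis. (w \<bullet> i) * l i)" for w :: 'a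
  have T: "bounded_linear T" unfolding T_def
    by (intro bounded_linear_sum bounded_linear_mult_const bounded_linear_inner_left)
  have lT: "l v = T v" if v: "v \<in> rat_vecs" for v
  proof -
    have "(\<Sum>i\<in>B. (v \<bullet> i) *\<^sub>R i) \<in> rat_vecs \<and> l (\<Sum>i\<in>B. (v \<bullet> i) *\<^sub>R i) = (\<Sum>i\<in>B. (v \<bullet> i) * l i)"
      if "finite B" "B \<subseteq> Basis" for B
      using that
    proof (induction B rule: finite_induct)
      case empty
      then show ?case using zero l0 by simp
    next
      case (insert i B)
      have i: "i \<in> Basis" "v \<bullet> i \<in> \<rat>" using insert v by (auto simp: rat_vecs_def)
      have "i \<in> rat_vecs" using basis[OF i(1), of 1] by simp
      then have "l ((v \<bullet> i) *\<^sub>R i) = (v \<bullet> i) * l i" using scale basis[OF i] by blast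
      moreover have IH: "(\<Sum>i\<in>B. (v \<bullet> i) *\<^sub>R i) \<in> rat_vecs" "l (\<Sum>i\<in>B. (v \<bullet> i) *\<^sub>R i) = (\<Sum>i\<in>B. (v \<bullet> i) * l i)"
        using insert by auto
      moreover have "(v \<bullet> i) *\<^sub>R i + (\<Sum>i\<in>B. (v \<bullet> i) *\<^sub>R i) \<in> rat_vecs"
        using IH(1) basis[OF i] by (auto simp: rat_vecs_def inner_add_left intro!: Rats_add)
      ultimately show ?case using insert(1,2) add[OF basis[OF i] IH(1)] by simp
    qed
    from this[OF finite_Basis] show ?thesis by (simp add: T_def euclidean_representation)
  qed
  obtain K where K: "K > 0" "\<And>w. \<bar>T w\<bar> \<le> norm w * K" using bounded_linear.pos_bounded[OF T] by auto
  have "(f has_derivative T) (at x)"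
    unfolding has_derivative_at_alt
  proof (intro conjI T allI impI)
    fix e :: real assume e: "e > 0"
    \<comment> \<open>Moving from a direction to the net costs at most
      \<open>(L + K) * \<eta>\<close> per unit length, \<open>L\<close> for \<open>f\<close> and
      \<open>K\<close> for \<open>T\<close>; this may use up half of \<open>e\<close>.\<close>
    define \<eta> where "\<eta> = e / (2 * (L + K + 1))"
    have \<eta>: "\<eta> > 0" using e L0 K by (simp add: \<eta>_def)
    have "\<eta> * (L + K + 1) = e / 2" using L0 K by (simp add: \<eta>_def field_simps)
    then have \<eta>': "(L + K) * \<eta> \<le> e / 2" using \<eta> by (simp add: algebra_simps)
    have "sphere (0::'a) 1 \<subseteq> (\<Union>w\<in>rat_vecs. ball w \<eta>)"
      using rat_vecs_dense[OF \<eta>] by (force simp: dist_norm norm_minus_commute)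
    then obtain W where W: "W \<subseteq> rat_vecs" "finite W" "sphere (0::'a) 1 \<subseteq> (\<Union>w\<in>W. ball w \<eta>)"
      using compactE_image[OF compact_sphere, of rat_vecs "\<lambda>w. ball w \<eta>" 0 1] by auto
    have "\<forall>w\<in>W. \<exists>d>0. \<forall>t. t \<noteq> 0 \<and> \<bar>t\<bar> < d \<longrightarrow> \<bar>quot f w x t - l w\<bar> < e / 2"
      using LIM_D[OF l, of _ "e/2"] W(1) e by (auto simp: subset_iff)
    then obtain d where d: "\<And>w. w \<in> W \<Longrightarrow> d w > 0 \<and> (\<forall>t. t \<noteq> 0 \<and> \<bar>t\<bar> < d w \<longrightarrow> \<bar>quot f w x t - l w\<bar> < e / 2)"
      by metis
    define D where "D = Min (insert 1 (d ` W))"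
    have D: "D > 0" "\<And>w. w \<in> W \<Longrightarrow> D \<le> d w" using W(2) d by (auto simp: D_def)
    show "\<exists>D>0. \<forall>y. norm (y - x) < D \<longrightarrow> norm (f y - f x - T (y - x)) \<le> e * norm (y - x)"
    proof (intro exI[of _ D] conjI D(1) allI impI)
      fix y assume y: "norm (y - x) < D"
      show "norm (f y - f x - T (y - x)) \<le> e * norm (y - x)"
      proof (cases "y = x")
        case True
        then show ?thesis using linear_0[OF bounded_linear.linear[OF T]] by simp
      next
        case False
        define t where "t = norm (y - x)"
        have t: "t > 0" using False by (simp add: t_def)
        define s where "s = (y - x) /\<^sub>R t"
        have y': "y = x + t *\<^sub>R s" using t by (simp add: s_def)
        have "s \<in> sphere 0 1" using t by (simp add: s_def t_def)
        then obtain w where w: "w \<in> W" "norm (s - w) < \<eta>"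
          using W(3) by (auto simp: dist_norm norm_minus_commute)
        have "\<bar>quot f w x t - T w\<bar> < e / 2"
          using d[OF w(1)] D(2)[OF w(1)] y t lT w(1) W(1) by (auto simp: t_def)
        then have 1: "\<bar>f (x + t *\<^sub>R w) - f x - t * T w\<bar> \<le> e / 2 * t"
        proof -
          have "f (x + t *\<^sub>R w) - f x - t * T w = t * (quot f w x t - T w)"
            using t by (simp add: quot_def field_simps)
          then show ?thesis using \<open>\<bar>quot f w x t - T w\<bar> < e / 2\<close> t by (simp add: abs_mult)
        qed
        have n: "norm (t *\<^sub>R s - t *\<^sub>R w) \<le> \<eta> * t"
          using w(2) t by (simp flip: scaleR_diff_right)
        have 2: "\<bar>f y - f (x + t *\<^sub>R w)\<bar> \<le> L * (\<eta> * t)"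
          using L[of y "x + t *\<^sub>R w"] mult_left_mono[OF n L0] by (simp add: y')
        have "T (t *\<^sub>R s) - t * T w = T (t *\<^sub>R s - t *\<^sub>R w)"
          using bounded_linear.linear[OF T] by (simp add: linear_diff linear_scale)
        then have 3: "\<bar>T (t *\<^sub>R s) - t * T w\<bar> \<le> \<eta> * t * K"
          using K(2)[of "t *\<^sub>R s - t *\<^sub>R w"] mult_right_mono[OF n, of K] K(1) by linarith
        have "\<bar>f y - f x - T (y - x)\<bar> \<le> e / 2 * t + L * (\<eta> * t) + \<eta> * t * K"
        proof -
          have "T (y - x) = T (t *\<^sub>R s)" by (simp add: y')
          then show ?thesis using 1 2 3 by linarith
        qed
        also have "\<dots> = (e / 2 + (L + K) * \<eta>) * t" by (simp add: algebra_simps)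
        also have "\<dots> \<le> e * t" using \<eta>' t by (intro mult_right_mono) auto
        finally show ?thesis by (simp add: t_def)
      qed
    qed
  qed
  then show ?thesis unfolding differentiable_def by blast
qed

lemma Rademacher_real:
  fixes f :: "'a::euclidean_space \<Rightarrow> real"
  assumes L: "\<And>x y. \<bar>f x - f y\<bar> \<le> L * norm (x - y)"
  shows "negligible {x. \<not> f differentiable (at x)}"
proof -
  let ?D = "\<lambda>v. {x. \<nexists>l. (quot f v x \<longlongrightarrow> l) (at 0)}"
  let ?A = "\<lambda>u v. {x. \<exists>a b c. (quot f u x \<longlongrightarrow> a) (at 0) \<and> (quot f v x \<longlongrightarrow> b) (at 0)
    \<and> (quot f (u + v) x \<longlongrightarrow> c) (at 0) \<and> c \<noteq> a + b}"
  define N where "N = (\<Union>v\<in>rat_vecs. ?D v) \<union> (\<Union>p\<in>rat_vecs \<times> rat_vecs. ?A (fst p) (snd p))"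
  have "negligible N"
    unfolding N_def
  proof (intro negligible_Un negligible_countable_Union countable_image countable_SIGMA countable_rat_vecs)
    show "negligible S" if "S \<in> ?D ` rat_vecs" for S
      using that Lipschitz_ae_directional_derivative(2)[OF L] by blast
    show "negligible S" if "S \<in> (\<lambda>p. ?A (fst p) (snd p)) ` (rat_vecs \<times> rat_vecs)" for S
      using that Lipschitz_ae_additive_derivative[OF L] by blast
  qed
  moreover have "f differentiable (at x)" if x: "x \<notin> N" for x
  proof -
    have "\<forall>v\<in>rat_vecs. \<exists>l. (quot f v x \<longlongrightarrow> l) (at 0)" using x by (auto simp: N_def)
    then obtain l where l: "\<And>v. v \<in> rat_vecs \<Longrightarrow> (quot f v x \<longlongrightarrow> l v) (at 0)" by metis
    show ?thesis
    proof (rule differentiable_if_directional_derivatives_additive[OF L l])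
      fix u v :: 'a assume uv: "u \<in> rat_vecs" "v \<in> rat_vecs"
      then have "u + v \<in> rat_vecs" by (auto simp: rat_vecs_def inner_add_left)
      then have "(quot f (u + v) x \<longlongrightarrow> l (u + v)) (at 0)" by (rule l)
      moreover have "x \<notin> ?A u v"
        using UN_upper[of "(u, v)" "rat_vecs \<times> rat_vecs" "\<lambda>p. ?A (fst p) (snd p)"] x uv
        unfolding N_def fst_conv snd_conv by blast
      ultimately show "l (u + v) = l u + l v" using l uv by blast
    qed auto
  qed
  ultimately show ?thesis by - (rule negligible_subset, assumption, blast)
qed

theorem Rademacher:
  fixes f :: "'a::euclidean_space \<Rightarrow> 'b::euclidean_space"
  assumes L: "\<And>x y. norm (f x - f y) \<le> L * norm (x - y)"
  shows "negligible {x. \<not> f differentiable (at x)}"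
proof -
  have "negligible (\<Union>i\<in>Basis. {x. \<not> (\<lambda>x. f x \<bullet> i) differentiable (at x)})"
  proof (rule negligible_Union)
    fix t assume "t \<in> (\<lambda>i. {x. \<not> (\<lambda>x. f x \<bullet> i) differentiable (at x)}) ` Basis"
    then obtain i where i: "i \<in> Basis" "t = {x. \<not> (\<lambda>x. f x \<bullet> i) differentiable (at x)}" by blast
    have "\<bar>f x \<bullet> i - f y \<bullet> i\<bar> \<le> L * norm (x - y)" for x y
      using L[of x y] Basis_le_norm[OF i(1), of "f x - f y"] by (simp add: inner_diff_left)
    then show "negligible t" unfolding i(2) by (rule Rademacher_real)
  qed auto
  moreover have "{x. \<not> f differentiable (at x)} \<subseteq> (\<Union>i\<in>Basis. {x. \<not> (\<lambda>x. f x \<bullet> i) differentiable (at x)})"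
    using differentiable_componentwise_within[of f _ UNIV] by auto
  ultimately show ?thesis by (rule negligible_subset)
qed

section \<open>Second order differentiability of convex functions\<close>

definition subgrad :: "('a::real_inner \<Rightarrow> real) \<Rightarrow> 'a \<Rightarrow> 'a \<Rightarrow> bool" where
  "subgrad f x p \<longleftrightarrow> (\<forall>y. f x + p \<bullet> (y - x) \<le> f y)"

lemma subgradD: "subgrad f x p \<Longrightarrow> f x + p \<bullet> (y - x) \<le> f y"
  by (simp add: subgrad_def)

text \<open>Convexity and a global Lipschitz bound in one condition, in the form of supporting
  planes.\<close>

definition bounded_subgrads :: "real \<Rightarrow> ('a::real_inner \<Rightarrow> real) \<Rightarrow> bool" where
  "bounded_subgrads R f \<longleftrightarrow> (\<forall>x. \<exists>p. norm p \<le> R \<and> subgrad f x p)"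

lemma bounded_subgrads_Lipschitz:
  assumes "bounded_subgrads R f"
  shows "\<bar>f x - f y\<bar> \<le> R * norm (x - y)"
proof -
  have "f x - f y \<le> R * norm (x - y)" for x y
  proof -
    obtain p where p: "norm p \<le> R" "subgrad f x p" using assms by (auto simp: bounded_subgrads_def)
    have "f x - f y \<le> p \<bullet> (x - y)" using subgradD[OF p(2), of y] by (simp add: inner_diff_right)
    also have "\<dots> \<le> norm p * norm (x - y)" by (rule norm_cauchy_schwarz)
    also have "\<dots> \<le> R * norm (x - y)" using p(1) by (intro mult_right_mono) auto
    finally show ?thesis .
  qed
  from this[of x y] this[of y x] show ?thesis by (simp add: norm_minus_commute abs_le_iff)
qed

lemma bounded_subgrads_continuous_on:
  fixes f :: "'a::euclidean_space \<Rightarrow> real"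
  assumes "bounded_subgrads R f"
  shows "continuous_on S f"
  using bounded_subgrads_Lipschitz[OF assms] by (rule Lipschitz_bound_imp_continuous_on)

lemma norm_add_scaleR_sq:
  fixes a b :: "'a::real_inner"
  shows "(norm (a + s *\<^sub>R b))\<^sup>2 = (norm a)\<^sup>2 + 2 * s * (a \<bullet> b) + s\<^sup>2 * (norm b)\<^sup>2"
  unfolding power2_norm_eq_inner by (simp add: inner_simps inner_commute algebra_simps power2_eq_square)

text \<open>Minty: the minimizer \<open>x\<close> of \<open>f x + (norm (x - z))\<^sup>2 / 2\<close> is the point sought.\<close>

lemma prox_exists:
  fixes f :: "'a::euclidean_space \<Rightarrow> real"
  assumes S: "bounded_subgrads R f"
  shows "\<exists>x. subgrad f x (z - x)"
proof -
  have R0: "0 \<le> R" using S by (meson bounded_subgrads_def norm_ge_zero order_trans)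
  let ?F = "\<lambda>x. f x + (norm (x - z))\<^sup>2 / 2"
  \<comment> \<open>Outside the ball of radius \<open>2 * R + 1\<close> the quadratic term exceeds
    the Lipschitz loss, so a minimizer over the ball is a global one.\<close>
  have "continuous_on (cball z (2 * R + 1)) ?F"
    by (intro continuous_intros bounded_subgrads_continuous_on[OF S]) auto
  moreover have "cball z (2 * R + 1) \<noteq> {}" using R0 by simp
  ultimately obtain x where x: "x \<in> cball z (2 * R + 1)" "\<And>y. y \<in> cball z (2 * R + 1) \<Longrightarrow> ?F x \<le> ?F y"
    using continuous_attains_inf[of "cball z (2*R+1)" ?F] by auto
  have min: "?F x \<le> ?F y" for y
  proof (cases "y \<in> cball z (2 * R + 1)")
    case False
    then have n: "norm (y - z) > 2 * R + 1" by (simp add: dist_norm norm_minus_commute)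
    have "R * norm (y - z) \<le> norm (y - z) * norm (y - z) / 2"
      using n mult_right_mono[of "2 * R" "norm (y - z)" "norm (y - z)"] by simp
    then have "f z \<le> ?F y"
      using bounded_subgrads_Lipschitz[OF S, of z y] by (simp add: norm_minus_commute power2_eq_square)
    moreover have "?F x \<le> f z" using x(2)[of z] R0 by simp
    ultimately show ?thesis by simp
  qed (use x in auto)
  have "f x + (z - x) \<bullet> (y - x) \<le> f y" for y
  proof -
    \<comment> \<open>Moving from the minimizer a fraction \<open>s\<close> towards y and dividing
      by \<open>s\<close> leaves an error of order \<open>s\<close>. Convexity of \<open>f\<close>
      on the segment is read off a subgradient at the intermediate point.\<close>
    have "f x + (z - x) \<bullet> (y - x) \<le> f y + s * ((norm (y - x))\<^sup>2 / 2)" if s: "0 < s" "s < 1" for s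
    proof -
      define w where "w = x + s *\<^sub>R (y - x)"
      obtain p where p: "subgrad f w p" using S by (auto simp: bounded_subgrads_def)
      have wx: "x - w = (- s) *\<^sub>R (y - x)" by (simp add: w_def)
      have wy: "y - w = (1 - s) *\<^sub>R (y - x)" by (simp add: w_def algebra_simps)
      have "f w - s * (p \<bullet> (y - x)) \<le> f x" using subgradD[OF p, of x] unfolding wx by simp
      then have a: "(1 - s) * (f w - s * (p \<bullet> (y - x))) \<le> (1 - s) * f x" using s by (intro mult_left_mono) auto
      have "f w + (1 - s) * (p \<bullet> (y - x)) \<le> f y" using subgradD[OF p, of y] unfolding wy by simp
      then have b: "s * (f w + (1 - s) * (p \<bullet> (y - x))) \<le> s * f y" using s by (intro mult_left_mono) auto
      have conv: "f w \<le> (1 - s) * f x + s * f y" using a b by (simp add: algebra_simps)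
      have wz: "w - z = (x - z) + s *\<^sub>R (y - x)" by (simp add: w_def)
      have neg: "(x - z) \<bullet> (y - x) = - ((z - x) \<bullet> (y - x))" by (metis inner_minus_left minus_diff_eq)
      have "(norm (w - z))\<^sup>2 = (norm (x - z))\<^sup>2 - 2 * s * ((z - x) \<bullet> (y - x)) + s\<^sup>2 * (norm (y - x))\<^sup>2"
        unfolding wz norm_add_scaleR_sq neg by simp
      from min[of w, unfolded this] conv
      have "f x \<le> (1 - s) * f x + s * f y - s * ((z - x) \<bullet> (y - x)) + s\<^sup>2 * (norm (y - x))\<^sup>2 / 2"
        by argo
      then have "s * (f x + (z - x) \<bullet> (y - x)) \<le> s * (f y + s * ((norm (y - x))\<^sup>2 / 2))"
        by (simp add: algebra_simps power2_eq_square)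
      then show ?thesis using s by simp
    qed
    note * = this
    have "((\<lambda>s. f y + s * ((norm (y - x))\<^sup>2 / 2)) \<longlongrightarrow> f y + 0 * ((norm (y - x))\<^sup>2 / 2)) (at_right 0)"
      by (intro tendsto_intros)
    moreover have "\<forall>\<^sub>F s in at_right (0::real). f x + (z - x) \<bullet> (y - x) \<le> f y + s * ((norm (y - x))\<^sup>2 / 2)"
      using * by (auto simp: eventually_at_right_field intro!: exI[of _ 1])
    ultimately show ?thesis using tendsto_lowerbound by fastforce
  qed
  then show ?thesis by (auto simp: subgrad_def)
qed

text \<open>Adding the two subgradient inequalities shows that the subdifferential is monotone,
  which makes its resolvent firmly nonexpansive.\<close>

lemma prox_nonexpansive:
  assumes "subgrad f x (z - x)" "subgrad f y (w - y)"
  shows "norm (x - y) \<le> norm (z - w)"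
proof -
  have "(z - x) \<bullet> (y - x) + (w - y) \<bullet> (x - y) \<le> 0"
    using subgradD[OF assms(1), of y] subgradD[OF assms(2), of x] by linarith
  then have "(norm (x - y))\<^sup>2 \<le> (z - w) \<bullet> (x - y)"
    by (simp add: power2_norm_eq_inner inner_simps inner_commute)
  also have "\<dots> \<le> norm (z - w) * norm (x - y)" by (rule norm_cauchy_schwarz)
  finally show ?thesis
    by (metis mult_right_le_imp_le norm_ge_zero not_less order_less_le power2_eq_square zero_less_norm_iff norm_zero mult_zero_right)
qed

text \<open>Walk from \<open>x'\<close> a distance \<open>s\<close> in the direction of
  \<open>p' - p\<close>: the supporting plane at \<open>x'\<close> gains
  \<open>s * norm (p' - p)\<close> over slope \<open>p\<close>, while the paraboloid leaves room for
  \<open>c / 2 * (2 * s)\<^sup>2\<close>. For \<open>x' = x\<close> a small \<open>s\<close> gives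
  uniqueness of the subgradient; otherwise \<open>s\<close> is the distance of the two
  points.\<close>

lemma subgrad_Lipschitz_at_contact:
  assumes p: "subgrad f x p" and up: "\<And>y. y \<in> ball x r \<Longrightarrow> f y \<le> f x + p \<bullet> (y - x) + c / 2 * (norm (y - x))\<^sup>2"
    and c: "c > 0" and p': "subgrad f x' p'" and x': "norm (x' - x) < r / 2"
  shows "norm (p' - p) \<le> 2 * c * norm (x' - x)"
proof (cases "p' = p")
  case False
  have *: "norm (p' - p) \<le> 2 * c * s" if s: "s > 0" "norm (x' - x) \<le> s" "s < r / 2" for s
  proof -
    define u where "u = (p' - p) /\<^sub>R norm (p' - p)"
    have u: "norm u = 1" "(p' - p) \<bullet> u = norm (p' - p)"
      using False by (auto simp: u_def dot_square_norm power2_eq_square)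
    define y where "y = x' + s *\<^sub>R u"
    have "norm (y - x) \<le> norm (x' - x) + norm (s *\<^sub>R u)" unfolding y_def by (metis add_diff_eq add.commute norm_triangle_ineq)
    then have yx: "norm (y - x) \<le> 2 * s" using s u by simp
    then have "y \<in> ball x r" using s by (simp add: dist_norm norm_minus_commute)
    then have "f y \<le> f x + p \<bullet> (y - x) + c / 2 * (norm (y - x))\<^sup>2" by (rule up)
    moreover have "f x' + p' \<bullet> (y - x') \<le> f y" using p' by (rule subgradD)
    moreover have "f x + p \<bullet> (x' - x) \<le> f x'" using p by (rule subgradD)
    moreover have "p \<bullet> (y - x) = p \<bullet> (y - x') + p \<bullet> (x' - x)" by (simp add: inner_diff_right)
    ultimately have "(p' - p) \<bullet> (y - x') \<le> c / 2 * (norm (y - x))\<^sup>2" by (simp add: inner_diff_left)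
    also have "\<dots> \<le> c / 2 * (2 * s)\<^sup>2" using c yx by (intro mult_left_mono power_mono) auto
    finally have "s * norm (p' - p) \<le> s * (2 * c * s)" using u(2) by (simp add: y_def power2_eq_square algebra_simps)
    then show ?thesis using s(1) by simp
  qed
  show ?thesis
  proof (cases "x' = x")
    case True
    define s where "s = min (r / 4) (norm (p' - p) / (4 * c))"
    have s: "s > 0" "s < r / 2" using True x' c False by (auto simp: s_def)
    have "norm (p' - p) \<le> 2 * c * s" using * s True by simp
    also have "\<dots> \<le> 2 * c * (norm (p' - p) / (4 * c))" using c by (intro mult_left_mono) (auto simp: s_def)
    also have "\<dots> = norm (p' - p) / 2" using c by simp
    finally show ?thesis using False by simp
  next
    case False
    then show ?thesis using *[of "norm (x' - x)"] x' by simp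
  qed
qed (use c in auto)

text \<open>Over \<open>Suc n\<close> equal pieces the quadratic part contributes only
  \<open>b / Suc n\<close>. This stands in for integrating a derivative that may fail to exist on
  the segment.\<close>

lemma telescoping_bound:
  fixes e :: "real \<Rightarrow> real"
  assumes e: "\<And>s t. 0 \<le> s \<Longrightarrow> s \<le> t \<Longrightarrow> t \<le> 1 \<Longrightarrow> \<bar>e t - e s\<bar> \<le> (t - s) * (a + b * (t - s))"
  shows "\<bar>e 1 - e 0\<bar> \<le> a"
proof -
  have N: "\<bar>e 1 - e 0\<bar> \<le> a + b / Suc n" for n
  proof -
    let ?N = "real (Suc n)"
    have "e 1 - e 0 = (\<Sum>k<Suc n. e (Suc k / ?N) - e (k / ?N))"
      by (subst sum_lessThan_telescope[of "\<lambda>k. e (k / ?N)"]) simp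
    also have "\<bar>\<dots>\<bar> \<le> (\<Sum>k<Suc n. \<bar>e (Suc k / ?N) - e (k / ?N)\<bar>)" by (rule sum_abs)
    also have "\<dots> \<le> (\<Sum>k<Suc n. 1 / ?N * (a + b * (1 / ?N)))"
    proof (rule sum_mono)
      fix k assume k: "k \<in> {..<Suc n}"
      have d: "real (Suc k) / ?N - real k / ?N = 1 / ?N" by (simp add: diff_divide_distrib[symmetric])
      have "\<bar>e (Suc k / ?N) - e (k / ?N)\<bar> \<le> (Suc k / ?N - k / ?N) * (a + b * (Suc k / ?N - k / ?N))"
        using k by (intro e) (auto simp: divide_right_mono)
      then show "\<bar>e (Suc k / ?N) - e (k / ?N)\<bar> \<le> 1 / ?N * (a + b * (1 / ?N))" unfolding d .
    qed
    also have "\<dots> = a + b / ?N" by simp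
    finally show ?thesis .
  qed
  have "(\<lambda>n. a + b * inverse (real (Suc n))) \<longlonglongrightarrow> a + b * 0"
    by (intro tendsto_intros LIMSEQ_inverse_real_of_nat)
  then have "(\<lambda>n. a + b / Suc n) \<longlonglongrightarrow> a" by (simp add: divide_inverse)
  then show ?thesis by (rule LIMSEQ_le_const) (use N in blast)
qed

text \<open>A convex function is recovered by integrating its subgradients, so a first order
  expansion of these at x gives a second order one of \<open>f\<close>. Subgradients at the two ends
  of a subinterval bound the increment of the remainder \<open>E\<close> from both sides.\<close>

lemma second_order_expansion_if_subgrad_differentiable:
  fixes f :: "'a::euclidean_space \<Rightarrow> real"
  assumes S: "bounded_subgrads R f" and p: "subgrad f x p" and M: "linear M"
    and D: "\<And>e. e > 0 \<Longrightarrow> \<exists>d>0. \<forall>x' p'. norm (x' - x) < d \<and> subgrad f x' p' \<longrightarrow>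
        norm (p' - p - M (x' - x)) \<le> e * norm (x' - x)"
    and e: "e > 0"
  shows "\<exists>d>0. \<forall>h. norm h < d \<longrightarrow> \<bar>f (x + h) - f x - p \<bullet> h - (h \<bullet> M h) / 2\<bar> \<le> e * (norm h)\<^sup>2"
proof -
  obtain d where d: "d > 0" "\<And>x' p'. norm (x' - x) < d \<Longrightarrow> subgrad f x' p' \<Longrightarrow>
        norm (p' - p - M (x' - x)) \<le> e * norm (x' - x)" using D[OF e] by blast
  show ?thesis
  proof (intro exI[of _ d] conjI d(1) allI impI)
    fix h :: 'a assume h: "norm h < d"
    define E where "E t = f (x + t *\<^sub>R h) - t * (p \<bullet> h) - t\<^sup>2 / 2 * (h \<bullet> M h)" for t
    have bd: "\<bar>(q - p - t *\<^sub>R M h) \<bullet> h\<bar> \<le> e * (norm h)\<^sup>2"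
      if t: "0 \<le> t" "t \<le> 1" and q: "subgrad f (x + t *\<^sub>R h) q" for t q
    proof -
      have th: "norm (t *\<^sub>R h) \<le> norm h" using t by (simp add: mult_left_le_one_le)
      have "norm (q - p - M (t *\<^sub>R h)) \<le> e * norm (t *\<^sub>R h)" using d(2)[of "x + t *\<^sub>R h" q] th h q by simp
      also have "\<dots> \<le> e * norm h" using th e by (intro mult_left_mono) auto
      finally have "norm (q - p - t *\<^sub>R M h) \<le> e * norm h" using M by (simp add: linear_scale)
      then have "norm (q - p - t *\<^sub>R M h) * norm h \<le> e * norm h * norm h" by (intro mult_right_mono) auto
      then show ?thesis using Cauchy_Schwarz_ineq2[of "q - p - t *\<^sub>R M h" h] by (simp add: power2_eq_square)
    qed
    have "\<bar>E t - E s\<bar> \<le> (t - s) * (e * (norm h)\<^sup>2 + \<bar>h \<bullet> M h\<bar> / 2 * (t - s))" if st: "0 \<le> s" "s \<le> t" "t \<le> 1" for s t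
    proof -
      obtain q where q: "subgrad f (x + t *\<^sub>R h) q" using S by (auto simp: bounded_subgrads_def)
      obtain q' where q': "subgrad f (x + s *\<^sub>R h) q'" using S by (auto simp: bounded_subgrads_def)
      have ts: "t - s \<ge> 0" using st by simp
      have F: "f (x + t *\<^sub>R h) - f (x + s *\<^sub>R h) \<le> (t - s) * (q \<bullet> h)"
        using subgradD[OF q, of "x + s *\<^sub>R h"] by (simp add: algebra_simps inner_simps)
      have F': "(t - s) * (q' \<bullet> h) \<le> f (x + t *\<^sub>R h) - f (x + s *\<^sub>R h)"
        using subgradD[OF q', of "x + t *\<^sub>R h"] by (simp add: algebra_simps inner_simps)
      have E: "E t - E s = f (x + t *\<^sub>R h) - f (x + s *\<^sub>R h) - (t - s) * (p \<bullet> h + (t + s) / 2 * (h \<bullet> M h))"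
        by (simp add: E_def field_simps power2_eq_square)
      have i: "(q - p - t *\<^sub>R M h) \<bullet> h = q \<bullet> h - p \<bullet> h - t * (h \<bullet> M h)"
        "(q' - p - s *\<^sub>R M h) \<bullet> h = q' \<bullet> h - p \<bullet> h - s * (h \<bullet> M h)"
        by (simp_all add: inner_diff_left inner_diff_right inner_commute)
      have ring: "(t - s) * ((a - b - t * c) + (t - s) / 2 * c) = (t - s) * a - (t - s) * (b + (t + s) / 2 * c)"
        "(t - s) * ((a - b - s * c) - (t - s) / 2 * c) = (t - s) * a - (t - s) * (b + (t + s) / 2 * c)" for a b c :: real
        by (simp_all add: field_simps)
      have u: "E t - E s \<le> (t - s) * ((q - p - t *\<^sub>R M h) \<bullet> h + (t - s) / 2 * (h \<bullet> M h))"
        and l: "(t - s) * ((q' - p - s *\<^sub>R M h) \<bullet> h - (t - s) / 2 * (h \<bullet> M h)) \<le> E t - E s"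
        unfolding i ring using F F' E by linarith+
      have "\<bar>(t - s) / 2 * (h \<bullet> M h)\<bar> = \<bar>h \<bullet> M h\<bar> / 2 * (t - s)" using ts by (simp add: abs_mult)
      then have "(q - p - t *\<^sub>R M h) \<bullet> h + (t - s) / 2 * (h \<bullet> M h) \<le> e * (norm h)\<^sup>2 + \<bar>h \<bullet> M h\<bar> / 2 * (t - s)"
        "- (e * (norm h)\<^sup>2 + \<bar>h \<bullet> M h\<bar> / 2 * (t - s)) \<le> (q' - p - s *\<^sub>R M h) \<bullet> h - (t - s) / 2 * (h \<bullet> M h)"
        using bd[of t q] bd[of s q'] q q' st by (auto simp: abs_le_iff)
      from order_trans[OF u mult_left_mono[OF this(1) ts]] order_trans[OF mult_left_mono[OF this(2) ts] l]
      show ?thesis unfolding mult_minus_right by linarith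
    qed
    then have "\<bar>E 1 - E 0\<bar> \<le> e * (norm h)\<^sup>2" by (rule telescoping_bound)
    then show "\<bar>f (x + h) - f x - p \<bullet> h - (h \<bullet> M h) / 2\<bar> \<le> e * (norm h)\<^sup>2" by (simp add: E_def algebra_simps)
  qed
qed

text \<open>A Peano expansion at a single point. \<open>M\<close> enters through its quadratic form,
  so symmetry is not demanded of it.\<close>

definition second_order_expansion :: "('a::real_inner \<Rightarrow> real) \<Rightarrow> 'a \<Rightarrow> 'a \<Rightarrow> ('a \<Rightarrow> 'a) \<Rightarrow> bool" where
  "second_order_expansion f x p M \<longleftrightarrow> linear M \<and>
    (\<forall>e>0. \<exists>d>0. \<forall>h. norm h < d \<longrightarrow> \<bar>f (x + h) - f x - p \<bullet> h - (h \<bullet> M h) / 2\<bar> \<le> e * (norm h)\<^sup>2)"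

lemma second_order_expansionD:
  assumes "second_order_expansion f x p M" "e > 0"
  obtains d where "d > 0" "\<And>h. norm h < d \<Longrightarrow> \<bar>f (x + h) - f x - p \<bullet> h - (h \<bullet> M h) / 2\<bar> \<le> e * (norm h)\<^sup>2"
  using assms unfolding second_order_expansion_def by blast

text \<open>The resolvent of the subdifferential is nonexpansive, hence differentiable almost everywhere.
  At a point where f is touched from above by a paraboloid its derivative is injective, and
  inverting it differentiates the subdifferential.\<close>

lemma ae_second_order_expansion_at_contact:
  fixes f :: "'a::euclidean_space \<Rightarrow> real"
  assumes S: "bounded_subgrads R f"
  shows "\<exists>N. negligible N \<and> (\<forall>x p c r. x \<notin> N \<longrightarrow> subgrad f x p \<longrightarrow> c > 0 \<longrightarrow> r > 0 \<longrightarrow>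
    (\<forall>y\<in>ball x r. f y \<le> f x + p \<bullet> (y - x) + c / 2 * (norm (y - x))\<^sup>2) \<longrightarrow>
    (\<exists>M. second_order_expansion f x p M))"
proof -
  obtain J where J: "\<And>z. subgrad f (J z) (z - J z)" using prox_exists[OF S] by metis
  have Jlip: "norm (J z - J w) \<le> 1 * norm (z - w)" for z w using prox_nonexpansive[OF J J] by simp
  \<comment> \<open>The bad points are the images of the points of nondifferentiability of
    \<open>J\<close>, and the nonexpansive \<open>J\<close> keeps this set negligible. For x outside
    of it, \<open>J\<close> is differentiable at every preimage.\<close>
  define N where "N = J ` {z. \<not> J differentiable (at z)}"
  have "negligible N"
    unfolding N_def
  proof (rule negligible_locally_Lipschitz_image)
    show "negligible {z. \<not> J differentiable (at z)}" using Jlip by (rule Rademacher)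
    show "\<exists>T B. open T \<and> x \<in> T \<and> (\<forall>y\<in>{z. \<not> J differentiable (at z)} \<inter> T. norm (J y - J x) \<le> B * norm (y - x))" for x
      using Jlip by (intro exI[of _ UNIV] exI[of _ "1::real"]) auto
  qed simp
  moreover have "\<exists>M. second_order_expansion f x p M"
    if x: "x \<notin> N" and p: "subgrad f x p" and c: "c > 0" and r: "r > 0"
      and up: "\<forall>y\<in>ball x r. f y \<le> f x + p \<bullet> (y - x) + c / 2 * (norm (y - x))\<^sup>2" for x p c r
  proof -
    define z where "z = x + p"
    \<comment> \<open>\<open>J\<close> inverts the identity plus the subdifferential, so every pair
      of a point and a subgradient there is seen by \<open>J\<close>.\<close>
    have Juniq: "J (y + q) = y" if "subgrad f y q" for y q
      using prox_nonexpansive[of f "J (y + q)" "y + q" y "y + q"] J[of "y + q"] that by simp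
    have Jz: "J z = x" using Juniq[OF p] by (simp add: z_def)
    have "J differentiable (at z)" using x Jz by (auto simp: N_def)
    then obtain L where L: "(J has_derivative L) (at z)" unfolding differentiable_def by blast
    have linL: "linear L" using L has_derivative_linear by blast
    have Lip: "norm (q - p) \<le> 2 * c * norm (y - x)" if "subgrad f y q" "norm (y - x) < r / 2" for y q
      using subgrad_Lipschitz_at_contact[OF p _ c that] up by blast
    have Dz: "\<exists>d>0. \<forall>w. norm (w - z) < d \<longrightarrow> norm (J w - x - L (w - z)) \<le> e * norm (w - z)" if "e > 0" for e
      using L that unfolding has_derivative_at_alt Jz by blast
    \<comment> \<open>If \<open>L w = 0\<close>, then \<open>J\<close> hardly moves along
      \<open>w\<close>, and by \<open>Lip\<close> the subgradient hardly moves either; yet the two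
      displacements add up to \<open>s *\<^sub>R w\<close>.\<close>
    have "inj L"
      unfolding linear_injective_0[OF linL]
    proof (intro allI impI, rule ccontr)
      fix w assume w: "L w = 0" "w \<noteq> 0"
      define e where "e = 1 / (2 * (2 * c + 1))"
      have e: "e > 0" "(2 * c + 1) * e = 1 / 2" using c by (auto simp: e_def field_simps)
      obtain d where d: "d > 0" "\<And>w. norm (w - z) < d \<Longrightarrow> norm (J w - x - L (w - z)) \<le> e * norm (w - z)"
        using Dz[OF e(1)] by blast
      define s where "s = min d (r / 2) / (2 * norm w)"
      have s: "s > 0" "norm (s *\<^sub>R w) < d" "norm (s *\<^sub>R w) < r / 2" using w d(1) r by (auto simp: s_def)
      have "norm (J (z + s *\<^sub>R w) - x - L (s *\<^sub>R w)) \<le> e * norm (s *\<^sub>R w)" using d(2)[of "z + s *\<^sub>R w"] s by simp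
      moreover have "L (s *\<^sub>R w) = 0" using w(1) linL by (simp add: linear_scale)
      ultimately have 1: "norm (J (z + s *\<^sub>R w) - x) \<le> e * norm (s *\<^sub>R w)" by simp
      define x' where "x' = J (z + s *\<^sub>R w)"
      have "norm (x' - x) \<le> norm (s *\<^sub>R w)" using Jlip[of "z + s *\<^sub>R w" z] Jz by (simp add: x'_def)
      then have "norm ((z + s *\<^sub>R w - x') - p) \<le> 2 * c * norm (x' - x)"
        using Lip[OF J[of "z + s *\<^sub>R w"]] s(3) by (simp add: x'_def)
      moreover have "s *\<^sub>R w = ((z + s *\<^sub>R w - x') - p) + (x' - x)" by (simp add: z_def)
      ultimately have "norm (s *\<^sub>R w) \<le> 2 * c * norm (x' - x) + norm (x' - x)"
        by (metis add_right_mono norm_triangle_le)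
      also have "\<dots> = (2 * c + 1) * norm (x' - x)" by (simp add: algebra_simps)
      also have "\<dots> \<le> (2 * c + 1) * (e * norm (s *\<^sub>R w))" using 1 c by (intro mult_left_mono) (auto simp: x'_def)
      also have "\<dots> = norm (s *\<^sub>R w) / 2" by (simp only: mult.assoc[symmetric] e(2))
      finally show False using s(1) w(2) by simp
    qed
    then obtain L' where L': "linear L'" "L' \<circ> L = id" using linear_injective_left_inverse[OF linL] by blast
    \<comment> \<open>The inverse of the derivative of \<open>J\<close>, less the identity,
      differentiates the subdifferential.\<close>
    define M where "M y = L' y - y" for y
    have M: "linear M" unfolding M_def using L'(1) by (intro linear_compose_sub linear_id[unfolded id_def])
    obtain B where B: "B > 0" "\<And>y. norm (L' y) \<le> B * norm y" using linear_bounded_pos[OF L'(1)] by blast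
    have "\<exists>d>0. \<forall>x' p'. norm (x' - x) < d \<and> subgrad f x' p' \<longrightarrow> norm (p' - p - M (x' - x)) \<le> e * norm (x' - x)"
      if e: "e > 0" for e
    proof -
      define e' where "e' = e / (B * (2 * c + 1))"
      have k: "B * (2 * c + 1) > 0" using B(1) c by simp
      then have e'1: "e' > 0" using e by (simp add: e'_def)
      have "B * e' * (2 * c + 1) = (B * (2 * c + 1)) * e'" by (simp only: mult_ac)
      also have "\<dots> = e" using k unfolding e'_def by (metis nonzero_mult_div_cancel_left order_less_irrefl times_divide_eq_right)
      finally have e': "e' > 0" "B * e' * (2 * c + 1) = e" using e'1 by auto
      obtain d where d: "d > 0" "\<And>w. norm (w - z) < d \<Longrightarrow> norm (J w - x - L (w - z)) \<le> e' * norm (w - z)"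
        using Dz[OF e'(1)] by blast
      show ?thesis
      proof (intro exI[of _ "min (r / 2) (d / (2 * c + 1))"] conjI allI impI)
        show "min (r / 2) (d / (2 * c + 1)) > 0" using r d c by simp
        fix x' p' assume "norm (x' - x) < min (r / 2) (d / (2 * c + 1)) \<and> subgrad f x' p'"
        then have x': "norm (x' - x) < r / 2" "norm (x' - x) < d / (2 * c + 1)" and p': "subgrad f x' p'" by auto
        define w where "w = x' + p'"
        have Jw: "J w = x'" using Juniq[OF p'] by (simp add: w_def)
        have "w - z = (p' - p) + (x' - x)" by (simp add: w_def z_def)
        then have "norm (w - z) \<le> 2 * c * norm (x' - x) + norm (x' - x)"
          using Lip[OF p' x'(1)] by (metis add_right_mono norm_triangle_le)
        then have wz: "norm (w - z) \<le> (2 * c + 1) * norm (x' - x)" by (simp add: algebra_simps)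
        also have "\<dots> < d" using x'(2) c by (simp add: field_simps)
        finally have "norm (J w - x - L (w - z)) \<le> e' * norm (w - z)" by (rule d(2))
        have "p' - p - M (x' - x) = L' (L (w - z)) - L' (x' - x)"
          using L'(2) by (simp add: M_def w_def z_def pointfree_idE algebra_simps)
        also have "\<dots> = L' (L (w - z) - (x' - x))" using L'(1) by (simp add: linear_diff)
        finally have "norm (p' - p - M (x' - x)) \<le> B * norm (L (w - z) - (x' - x))" using B(2) by simp
        also have "\<dots> \<le> B * (e' * norm (w - z))"
          using \<open>norm (J w - x - L (w - z)) \<le> e' * norm (w - z)\<close> B(1) Jw
          by (intro mult_left_mono) (auto simp: norm_minus_commute)
        also have "\<dots> \<le> B * (e' * ((2 * c + 1) * norm (x' - x)))" using wz B(1) e'(1) by (intro mult_left_mono) auto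
        also have "\<dots> = e * norm (x' - x)" by (simp only: mult.assoc[symmetric] e'(2))
        finally show "norm (p' - p - M (x' - x)) \<le> e * norm (x' - x)" .
      qed
    qed
    then have "second_order_expansion f x p M"
      unfolding second_order_expansion_def
      using M second_order_expansion_if_subgrad_differentiable[OF S p M] by blast
    then show ?thesis by blast
  qed
  ultimately show ?thesis by blast
qed

text \<open>Jensen's argument: the points where a slightly tilted f + g - c|.|^2/2 attains its maximum
  form a set that a Lipschitz map sends onto a neighbourhood of the tilts, so this set is not
  negligible and meets the points of second order differentiability of f and g.\<close>

lemma Jensen_maximum_principle:
  fixes f g :: "'a::euclidean_space \<Rightarrow> real"
  assumes Sf: "bounded_subgrads R f" and Sg: "bounded_subgrads R g" and c: "c > 0"
    and C: "compact C" and D: "open D" "D \<subseteq> C" and z: "z \<in> D"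
    and lt: "\<And>x. x \<in> C - D \<Longrightarrow> f x + g x - c / 2 * (norm x)\<^sup>2 < f z + g z - c / 2 * (norm z)\<^sup>2"
  obtains x p q M M' where "x \<in> D" "second_order_expansion f x p M" "second_order_expansion g x q M'"
    "\<And>h. h \<bullet> M h + h \<bullet> M' h \<le> c * (norm h)\<^sup>2"
proof -
  define W where "W x = f x + g x - c / 2 * (norm x)\<^sup>2" for x
  have contW: "continuous_on S W" for S unfolding W_def
    by (intro continuous_intros bounded_subgrads_continuous_on[OF Sf] bounded_subgrads_continuous_on[OF Sg])
  obtain \<mu> where \<mu>: "\<mu> > 0" "\<And>x. x \<in> C - D \<Longrightarrow> W x \<le> W z - \<mu>"
  proof (cases "C - D = {}")
    case True
    then show ?thesis using that[of 1] by auto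
  next
    case False
    then obtain x1 where x1: "x1 \<in> C - D" "\<And>x. x \<in> C - D \<Longrightarrow> W x \<le> W x1"
      using continuous_attains_sup[OF compact_diff[OF C D(1)] _ contW] by blast
    show ?thesis
    proof (rule that[of "W z - W x1"])
      show "0 < W z - W x1" using lt[OF x1(1)] unfolding W_def by linarith
      show "W x \<le> W z - (W z - W x1)" if "x \<in> C - D" for x using x1(2)[OF that] by simp
    qed
  qed
  obtain b where b: "b > 0" "\<And>x. x \<in> C \<Longrightarrow> norm x \<le> b"
    using compact_imp_bounded[OF C] bounded_pos by blast
  \<comment> \<open>A tilt of norm below \<open>\<rho>\<close> changes \<open>W\<close> by at most
    \<open>\<mu> / 4\<close> on \<open>C\<close>, too little to move the maximum to
    \<open>C - D\<close>, where \<open>W\<close> is lower by \<open>\<mu>\<close>.\<close>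
  define \<rho> where "\<rho> = \<mu> / (4 * b)"
  have \<rho>: "\<rho> > 0" "\<rho> * b = \<mu> / 4" using \<mu> b by (auto simp: \<rho>_def)
  define K where "K = {x \<in> D. \<exists>v. \<forall>y\<in>C. W y - v \<bullet> y \<le> W x - v \<bullet> x}"
  obtain F where F: "\<And>x. subgrad f x (F x)" using Sf unfolding bounded_subgrads_def by metis
  obtain G where G: "\<And>x. subgrad g x (G x)" using Sg unfolding bounded_subgrads_def by metis
  \<comment> \<open>The formal gradient of \<open>W\<close>: a tilt whose maximum lies at x must be
    \<open>T x\<close>. So \<open>T\<close> maps the set \<open>K\<close> of maximum points onto a
    set containing a ball.\<close>
  define T where "T x = F x + G x - c *\<^sub>R x" for x
  have contact: "v = T x \<and> (\<forall>y\<in>ball x r. f y \<le> f x + F x \<bullet> (y - x) + c / 2 * (norm (y - x))\<^sup>2)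
      \<and> (\<forall>y\<in>ball x r. g y \<le> g x + G x \<bullet> (y - x) + c / 2 * (norm (y - x))\<^sup>2)"
    if r: "r > 0" "ball x r \<subseteq> C" and v: "\<forall>y\<in>C. W y - v \<bullet> y \<le> W x - v \<bullet> x" for x v r
  proof -
    define w where "w = v - T x"
    have q: "f y + g y \<le> f x + g x + (v + c *\<^sub>R x) \<bullet> (y - x) + c / 2 * (norm (y - x))\<^sup>2" if "y \<in> ball x r" for y
    proof -
      have y: "W y - v \<bullet> y \<le> W x - v \<bullet> x" using v r(2) that by blast
      have "(norm y)\<^sup>2 = (norm x)\<^sup>2 + 2 * (x \<bullet> (y - x)) + (norm (y - x))\<^sup>2"
        using norm_add_scaleR_sq[of x 1 "y - x"] by simp
      then have "c / 2 * (norm y)\<^sup>2 = c / 2 * (norm x)\<^sup>2 + c * (x \<bullet> (y - x)) + c / 2 * (norm (y - x))\<^sup>2"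
        by (simp only: distrib_left)
      moreover have "(v + c *\<^sub>R x) \<bullet> (y - x) = v \<bullet> y - v \<bullet> x + c * (x \<bullet> (y - x))"
        by (simp add: inner_add_left inner_diff_right right_diff_distrib)
      ultimately show ?thesis using y unfolding W_def by linarith
    qed
    have wq: "0 \<le> w \<bullet> (y - x) + c / 2 * (norm (y - x))\<^sup>2" if "y \<in> ball x r" for y
    proof -
      have "w \<bullet> (y - x) = (v + c *\<^sub>R x) \<bullet> (y - x) - F x \<bullet> (y - x) - G x \<bullet> (y - x)"
        by (simp add: w_def T_def inner_simps algebra_simps)
      then show ?thesis using q[OF that] subgradD[OF F, of x y] subgradD[OF G, of x y] by linarith
    qed
    have "w = 0"
    proof (rule ccontr)
      assume w: "w \<noteq> 0"
      define s where "s = min (1 / c) (r / (2 * norm w))"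
      have s: "s > 0" "s \<le> 1 / c" "s * norm w < r"
      proof -
        show "s > 0" "s \<le> 1 / c" using c r w by (auto simp: s_def)
        have "s * norm w \<le> r / (2 * norm w) * norm w" by (intro mult_right_mono) (auto simp: s_def)
        also have "\<dots> < r" using r w by simp
        finally show "s * norm w < r" .
      qed
      have "0 \<le> w \<bullet> (- s *\<^sub>R w) + c / 2 * (norm (- s *\<^sub>R w))\<^sup>2"
        using wq[of "x - s *\<^sub>R w"] s by (simp add: dist_norm)
      also have "\<dots> = (c * s / 2 - 1) * (s * (norm w)\<^sup>2)"
        by (simp add: power_mult_distrib power2_norm_eq_inner algebra_simps power2_eq_square[of s])
      finally have "0 \<le> (c * s / 2 - 1) * (s * (norm w)\<^sup>2)" .
      moreover have "s * (norm w)\<^sup>2 > 0" using s(1) w by simp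
      ultimately have "0 \<le> c * s / 2 - 1" by (metis not_less mult_neg_pos)
      moreover have "c * s \<le> 1" using s(2) c by (simp add: field_simps)
      ultimately show False by simp
    qed
    then have vT: "v = T x" by (simp add: w_def)
    have "(v + c *\<^sub>R x) \<bullet> (y - x) = F x \<bullet> (y - x) + G x \<bullet> (y - x)" for y
      by (simp add: vT T_def inner_simps)
    then have "f y + g y \<le> f x + g x + F x \<bullet> (y - x) + G x \<bullet> (y - x) + c / 2 * (norm (y - x))\<^sup>2" if "y \<in> ball x r" for y
      using q[OF that] by simp
    \<comment> \<open>Subtracting the supporting plane of one summand turns the bound on the sum
      into a bound on the other.\<close>
    then have "f y \<le> f x + F x \<bullet> (y - x) + c / 2 * (norm (y - x))\<^sup>2"
      "g y \<le> g x + G x \<bullet> (y - x) + c / 2 * (norm (y - x))\<^sup>2" if "y \<in> ball x r" for y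
      using subgradD[OF F, of x y] subgradD[OF G, of x y] that by (smt (verit, best))+
    then show ?thesis using vT by blast
  qed
  have ball_in: "\<exists>r>0. ball x r \<subseteq> C" if "x \<in> K" for x
    using that D unfolding K_def open_contains_ball by blast
  have "ball 0 \<rho> \<subseteq> T ` K"
  proof
    fix v :: 'a assume v: "v \<in> ball 0 \<rho>"
    have "continuous_on C (\<lambda>x. W x - v \<bullet> x)" by (intro continuous_intros contW)
    moreover have "C \<noteq> {}" using z D by auto
    ultimately obtain x where x: "x \<in> C" "\<And>y. y \<in> C \<Longrightarrow> W y - v \<bullet> y \<le> W x - v \<bullet> x"
      using continuous_attains_sup[OF C] by blast
    have bd: "\<bar>v \<bullet> y\<bar> \<le> \<mu> / 4" if "y \<in> C" for y
    proof -
      have "\<bar>v \<bullet> y\<bar> \<le> norm v * norm y" by (rule Cauchy_Schwarz_ineq2)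
      also have "\<dots> \<le> \<rho> * b" using v b(2)[OF that] \<rho>(1) by (intro mult_mono) auto
      finally show ?thesis using \<rho>(2) by simp
    qed
    have "x \<in> D"
    proof (rule ccontr)
      assume "x \<notin> D"
      then have "W x \<le> W z - \<mu>" using \<mu>(2) x(1) by blast
      moreover have "z \<in> C" using z D by blast
      ultimately show False using x(2)[of z] bd[of x] bd[of z] x(1) \<mu>(1) by linarith
    qed
    then have "x \<in> K" using x by (auto simp: K_def)
    moreover obtain r where "r > 0" "ball x r \<subseteq> C" using ball_in[OF \<open>x \<in> K\<close>] by blast
    then have "v = T x" using contact x(2) by blast
    ultimately show "v \<in> T ` K" by blast
  qed
  moreover have "\<not> negligible (ball (0::'a) \<rho>)" using \<rho>(1) by (intro open_not_negligible) auto
  ultimately have nTK: "\<not> negligible (T ` K)" using negligible_subset by blast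
  have nK: "\<not> negligible K"
  proof
    assume "negligible K"
    then have "negligible (T ` K)"
    proof (rule negligible_locally_Lipschitz_image[rotated])
      fix x assume x: "x \<in> K"
      obtain r where r: "r > 0" "ball x r \<subseteq> C" using ball_in[OF x] by blast
      obtain v where "\<forall>y\<in>C. W y - v \<bullet> y \<le> W x - v \<bullet> x" using x by (auto simp: K_def)
      note ct = contact[OF r this]
      have "norm (T y - T x) \<le> 5 * c * norm (y - x)" if "y \<in> ball x (r / 2)" for y
      proof -
        have y: "norm (y - x) < r / 2" using that by (simp add: dist_norm norm_minus_commute)
        have Tyx: "T y - T x = (F y - F x) + (G y - G x) + (- c) *\<^sub>R (y - x)" by (simp add: T_def algebra_simps)
        have "norm (T y - T x) \<le> norm (F y - F x) + norm (G y - G x) + norm ((- c) *\<^sub>R (y - x))"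
          unfolding Tyx using norm_triangle_ineq[of "(F y - F x) + (G y - G x)" "(- c) *\<^sub>R (y - x)"]
            norm_triangle_ineq[of "F y - F x" "G y - G x"] by linarith
        moreover have "norm (F y - F x) \<le> 2 * c * norm (y - x)"
          using ct by (intro subgrad_Lipschitz_at_contact[OF F _ c F y]) blast
        moreover have "norm (G y - G x) \<le> 2 * c * norm (y - x)"
          using ct by (intro subgrad_Lipschitz_at_contact[OF G _ c G y]) blast
        ultimately show ?thesis using c by simp
      qed
      then show "\<exists>U B. open U \<and> x \<in> U \<and> (\<forall>y\<in>K \<inter> U. norm (T y - T x) \<le> B * norm (y - x))"
        using r(1) by (intro exI[of _ "ball x (r / 2)"] exI[of _ "5 * c"]) auto
    qed simp
    then show False using nTK by blast
  qed
  obtain Nf where Nf: "negligible Nf" "\<And>x p c r. x \<notin> Nf \<Longrightarrow> subgrad f x p \<Longrightarrow> c > 0 \<Longrightarrow> r > 0 \<Longrightarrow>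
    (\<forall>y\<in>ball x r. f y \<le> f x + p \<bullet> (y - x) + c / 2 * (norm (y - x))\<^sup>2) \<Longrightarrow> \<exists>M. second_order_expansion f x p M"
    using ae_second_order_expansion_at_contact[OF Sf] by blast
  obtain Ng where Ng: "negligible Ng" "\<And>x p c r. x \<notin> Ng \<Longrightarrow> subgrad g x p \<Longrightarrow> c > 0 \<Longrightarrow> r > 0 \<Longrightarrow>
    (\<forall>y\<in>ball x r. g y \<le> g x + p \<bullet> (y - x) + c / 2 * (norm (y - x))\<^sup>2) \<Longrightarrow> \<exists>M. second_order_expansion g x p M"
    using ae_second_order_expansion_at_contact[OF Sg] by blast
  have "\<not> K \<subseteq> Nf \<union> Ng" using nK Nf(1) Ng(1) negligible_subset negligible_Un by metis
  then obtain x where x: "x \<in> K" "x \<notin> Nf" "x \<notin> Ng" by blast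
  obtain r where r: "r > 0" "ball x r \<subseteq> C" using ball_in[OF x(1)] by blast
  obtain v where v: "\<forall>y\<in>C. W y - v \<bullet> y \<le> W x - v \<bullet> x" using x by (auto simp: K_def)
  note ct = contact[OF r v]
  obtain M where M: "second_order_expansion f x (F x) M" using Nf(2)[OF x(2) F c r(1)] ct by blast
  obtain M' where M': "second_order_expansion g x (G x) M'" using Ng(2)[OF x(3) G c r(1)] ct by blast
  have lin: "linear M" "linear M'" using M M' by (auto simp: second_order_expansion_def)
  \<comment> \<open>Maximality and both expansions are compared at \<open>x + t *\<^sub>R h\<close>
    for a small \<open>t\<close>; the linear terms cancel because the tilt is
    \<open>T x\<close>.\<close>
  have "h \<bullet> M h + h \<bullet> M' h \<le> c * (norm h)\<^sup>2 + e" if e: "e > 0" for h e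
  proof (cases "h = 0")
    case False
    define e' where "e' = e / (4 * (norm h)\<^sup>2)"
    have e': "e' > 0" "4 * e' * (norm h)\<^sup>2 = e" using e False by (auto simp: e'_def)
    obtain d1 where d1: "d1 > 0" "\<And>k. norm k < d1 \<Longrightarrow> \<bar>f (x + k) - f x - F x \<bullet> k - (k \<bullet> M k) / 2\<bar> \<le> e' * (norm k)\<^sup>2"
      using second_order_expansionD[OF M e'(1)] by blast
    obtain d2 where d2: "d2 > 0" "\<And>k. norm k < d2 \<Longrightarrow> \<bar>g (x + k) - g x - G x \<bullet> k - (k \<bullet> M' k) / 2\<bar> \<le> e' * (norm k)\<^sup>2"
      using second_order_expansionD[OF M' e'(1)] by blast
    define t where "t = min r (min d1 d2) / (2 * norm h)"
    have "norm (t *\<^sub>R h) = min r (min d1 d2) / 2" using False r d1 d2 by (simp add: t_def)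
    then have t: "t > 0" "norm (t *\<^sub>R h) < d1" "norm (t *\<^sub>R h) < d2" "norm (t *\<^sub>R h) < r"
      using False r d1(1) d2(1) by (auto simp: t_def)
    have "x + t *\<^sub>R h \<in> C" using r(2) t(4) by (force simp: dist_norm)
    then have "W (x + t *\<^sub>R h) - v \<bullet> (x + t *\<^sub>R h) \<le> W x - v \<bullet> x" using v by blast
    moreover have "v \<bullet> (x + t *\<^sub>R h) = v \<bullet> x + (F x \<bullet> (t *\<^sub>R h) + G x \<bullet> (t *\<^sub>R h) - c * t * (x \<bullet> h))"
    proof -
      have "v = T x" using ct by blast
      then have vh: "v \<bullet> h = F x \<bullet> h + G x \<bullet> h - c * (x \<bullet> h)" by (simp add: T_def inner_diff_left inner_add_left)
      show ?thesis by (simp add: inner_add_right vh algebra_simps)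
    qed
    moreover have "c / 2 * (norm (x + t *\<^sub>R h))\<^sup>2 = c / 2 * (norm x)\<^sup>2 + c * t * (x \<bullet> h) + c / 2 * (t\<^sup>2 * (norm h)\<^sup>2)"
      unfolding norm_add_scaleR_sq by (simp add: algebra_simps)
    moreover have "(t *\<^sub>R h) \<bullet> M (t *\<^sub>R h) = t\<^sup>2 * (h \<bullet> M h)" "(t *\<^sub>R h) \<bullet> M' (t *\<^sub>R h) = t\<^sup>2 * (h \<bullet> M' h)"
      using lin by (auto simp: linear_scale power2_eq_square)
    moreover have "e' * (norm (t *\<^sub>R h))\<^sup>2 = t\<^sup>2 * (e' * (norm h)\<^sup>2)" by (simp add: power_mult_distrib)
    ultimately have "t\<^sup>2 * (h \<bullet> M h) / 2 + t\<^sup>2 * (h \<bullet> M' h) / 2 \<le> c / 2 * (t\<^sup>2 * (norm h)\<^sup>2) + 2 * (t\<^sup>2 * (e' * (norm h)\<^sup>2))"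
      using d1(2)[OF t(2)] d2(2)[OF t(3)] unfolding W_def abs_le_iff by linarith
    then have "t\<^sup>2 * (h \<bullet> M h + h \<bullet> M' h) \<le> t\<^sup>2 * (c * (norm h)\<^sup>2 + 4 * e' * (norm h)\<^sup>2)"
      by (simp add: algebra_simps)
    then show ?thesis using t(1) e'(2) by simp
  qed (use that lin in \<open>simp add: linear_0\<close>)
  then have "h \<bullet> M h + h \<bullet> M' h \<le> c * (norm h)\<^sup>2" for h by (rule field_le_epsilon)
  moreover have "x \<in> D" using x by (simp add: K_def)
  ultimately show ?thesis using that M M' by blast
qed

section \<open>Second order calculus and paraboloids\<close>

text \<open>\<open>Ck_on\<close> speaks of coordinate partials only. The coordinates of the
  increment are switched on one after another, each with the mean value inequality; continuity keeps
  all partials within \<open>e'\<close> of their values at x.\<close>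

lemma has_derivative_if_continuous_partials:
  fixes f :: "real^'n \<Rightarrow> real"
  assumes S: "open S" "x \<in> S"
    and d: "\<And>i z. z \<in> S \<Longrightarrow> (\<lambda>t. f (z + t *\<^sub>R axis i 1)) differentiable (at 0)"
    and c: "\<And>i. continuous_on S (pd i f)"
  shows "(f has_derivative (\<lambda>h. grad f x \<bullet> h)) (at x)"
  unfolding has_derivative_at_alt
proof (intro conjI bounded_linear_inner_right allI impI)
  fix e :: real assume e: "e > 0"
  define e' where "e' = e / CARD('n)"
  have e': "e' > 0" using e by (simp add: e'_def)
  have "\<exists>\<delta>>0. \<forall>z. dist z x < \<delta> \<longrightarrow> \<bar>pd i f z - pd i f x\<bar> < e'" for i
    using c[of i] S e' unfolding continuous_on_eq_continuous_at[OF S(1)] continuous_at_eps_delta dist_real_def by blast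
  then obtain \<delta> where \<delta>: "\<And>i. \<delta> i > 0" "\<And>i z. dist z x < \<delta> i \<Longrightarrow> \<bar>pd i f z - pd i f x\<bar> < e'" by metis
  obtain r where r: "r > 0" "ball x r \<subseteq> S" using S open_contains_ball by blast
  define D where "D = Min (insert r (range \<delta>))"
  have D: "D > 0" "D \<le> r" using r(1) \<delta>(1) by (auto simp: D_def)
  have D3: "D \<le> \<delta> i" for i unfolding D_def by (rule Min_le) auto
  show "\<exists>D>0. \<forall>y. norm (y - x) < D \<longrightarrow> norm (f y - f x - grad f x \<bullet> (y - x)) \<le> e * norm (y - x)"
  proof (intro exI[of _ D] conjI D(1) allI impI)
    fix y assume y: "norm (y - x) < D"
    define h where "h = y - x"
    define hS :: "'n set \<Rightarrow> real^'n" where "hS T = (\<Sum>i\<in>T. h $ i *\<^sub>R axis i 1)" for T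
    have comp: "hS T $ j = (if j \<in> T then h $ j else 0)" if "finite T" for T j
      using that by (simp add: hS_def axis_def if_distrib[of "\<lambda>z. _ * z"] cong: if_cong)
    have "\<bar>f (x + hS T) - f x - (\<Sum>i\<in>T. pd i f x * h $ i)\<bar> \<le> e' * (\<Sum>i\<in>T. \<bar>h $ i\<bar>)" if "finite T" for T
      using that
    proof (induction T rule: finite_induct)
      case empty
      then show ?case by (simp add: hS_def)
    next
      case (insert i T)
      define a where "a = x + hS T"
      define I where "I = closed_segment 0 (h $ i)"
      have near: "a + t *\<^sub>R axis i 1 \<in> ball x D" if t: "t \<in> I" for t
      proof -
        have "norm (hS T + t *\<^sub>R axis i 1) \<le> norm h"
        proof (rule norm_le_componentwise_cart)
          fix j
          have "\<bar>t\<bar> \<le> \<bar>h $ i\<bar>" using t by (auto simp: I_def closed_segment_eq_real_ivl split: if_splits)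
          then show "norm ((hS T + t *\<^sub>R axis i 1) $ j) \<le> norm (h $ j)"
            using insert(1,2) by (auto simp: comp axis_def)
        qed
        then have "norm (hS T + t *\<^sub>R axis i 1) < D" using y by (simp add: h_def)
        moreover have "dist x (x + v) = norm v" for v by (simp add: dist_norm)
        ultimately show ?thesis unfolding a_def mem_ball add.assoc by simp
      qed
      have der: "((\<lambda>t. f (a + t *\<^sub>R axis i 1) - t * pd i f x) has_field_derivative
          pd i f (a + t *\<^sub>R axis i 1) - pd i f x) (at t within I)" if t: "t \<in> I" for t
      proof -
        have "a + t *\<^sub>R axis i 1 \<in> S" using near[OF t] D(2) r(2) by auto
        then have "((\<lambda>s. f ((a + t *\<^sub>R axis i 1) + s *\<^sub>R axis i 1)) has_field_derivative pd i f (a + t *\<^sub>R axis i 1)) (at 0)"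
          using d[of "a + t *\<^sub>R axis i 1" i] unfolding pd_def
          by (simp add: DERIV_deriv_iff_real_differentiable)
        then have "((\<lambda>s. f (a + (s + t) *\<^sub>R axis i 1)) has_field_derivative pd i f (a + t *\<^sub>R axis i 1)) (at 0)"
          by (simp add: algebra_simps)
        then have "((\<lambda>t. f (a + t *\<^sub>R axis i 1)) has_field_derivative pd i f (a + t *\<^sub>R axis i 1)) (at t)"
          using DERIV_shift[of "\<lambda>t. f (a + t *\<^sub>R axis i 1)" _ 0 t] by simp
        then have "((\<lambda>t. f (a + t *\<^sub>R axis i 1) - t * pd i f x) has_field_derivative
          pd i f (a + t *\<^sub>R axis i 1) - 1 * pd i f x) (at t)"
          by (auto intro!: derivative_eq_intros)
        then show ?thesis using DERIV_subset by fastforce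
      qed
      have "norm ((f (a + h $ i *\<^sub>R axis i 1) - h $ i * pd i f x) - (f (a + 0 *\<^sub>R axis i 1) - 0 * pd i f x)) \<le> e' * norm (h $ i - 0)"
      proof (rule field_differentiable_bound[OF _ der])
        show "convex I" by (simp add: I_def)
        show "norm (pd i f (a + t *\<^sub>R axis i 1) - pd i f x) \<le> e'" if "t \<in> I" for t
          using \<delta>(2)[of "a + t *\<^sub>R axis i 1" i] near[OF that] D3[of i] by (simp add: dist_commute)
      qed (auto simp: I_def)
      then have "\<bar>f (a + h $ i *\<^sub>R axis i 1) - f a - pd i f x * h $ i\<bar> \<le> e' * \<bar>h $ i\<bar>"
        by (simp add: algebra_simps)
      moreover have "x + hS (insert i T) = a + h $ i *\<^sub>R axis i 1" using insert(1,2) by (simp add: a_def hS_def)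
      ultimately show ?case
        using insert.IH unfolding sum.insert[OF insert(1,2)] distrib_left a_def[symmetric] by simp
    qed
    from this[OF finite_class.finite_UNIV]
    have "\<bar>f (x + hS UNIV) - f x - (\<Sum>i\<in>UNIV. pd i f x * h $ i)\<bar> \<le> e' * (\<Sum>i\<in>UNIV. \<bar>h $ i\<bar>)" .
    moreover have "hS UNIV = h" by (simp add: vec_eq_iff comp)
    moreover have "(\<Sum>i\<in>UNIV. pd i f x * h $ i) = grad f x \<bullet> h" by (simp add: inner_vec_def grad_def)
    moreover have "e' * (\<Sum>i\<in>UNIV. \<bar>h $ i\<bar>) \<le> e * norm h"
    proof -
      have "(\<Sum>i\<in>UNIV. \<bar>h $ i\<bar>) \<le> (\<Sum>i\<in>(UNIV::'n set). norm h)"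
        by (intro sum_mono) (rule component_le_norm_cart)
      then have "e' * (\<Sum>i\<in>UNIV. \<bar>h $ i\<bar>) \<le> e' * (CARD('n) * norm h)" using e' by (intro mult_left_mono) auto
      then show ?thesis by (simp add: e'_def)
    qed
    ultimately show "norm (f y - f x - grad f x \<bullet> (y - x)) \<le> e * norm (y - x)" by (simp add: h_def)
  qed
qed

text \<open>The mean value inequality for the remainder along a segment; differentiability of the
  gradient \<open>G\<close> enters at the single point y.\<close>

lemma second_order_Taylor:
  fixes \<phi> :: "'a::real_inner \<Rightarrow> real"
  assumes r: "r > 0" and G: "\<And>x. x \<in> ball y r \<Longrightarrow> (\<phi> has_derivative (\<lambda>h. G x \<bullet> h)) (at x)"
    and K: "(G has_derivative K) (at y)" and e: "e > 0"
  shows "\<exists>d>0. \<forall>h. norm h < d \<longrightarrow> \<bar>\<phi> (y + h) - \<phi> y - G y \<bullet> h - (h \<bullet> K h) / 2\<bar> \<le> e * (norm h)\<^sup>2"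
proof -
  have linK: "linear K" using K has_derivative_linear by blast
  obtain d where d: "d > 0" "\<And>x. norm (x - y) < d \<Longrightarrow> norm (G x - G y - K (x - y)) \<le> e * norm (x - y)"
    using K e unfolding has_derivative_at_alt by blast
  show ?thesis
  proof (intro exI[of _ "min d r"] conjI allI impI)
    fix h :: 'a assume h: "norm h < min d r"
    have der: "((\<lambda>t. \<phi> (y + t *\<^sub>R h) - t * (G y \<bullet> h) - t\<^sup>2 / 2 * (h \<bullet> K h)) has_field_derivative
        (G (y + t *\<^sub>R h) - G y - t *\<^sub>R K h) \<bullet> h) (at t within {0..1})" if t: "t \<in> {0..1}" for t
    proof -
      have "norm (t *\<^sub>R h) \<le> norm h" using t by (simp add: mult_left_le_one_le)
      then have "y + t *\<^sub>R h \<in> ball y r" using h by (simp add: dist_norm)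
      then have "(\<phi> has_derivative (\<lambda>h'. G (y + t *\<^sub>R h) \<bullet> h')) (at (y + t *\<^sub>R h))" by (rule G)
      then have "((\<lambda>t. \<phi> (y + t *\<^sub>R h)) has_derivative (\<lambda>s. G (y + t *\<^sub>R h) \<bullet> (s *\<^sub>R h))) (at t within {0..1})"
        by (rule has_derivative_compose[rotated]) (auto intro!: derivative_eq_intros)
      then have "((\<lambda>t. \<phi> (y + t *\<^sub>R h)) has_field_derivative (G (y + t *\<^sub>R h) \<bullet> h)) (at t within {0..1})"
        unfolding has_field_derivative_def by (simp add: mult_commute_abs)
      then show ?thesis
        by (auto intro!: derivative_eq_intros simp: inner_diff_left inner_commute algebra_simps)
    qed
    have "norm ((\<phi> (y + 1 *\<^sub>R h) - 1 * (G y \<bullet> h) - 1\<^sup>2 / 2 * (h \<bullet> K h)) - (\<phi> (y + 0 *\<^sub>R h) - 0 * (G y \<bullet> h) - 0\<^sup>2 / 2 * (h \<bullet> K h)))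
        \<le> e * (norm h)\<^sup>2 * norm (1 - 0 :: real)"
    proof (rule field_differentiable_bound[OF _ der])
      fix t :: real assume t: "t \<in> {0..1}"
      have th: "norm (t *\<^sub>R h) \<le> norm h" using t by (simp add: mult_left_le_one_le)
      have "norm (G (y + t *\<^sub>R h) - G y - K (t *\<^sub>R h)) \<le> e * norm (t *\<^sub>R h)"
        using d(2)[of "y + t *\<^sub>R h"] th h by simp
      also have "\<dots> \<le> e * norm h" using th e by (intro mult_left_mono) auto
      finally have "norm (G (y + t *\<^sub>R h) - G y - t *\<^sub>R K h) \<le> e * norm h" using linK by (simp add: linear_scale)
      then have "norm (G (y + t *\<^sub>R h) - G y - t *\<^sub>R K h) * norm h \<le> e * norm h * norm h" by (intro mult_right_mono) auto
      then show "norm ((G (y + t *\<^sub>R h) - G y - t *\<^sub>R K h) \<bullet> h) \<le> e * (norm h)\<^sup>2"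
        using Cauchy_Schwarz_ineq2[of "G (y + t *\<^sub>R h) - G y - t *\<^sub>R K h" h] by (simp add: power2_eq_square)
    qed auto
    then show "\<bar>\<phi> (y + h) - \<phi> y - G y \<bullet> h - (h \<bullet> K h) / 2\<bar> \<le> e * (norm h)\<^sup>2" by (simp add: algebra_simps)
  qed (use d r in auto)
qed

text \<open>The second difference over the parallelogram spanned by \<open>s *\<^sub>R a\<close> and
  \<open>s *\<^sub>R b\<close> is symmetric in a and b, and it equals
  \<open>s\<^sup>2 * (a \<bullet> K b)\<close> up to smaller order.\<close>

lemma second_derivative_symmetric:
  fixes \<phi> :: "'a::real_inner \<Rightarrow> real"
  assumes r: "r > 0" and G: "\<And>x. x \<in> ball y r \<Longrightarrow> (\<phi> has_derivative (\<lambda>h. G x \<bullet> h)) (at x)"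
    and K: "(G has_derivative K) (at y)"
  shows "a \<bullet> K b = b \<bullet> K a"
proof -
  have linK: "linear K" using K has_derivative_linear by blast
  define C where "C = (norm a + norm b + 1)\<^sup>2 * 2"
  have C: "C > 0"
    unfolding C_def by (intro mult_pos_pos zero_less_power add_nonneg_pos add_nonneg_nonneg) auto
  \<comment> \<open>\<open>C\<close> enters through an equation so that the estimate serves both
    orders of a and b with one constant.\<close>
  have half: "\<exists>d>0. \<forall>s. 0 < s \<and> s < d \<longrightarrow>
      \<bar>(\<phi> (y + s *\<^sub>R a + s *\<^sub>R b) - \<phi> (y + s *\<^sub>R a) - \<phi> (y + s *\<^sub>R b) + \<phi> y) - s\<^sup>2 * (a \<bullet> K b)\<bar> \<le> s\<^sup>2 * (e * C)"
    if C_eq: "C = (norm a + norm b + 1)\<^sup>2 * 2" and e: "e > 0" for a b e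
  proof -
    obtain d where d: "d > 0" "\<And>x. norm (x - y) < d \<Longrightarrow> norm (G x - G y - K (x - y)) \<le> e * norm (x - y)"
      using K e unfolding has_derivative_at_alt by blast
    define m where "m = norm a + norm b + 1"
    have m: "m > 0" by (simp add: m_def add_nonneg_pos)
    show ?thesis
    proof (intro exI[of _ "min d r / m"] conjI allI impI)
      show "min d r / m > 0" using d r m by simp
      fix s assume "0 < s \<and> s < min d r / m"
      then have s: "0 < s" "s * m < d" "s * m < r" using m by (auto simp: field_simps)
      have nb: "norm (t *\<^sub>R a + c *\<^sub>R b) \<le> s * m" if t: "0 \<le> t" "t \<le> s" "0 \<le> c" "c \<le> s" for t c
      proof -
        have "norm (t *\<^sub>R a + c *\<^sub>R b) \<le> norm (t *\<^sub>R a) + norm (c *\<^sub>R b)" by (rule norm_triangle_ineq)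
        also have "\<dots> \<le> s * norm a + s * norm b" using t by (intro add_mono) (auto intro!: mult_right_mono)
        also have "\<dots> \<le> s * m" using s(1) by (simp add: m_def algebra_simps)
        finally show ?thesis .
      qed
      have Gd: "norm (G (y + (t *\<^sub>R a + c *\<^sub>R b)) - G y - K (t *\<^sub>R a + c *\<^sub>R b)) \<le> e * (s * m)"
        if t: "0 \<le> t" "t \<le> s" "0 \<le> c" "c \<le> s" for t c
      proof -
        have "norm (G (y + (t *\<^sub>R a + c *\<^sub>R b)) - G y - K (t *\<^sub>R a + c *\<^sub>R b)) \<le> e * norm (t *\<^sub>R a + c *\<^sub>R b)"
          using d(2)[of "y + (t *\<^sub>R a + c *\<^sub>R b)"] nb[OF t] s(2) by simp
        also have "\<dots> \<le> e * (s * m)" using nb[OF t] e by (intro mult_left_mono) auto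
        finally show ?thesis .
      qed
      have dv: "dist y (y + v) = norm v" for v by (simp add: dist_norm)
      have derc: "((\<lambda>t. \<phi> (y + (t *\<^sub>R a + c *\<^sub>R b))) has_field_derivative G (y + (t *\<^sub>R a + c *\<^sub>R b)) \<bullet> a) (at t within {0..s})"
        if t: "t \<in> {0..s}" "0 \<le> c" "c \<le> s" for t c
      proof -
        have "y + (t *\<^sub>R a + c *\<^sub>R b) \<in> ball y r"
          unfolding mem_ball dv using nb[of t c] t s(3) by simp
        then have "(\<phi> has_derivative (\<lambda>h'. G (y + (t *\<^sub>R a + c *\<^sub>R b)) \<bullet> h')) (at (y + (t *\<^sub>R a + c *\<^sub>R b)))" by (rule G)
        then have "((\<lambda>t. \<phi> (y + (t *\<^sub>R a + c *\<^sub>R b))) has_derivative (\<lambda>u. G (y + (t *\<^sub>R a + c *\<^sub>R b)) \<bullet> (u *\<^sub>R a))) (at t within {0..s})"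
          by (rule has_derivative_compose[rotated]) (auto intro!: derivative_eq_intros)
        then show ?thesis unfolding has_field_derivative_def by (simp add: mult_commute_abs)
      qed
      let ?g = "\<lambda>t. \<phi> (y + (t *\<^sub>R a + s *\<^sub>R b)) - \<phi> (y + (t *\<^sub>R a + 0 *\<^sub>R b)) - t * (s * (a \<bullet> K b))"
      have "norm (?g s - ?g 0) \<le> 2 * e * (s * m) * norm a * norm (s - 0)"
      proof (rule field_differentiable_bound)
        fix t assume t: "t \<in> {0..s}"
        show "(?g has_field_derivative (G (y + (t *\<^sub>R a + s *\<^sub>R b)) \<bullet> a - G (y + (t *\<^sub>R a + 0 *\<^sub>R b)) \<bullet> a - s * (a \<bullet> K b))) (at t within {0..s})"
          using derc[OF t, of s] derc[OF t, of 0] s(1)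
          by (auto intro!: derivative_eq_intros simp: algebra_simps)
        have Kd: "K (t *\<^sub>R a + s *\<^sub>R b) = t *\<^sub>R K a + s *\<^sub>R K b" "K (t *\<^sub>R a + 0 *\<^sub>R b) = t *\<^sub>R K a"
          using linK by (simp_all add: linear_add linear_scale)
        let ?v1 = "G (y + (t *\<^sub>R a + s *\<^sub>R b)) - G y - K (t *\<^sub>R a + s *\<^sub>R b)"
        let ?v2 = "G (y + (t *\<^sub>R a + 0 *\<^sub>R b)) - G y - K (t *\<^sub>R a + 0 *\<^sub>R b)"
        have "G (y + (t *\<^sub>R a + s *\<^sub>R b)) \<bullet> a - G (y + (t *\<^sub>R a + 0 *\<^sub>R b)) \<bullet> a - s * (a \<bullet> K b) = (?v1 - ?v2) \<bullet> a"
          unfolding Kd by (simp add: inner_simps inner_commute)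
        moreover have "norm ((?v1 - ?v2) \<bullet> a) \<le> norm (?v1 - ?v2) * norm a"
          using Cauchy_Schwarz_ineq2 by auto
        moreover have "norm (?v1 - ?v2) \<le> 2 * e * (s * m)"
          using Gd[of t s] Gd[of t 0] t s(1) norm_triangle_ineq4[of ?v1 ?v2] by auto
        then have "norm (?v1 - ?v2) * norm a \<le> 2 * e * (s * m) * norm a" by (intro mult_right_mono) auto
        ultimately show "norm (G (y + (t *\<^sub>R a + s *\<^sub>R b)) \<bullet> a - G (y + (t *\<^sub>R a + 0 *\<^sub>R b)) \<bullet> a - s * (a \<bullet> K b)) \<le> 2 * e * (s * m) * norm a"
          by (simp only:)
      qed (use s in auto)
      moreover have "2 * e * (s * m) * norm a * norm (s - 0) \<le> s\<^sup>2 * (e * C)"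
      proof -
        have "m * norm a \<le> m * m" using m by (intro mult_left_mono) (auto simp: m_def)
        then have "(2 * e * s * s) * (m * norm a) \<le> (2 * e * s * s) * (m * m)"
          by (rule mult_left_mono) (use e s in auto)
        then show ?thesis using s(1) unfolding C_eq m_def[symmetric] power2_eq_square real_norm_def
          by (simp only: mult_ac diff_zero abs_of_pos)
      qed
      moreover have "?g s - ?g 0 = (\<phi> (y + s *\<^sub>R a + s *\<^sub>R b) - \<phi> (y + s *\<^sub>R a) - \<phi> (y + s *\<^sub>R b) + \<phi> y) - s\<^sup>2 * (a \<bullet> K b)"
        by (simp add: power2_eq_square add.assoc)
      ultimately show "\<bar>(\<phi> (y + s *\<^sub>R a + s *\<^sub>R b) - \<phi> (y + s *\<^sub>R a) - \<phi> (y + s *\<^sub>R b) + \<phi> y) - s\<^sup>2 * (a \<bullet> K b)\<bar> \<le> s\<^sup>2 * (e * C)"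
        by simp
    qed
  qed
  have "\<bar>a \<bullet> K b - b \<bullet> K a\<bar> \<le> 0 + e" if "e > 0" for e
  proof -
    define e' where "e' = e / (2 * C)"
    have e': "e' > 0" "2 * (e' * C) = e" using that C by (auto simp: e'_def)
    obtain d1 where d1: "d1 > 0" "\<And>s. 0 < s \<Longrightarrow> s < d1 \<Longrightarrow>
      \<bar>(\<phi> (y + s *\<^sub>R a + s *\<^sub>R b) - \<phi> (y + s *\<^sub>R a) - \<phi> (y + s *\<^sub>R b) + \<phi> y) - s\<^sup>2 * (a \<bullet> K b)\<bar> \<le> s\<^sup>2 * (e' * C)"
      using half[OF C_def e'(1)] by blast
    have C': "C = (norm b + norm a + 1)\<^sup>2 * 2" by (simp add: C_def add.commute)
    obtain d2 where d2: "d2 > 0" "\<And>s. 0 < s \<Longrightarrow> s < d2 \<Longrightarrow>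
      \<bar>(\<phi> (y + s *\<^sub>R b + s *\<^sub>R a) - \<phi> (y + s *\<^sub>R b) - \<phi> (y + s *\<^sub>R a) + \<phi> y) - s\<^sup>2 * (b \<bullet> K a)\<bar> \<le> s\<^sup>2 * (e' * C)"
      using half[OF C' e'(1)] by blast
    define s where "s = min d1 d2 / 2"
    have s: "0 < s" "s < d1" "s < d2" using d1 d2 by (auto simp: s_def)
    have ba: "y + s *\<^sub>R b + s *\<^sub>R a = y + s *\<^sub>R a + s *\<^sub>R b" by simp
    have "\<bar>s\<^sup>2 * (a \<bullet> K b) - s\<^sup>2 * (b \<bullet> K a)\<bar> \<le> 2 * (s\<^sup>2 * (e' * C))"
      using d1(2)[OF s(1,2)] d2(2)[OF s(1,3), unfolded ba] by linarith
    also have "\<dots> = s\<^sup>2 * e" using e'(2) by simp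
    finally have "s\<^sup>2 * \<bar>a \<bullet> K b - b \<bullet> K a\<bar> \<le> s\<^sup>2 * e"
      by (simp add: abs_mult flip: right_diff_distrib)
    then show ?thesis using s(1) by simp
  qed
  then have "\<bar>a \<bullet> K b - b \<bullet> K a\<bar> \<le> 0" by (rule field_le_epsilon)
  then show ?thesis by simp
qed

section \<open>Quadratic polynomials as test functions\<close>

text \<open>Contact is stated through differences \<open>u x - qform p A x\<close>, so a constant
  term would cancel; basing the polynomial at a point other than the origin only changes
  \<open>p\<close> and the constant.\<close>

definition qform :: "real^'n \<Rightarrow> real^'n^'n \<Rightarrow> real^'n \<Rightarrow> real" where
  "qform p A x = p \<bullet> x + (x \<bullet> (A *v x)) / 2"

lemma sym_mats_iff: "A \<in> sym_mats \<longleftrightarrow> (\<forall>i j. A $ i $ j = A $ j $ i)"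
  unfolding sym_mats_def transpose_def by (simp add: vec_eq_iff) blast

lemma sym_mats_add: "A \<in> sym_mats \<Longrightarrow> B \<in> sym_mats \<Longrightarrow> A + B \<in> sym_mats"
  and sym_mats_diff: "A \<in> sym_mats \<Longrightarrow> B \<in> sym_mats \<Longrightarrow> A - B \<in> sym_mats"
  and sym_mats_scaleR: "A \<in> sym_mats \<Longrightarrow> c *\<^sub>R A \<in> sym_mats"
  and sym_mats_uminus: "A \<in> sym_mats \<Longrightarrow> - A \<in> sym_mats"
  by (simp_all add: sym_mats_iff)

lemma sym_mats_mat: "mat k \<in> sym_mats"
  unfolding sym_mats_iff mat_def by simp

lemma sym_mats_inner: "A \<in> sym_mats \<Longrightarrow> x \<bullet> (A *v y) = y \<bullet> (A *v x)"
  by (metis (mono_tags, lifting) dot_lmul_matrix inner_commute mem_Collect_eq sym_mats_def transpose_matrix_vector)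

lemma scaleR_mat_vec: "(c *\<^sub>R mat 1) *v x = c *\<^sub>R (x :: real^'n)"
  by (simp add: scaleR_matrix_vector_assoc[symmetric])

lemma closed_sym_mats: "closed (sym_mats :: (real^'n^'n) set)"
proof -
  have eq: "sym_mats = {A :: real^'n^'n. \<forall>i j. A $ i $ j = A $ j $ i}"
    by (auto simp: sym_mats_def transpose_def vec_eq_iff)
  show ?thesis unfolding eq by (intro closed_Collect_all closed_Collect_eq continuous_intros)
qed

lemma qform_add:
  assumes "A \<in> sym_mats"
  shows "qform p A (y + h) = qform p A y + (p + A *v y) \<bullet> h + (h \<bullet> (A *v h)) / 2"
proof -
  have 1: "h \<bullet> (A *v y) = y \<bullet> (A *v h)" using sym_mats_inner[OF assms] .
  then have 2: "(A *v y) \<bullet> h = y \<bullet> (A *v h)" by (simp add: inner_commute[of "A *v y"])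
  show ?thesis
    by (simp add: qform_def matrix_vector_right_distrib inner_add_left inner_add_right 1 2 add_divide_distrib)
qed

lemma qform_diff_eq:
  assumes "A \<in> sym_mats"
  shows "qform p A x - qform p A y = (p + A *v y) \<bullet> (x - y) + ((x - y) \<bullet> (A *v (x - y))) / 2"
  using qform_add[OF assms, of p y "x - y"] by simp

lemma qform_add_scaled_mat:
  "qform (p - c *\<^sub>R y) (A + c *\<^sub>R mat 1) x = qform p A x + c / 2 * (norm (x - y))\<^sup>2 - c / 2 * (norm y)\<^sup>2"
proof -
  have 1: "(norm (x - y))\<^sup>2 = x \<bullet> x - 2 * (x \<bullet> y) + y \<bullet> y"
    by (simp add: power2_norm_eq_inner inner_diff_left inner_diff_right inner_commute[of y x])
  have 2: "(p - c *\<^sub>R y) \<bullet> x = p \<bullet> x - c * (x \<bullet> y)" by (simp add: inner_diff_left inner_commute[of y x])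
  have 3: "x \<bullet> ((A + c *\<^sub>R mat 1) *v x) = x \<bullet> (A *v x) + c * (x \<bullet> x)"
    by (simp add: matrix_vector_mult_add_rdistrib scaleR_mat_vec inner_add_right)
  have 4: "(norm y)\<^sup>2 = y \<bullet> y" by (simp add: power2_norm_eq_inner)
  show ?thesis unfolding qform_def 1 2 3 4
    by (simp add: distrib_left right_diff_distrib add_divide_distrib)
qed

lemma continuous_on_qform: "continuous_on S (qform p A)"
  unfolding qform_def by (intro continuous_intros matrix_vector_mult_linear_continuous_on) auto

lemma qform_scaleR: "qform (c *\<^sub>R p) (c *\<^sub>R A) x = c * qform p A x"
  by (simp add: qform_def scaleR_matrix_vector_assoc[symmetric] algebra_simps)

lemma qform_has_partial:
  fixes A :: "real^'n^'n"
  assumes A: "A \<in> sym_mats"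
  shows "((\<lambda>t. c + qform p A (x + t *\<^sub>R axis i 1)) has_field_derivative (p + A *v x) $ i) (at 0)"
proof -
  have "((\<lambda>t. c + (qform p A x + t * ((p + A *v x) $ i) + t\<^sup>2 * (axis i 1 \<bullet> (A *v axis i 1)) / 2))
      has_field_derivative (p + A *v x) $ i) (at 0)"
    by (auto intro!: derivative_eq_intros)
  moreover have "qform p A (x + t *\<^sub>R axis i 1) = qform p A x + t * ((p + A *v x) $ i) + t\<^sup>2 * (axis i 1 \<bullet> (A *v axis i 1)) / 2" for t
    unfolding qform_add[OF A]
    by (simp add: inner_axis matrix_vector_mult_scaleR power2_eq_square inner_add_left[symmetric] del: inner_add_left)
  ultimately show ?thesis by simp
qed

lemma
  fixes A :: "real^'n^'n"
  assumes A: "A \<in> sym_mats"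
  shows Ck_on_qform: "Ck_on 2 U (\<lambda>x. c + qform p A x)"
    and hess_qform: "hess (\<lambda>x. c + qform p A x) y = A"
proof -
  have pd1: "pd i (\<lambda>x. c + qform p A x) = (\<lambda>x. (p + A *v x) $ i)" for i
    unfolding pd_def by (rule ext) (rule DERIV_imp_deriv[OF qform_has_partial[OF A]])
  have aff: "((\<lambda>t. (p + A *v (x + t *\<^sub>R axis j 1)) $ i) has_field_derivative A $ i $ j) (at 0)" for x i j
  proof -
    have "(A *v axis j 1) $ i = A $ i $ j" by (simp add: matrix_vector_mult_basis column_def)
    then have "(p + A *v (x + t *\<^sub>R axis j 1)) $ i = (p + A *v x) $ i + t * A $ i $ j" for t
      by (simp add: matrix_vector_right_distrib matrix_vector_mult_scaleR)
    then show ?thesis by (auto intro!: derivative_eq_intros)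
  qed
  have pd2: "pd j (\<lambda>x. (p + A *v x) $ i) = (\<lambda>x. A $ i $ j)" for i j
    unfolding pd_def by (rule ext) (rule DERIV_imp_deriv[OF aff])
  have sym: "A $ i $ j = A $ j $ i" for i j using A by (auto simp: sym_mats_def transpose_def vec_eq_iff)
  show "hess (\<lambda>x. c + qform p A x) y = A"
    unfolding hess_def by (simp add: pd1 pd2 vec_eq_iff sym del: vector_add_component)
  have c0: "continuous_on U (\<lambda>x. c + qform p A x)" by (intro continuous_intros continuous_on_qform)
  have c1: "continuous_on U (\<lambda>x. (p + A *v x) $ i)" for i
    by (intro continuous_intros matrix_vector_mult_linear_continuous_on)
  show "Ck_on 2 U (\<lambda>x. c + qform p A x)"
    unfolding Ck_on_def
  proof (intro allI impI conjI ballI)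
    fix "is" :: "'n list" assume l: "length is \<le> 2"
    then consider "is = []" | i where "is = [i]" | i j where "is = [i, j]"
      by (cases "is"; cases "tl is") (auto simp: le_Suc_eq numeral_2_eq_2)
    then show "continuous_on U (iter_pd is (\<lambda>x. c + qform p A x))"
      by cases (use c0 c1 in \<open>auto simp: pd1 pd2 simp del: vector_add_component\<close>)
    fix i x assume "length is < 2"
    then consider "is = []" | k where "is = [k]" by (cases "is"; cases "tl is") auto
    then show "(\<lambda>t. iter_pd is (\<lambda>x. c + qform p A x) (x + t *\<^sub>R axis i 1)) differentiable at 0"
    proof cases
      case 1
      then show ?thesis unfolding real_differentiable_def
        by (simp del: vector_add_component) (rule exI, rule qform_has_partial[OF A])
    next
      case 2
      then show ?thesis unfolding real_differentiable_def
        by (simp add: pd1 del: vector_add_component) (rule exI, rule aff)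
    qed
  qed
qed

lemma
  fixes \<phi> :: "real^'n \<Rightarrow> real"
  assumes C2: "Ck_on 2 S \<phi>" and S: "open S" "y \<in> S"
  shows hess_symmetric: "hess \<phi> y \<in> sym_mats"
    and hess_Taylor: "e > 0 \<Longrightarrow> \<exists>d>0. \<forall>h. norm h < d \<longrightarrow>
      \<bar>\<phi> (y + h) - \<phi> y - grad \<phi> y \<bullet> h - (h \<bullet> (hess \<phi> y *v h)) / 2\<bar> \<le> e * (norm h)\<^sup>2"
proof -
  obtain r where r: "r > 0" "ball y r \<subseteq> S" using S open_contains_ball by blast
  have C: "continuous_on S (iter_pd is \<phi>)" if "length is \<le> 2" for "is"
    using C2 that unfolding Ck_on_def by blast
  have D: "(\<lambda>t. iter_pd is \<phi> (x + t *\<^sub>R axis i 1)) differentiable at 0" if "length is < 2" "x \<in> S" for "is" i x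
    using C2 that unfolding Ck_on_def by auto
  have G: "(\<phi> has_derivative (\<lambda>h. grad \<phi> x \<bullet> h)) (at x)" if "x \<in> S" for x
    using D[of "[]"] C[of "[_]"] by (intro has_derivative_if_continuous_partials[OF S(1) that]) auto
  have Gi: "(pd i \<phi> has_derivative (\<lambda>h. grad (pd i \<phi>) x \<bullet> h)) (at x)" if "x \<in> S" for x i
    using D[of "[i]"] C[of "[_, i]"] by (intro has_derivative_if_continuous_partials[OF S(1) that]) auto
  \<comment> \<open>Entry \<open>i j\<close> of \<open>hess\<close> is \<open>pd i\<close> of
    \<open>pd j\<close>, so the derivative of the gradient appears first as the transpose of
    \<open>hess\<close>; symmetry then removes the transposition.\<close>
  let ?K = "\<lambda>h. transpose (hess \<phi> y) *v h"
  have "(\<lambda>h. grad (pd i \<phi>) y \<bullet> h) = (\<lambda>h. ?K h $ i)" for i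
    by (rule ext) (simp add: grad_def hess_def inner_vec_def matrix_vector_mult_def transpose_def del: transpose_matrix_vector)
  then have "(pd i \<phi> has_derivative (\<lambda>h. ?K h $ i)) (at y)" for i using Gi[OF S(2), of i] by (simp only:)
  then have K: "(grad \<phi> has_derivative ?K) (at y)"
    unfolding grad_def[abs_def]
    by (subst has_derivative_componentwise_within) (auto simp: Basis_vec_def inner_axis simp del: transpose_matrix_vector)
  have sym: "a \<bullet> ?K b = b \<bullet> ?K a" for a b
    by (rule second_derivative_symmetric[OF r(1) _ K]) (use G r(2) in blast)
  show H: "hess \<phi> y \<in> sym_mats"
  proof -
    have "axis i 1 \<bullet> ?K (axis j 1) = hess \<phi> y $ j $ i" for i j
      by (simp add: matrix_vector_mult_basis column_def inner_axis' transpose_def)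
    then have "hess \<phi> y $ j $ i = hess \<phi> y $ i $ j" for i j using sym by metis
    then show ?thesis by (simp add: sym_mats_def transpose_def vec_eq_iff)
  qed
  then have tr: "transpose (hess \<phi> y) = hess \<phi> y" by (simp add: sym_mats_def)
  show "\<exists>d>0. \<forall>h. norm h < d \<longrightarrow>
      \<bar>\<phi> (y + h) - \<phi> y - grad \<phi> y \<bullet> h - (h \<bullet> (hess \<phi> y *v h)) / 2\<bar> \<le> e * (norm h)\<^sup>2" if "e > 0"
  proof -
    have "\<exists>d>0. \<forall>h. norm h < d \<longrightarrow> \<bar>\<phi> (y + h) - \<phi> y - grad \<phi> y \<bullet> h - (h \<bullet> ?K h) / 2\<bar> \<le> e * (norm h)\<^sup>2"
      by (rule second_order_Taylor[OF r(1) _ K that]) (use G r(2) in blast)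
    then show ?thesis unfolding tr .
  qed
qed

text \<open>Subharmonicity tested by quadratic polynomials, with contact written as a local maximum
  of \<open>u - qform p A\<close>. For closed \<open>F\<close> it agrees with
  \<open>F_subharmonic\<close> on open sets and frees later arguments from the regularity of test
  functions.\<close>

definition subh :: "(real^'n^'n) set \<Rightarrow> (real^'n) set \<Rightarrow> (real^'n \<Rightarrow> real) \<Rightarrow> bool" where
  "subh F X u \<longleftrightarrow> usc_on X u \<and> (\<forall>y\<in>X. \<forall>p. \<forall>A\<in>sym_mats.
     (\<exists>r>0. \<forall>x\<in>ball y r \<inter> X. u x - qform p A x \<le> u y - qform p A y) \<longrightarrow> A \<in> F)"

lemma subhD:
  assumes "subh F X u" "y \<in> X" "A \<in> sym_mats" "r > 0"
    "\<And>x. x \<in> ball y r \<Longrightarrow> x \<in> X \<Longrightarrow> u x - qform p A x \<le> u y - qform p A y"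
  shows "A \<in> F"
proof -
  have "\<forall>x\<in>ball y r \<inter> X. u x - qform p A x \<le> u y - qform p A y" using assms(5) by blast
  then show ?thesis using assms(1) unfolding subh_def using assms(2-4) by blast
qed

lemma closed_add_small_mat:
  assumes "closed F" and "\<And>e. e > 0 \<Longrightarrow> A + e *\<^sub>R mat 1 \<in> F"
  shows "A \<in> (F :: (real^'n^'n) set)"
proof -
  define X where "X n = A + inverse (real (Suc n)) *\<^sub>R mat 1" for n
  have "X \<longlonglongrightarrow> A + 0 *\<^sub>R mat 1"
    unfolding X_def by (intro tendsto_intros LIMSEQ_inverse_real_of_nat)
  moreover have "X n \<in> F" for n unfolding X_def by (rule assms(2)) simp
  ultimately have "A + 0 *\<^sub>R mat 1 \<in> F" using assms(1) unfolding closed_sequential_limits by blast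
  then show ?thesis by simp
qed

text \<open>By Taylor's formula the polynomial with Hessian
  \<open>hess \<phi> y + e *\<^sub>R mat 1\<close> lies above a C2 test function near the contact
  point; closedness of \<open>F\<close> lets \<open>e\<close> tend to 0.\<close>

lemma F_subharmonic_iff_subh:
  assumes X: "open X" and F: "closed F"
  shows "F_subharmonic F X u \<longleftrightarrow> subh F X u"
proof
  assume u: "F_subharmonic F X u"
  have "A \<in> F" if y: "y \<in> X" and A: "A \<in> sym_mats" and r: "r > 0"
    and t: "\<forall>x\<in>ball y r \<inter> X. u x - qform p A x \<le> u y - qform p A y" for y p A r
  proof -
    have "upper_test u X y (\<lambda>x. (u y - qform p A y) + qform p A x)"
      unfolding upper_test_def
    proof (intro conjI exI[of _ r] r Ck_on_qform[OF A])
      show "\<forall>x\<in>ball y r \<inter> X. u x \<le> (u y - qform p A y) + qform p A x" using t by force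
    qed simp
    then have "hess (\<lambda>x. (u y - qform p A y) + qform p A x) y \<in> F" using u y by (auto simp: F_subharmonic_def)
    then show ?thesis by (simp add: hess_qform[OF A])
  qed
  then show "subh F X u" using u unfolding subh_def F_subharmonic_def by blast
next
  assume u: "subh F X u"
  have "hess \<phi> y \<in> F" if y: "y \<in> X" and t: "upper_test u X y \<phi>" for y \<phi>
  proof -
    obtain r where r: "r > 0" "Ck_on 2 (ball y r) \<phi>" "\<And>x. x \<in> ball y r \<inter> X \<Longrightarrow> u x \<le> \<phi> x" "u y = \<phi> y"
      using t by (auto simp: upper_test_def)
    have yr: "y \<in> ball y r" using r(1) by simp
    show ?thesis
    proof (rule closed_add_small_mat[OF F])
      fix e :: real assume e: "e > 0"
      let ?A = "hess \<phi> y + e *\<^sub>R mat 1"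
      have H: "hess \<phi> y \<in> sym_mats" by (rule hess_symmetric[OF r(2) open_ball yr])
      then have A: "?A \<in> sym_mats" by (intro sym_mats_add sym_mats_scaleR sym_mats_mat)
      obtain d where d: "d > 0" "\<And>h. norm h < d \<Longrightarrow>
          \<bar>\<phi> (y + h) - \<phi> y - grad \<phi> y \<bullet> h - (h \<bullet> (hess \<phi> y *v h)) / 2\<bar> \<le> e / 2 * (norm h)\<^sup>2"
        using hess_Taylor[OF r(2) open_ball yr, of "e/2"] e by auto
      show "?A \<in> F"
      proof (rule subhD[OF u y A, of "min r d" "grad \<phi> y - ?A *v y"])
        fix x assume x: "x \<in> ball y (min r d)" "x \<in> X"
        define h where "h = x - y"
        have h: "norm h < d" "x = y + h" using x by (auto simp: h_def dist_norm norm_minus_commute)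
        have "u x \<le> \<phi> x" using r(3) x by auto
        moreover have "\<phi> x - \<phi> y \<le> grad \<phi> y \<bullet> h + (h \<bullet> (hess \<phi> y *v h)) / 2 + e / 2 * (norm h)\<^sup>2"
          using d(2)[OF h(1)] unfolding h(2)[symmetric] by linarith
        moreover have "(h \<bullet> (?A *v h)) / 2 = (h \<bullet> (hess \<phi> y *v h)) / 2 + e / 2 * (norm h)\<^sup>2"
          by (simp add: matrix_vector_mult_add_rdistrib scaleR_mat_vec inner_add_right power2_norm_eq_inner add_divide_distrib)
        moreover have "qform (grad \<phi> y - ?A *v y) ?A x - qform (grad \<phi> y - ?A *v y) ?A y = grad \<phi> y \<bullet> h + (h \<bullet> (?A *v h)) / 2"
          unfolding qform_diff_eq[OF A] h_def by simp
        ultimately show "u x - qform (grad \<phi> y - ?A *v y) ?A x \<le> u y - qform (grad \<phi> y - ?A *v y) ?A y"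
          using r(4) by linarith
      qed (use r(1) d(1) in auto)
    qed
  qed
  then show "F_subharmonic F X u" using u unfolding subh_def F_subharmonic_def by blast
qed

section \<open>Cone subequations and subharmonic functions\<close>

text \<open>Relates the Euclidean norm of the entries, in which \<open>sym_interior\<close> is
  defined, to quadratic forms, with a crude constant.\<close>

lemma inner_matrix_vector_le:
  fixes B :: "real^'n^'n"
  shows "\<bar>x \<bullet> (B *v x)\<bar> \<le> CARD('n) * norm B * (norm x)\<^sup>2"
proof -
  have "norm (B *v x) \<le> (\<Sum>k\<in>UNIV. \<bar>(B *v x) $ k\<bar>)" by (rule norm_le_l1_cart)
  also have "\<dots> \<le> (\<Sum>k\<in>(UNIV::'n set). norm B * norm x)"
  proof (rule sum_mono)
    fix k
    have "\<bar>(B *v x) $ k\<bar> \<le> norm (B $ k) * norm x"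
      by (simp add: matrix_vector_mul_component Cauchy_Schwarz_ineq2)
    also have "\<dots> \<le> norm B * norm x" by (intro mult_right_mono Finite_Cartesian_Product.norm_nth_le) auto
    finally show "\<bar>(B *v x) $ k\<bar> \<le> norm B * norm x" .
  qed
  finally have "norm x * norm (B *v x) \<le> norm x * (CARD('n) * (norm B * norm x))"
    by (intro mult_left_mono) auto
  then show ?thesis using Cauchy_Schwarz_ineq2[of x "B *v x"] by (simp add: power2_eq_square mult_ac)
qed

lemma uminus_matrix_vector: "(- B) *v x = - (B *v (x :: real^'n))"
  using matrix_vector_mult_diff_rdistrib[of 0 B x] by simp

lemma cone_subequationD:
  assumes "cone_subequation F"
  shows "F \<subseteq> sym_mats" "closed F" "A \<in> F \<Longrightarrow> psd P \<Longrightarrow> A + P \<in> F" "t > 0 \<Longrightarrow> A \<in> F \<Longrightarrow> t *\<^sub>R A \<in> F"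
proof -
  show "F \<subseteq> sym_mats" "closed F" using assms by (simp_all add: cone_subequation_def)
  show "A + P \<in> F" if "A \<in> F" "psd P" using assms that by (simp add: cone_subequation_def)
  show "t *\<^sub>R A \<in> F" if "t > 0" "A \<in> F"
  proof -
    have "(\<lambda>A. t *\<^sub>R A) ` F = F" using assms that(1) by (simp add: cone_subequation_def)
    then show ?thesis using that(2) by blast
  qed
qed

lemma cone_subequation_mono:
  assumes F: "cone_subequation F" and A: "A \<in> F" and B: "B \<in> sym_mats"
    and le: "\<And>x. x \<bullet> (A *v x) \<le> x \<bullet> (B *v x)"
  shows "B \<in> F"
proof -
  have "B - A \<in> sym_mats" using cone_subequationD(1)[OF F] A B by (intro sym_mats_diff) auto
  then have "psd (B - A)"
    using le by (simp add: psd_def matrix_vector_mult_diff_rdistrib inner_diff_right)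
  then have "A + (B - A) \<in> F" using cone_subequationD(3)[OF F A] by blast
  then show ?thesis by simp
qed

text \<open>Symmetric matrices within \<open>c / CARD('n)\<close> of \<open>B\<close> still dominate
  \<open>A\<close> as quadratic forms. Together with \<open>sym_interior_minus_mat\<close> this
  turns interior membership into a gap of size \<open>c\<close> times the identity.\<close>

lemma sym_interior_if_strictly_above:
  fixes F :: "(real^'n^'n) set"
  assumes F: "cone_subequation F" and A: "A \<in> F" and B: "B \<in> sym_mats" and c: "c > 0"
    and le: "\<And>x. x \<bullet> (A *v x) + c * (norm x)\<^sup>2 \<le> x \<bullet> (B *v x)"
  shows "B \<in> sym_interior F"
proof -
  let ?K = "real CARD('n)"
  have "E \<in> F" if E: "E \<in> sym_mats" "dist E B < c / ?K" for E
  proof (rule cone_subequation_mono[OF F A E(1)])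
    fix x :: "real^'n"
    have "?K * norm (E - B) \<le> c" using E(2) by (simp add: dist_norm field_simps)
    then have "?K * norm (E - B) * (norm x)\<^sup>2 \<le> c * (norm x)\<^sup>2" by (intro mult_right_mono) auto
    then have "\<bar>x \<bullet> ((E - B) *v x)\<bar> \<le> c * (norm x)\<^sup>2" using inner_matrix_vector_le[of x "E - B"] by linarith
    then have "x \<bullet> (B *v x) - c * (norm x)\<^sup>2 \<le> x \<bullet> (E *v x)"
      by (simp add: matrix_vector_mult_diff_rdistrib inner_diff_right abs_le_iff)
    then show "x \<bullet> (A *v x) \<le> x \<bullet> (E *v x)" using le[of x] by linarith
  qed
  then show ?thesis unfolding sym_interior_def using B c
    by (auto intro!: exI[of _ "c / ?K"])
qed

lemma sym_interior_minus_mat: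
  fixes A :: "real^'n^'n"
  assumes "A \<in> sym_interior F"
  shows "\<exists>c>0. A - c *\<^sub>R mat 1 \<in> F"
proof -
  obtain e where e: "e > 0" "\<And>B. B \<in> sym_mats \<Longrightarrow> dist B A < e \<Longrightarrow> B \<in> F" and A: "A \<in> sym_mats"
    using assms unfolding sym_interior_def by blast
  \<comment> \<open>The summand 1 keeps \<open>N\<close> positive without evaluating the norm of the
    identity.\<close>
  define N where "N = norm (mat 1 :: real^'n^'n) + 1"
  have N: "N > 0" by (simp add: N_def add_nonneg_pos)
  define c where "c = e / (2 * N)"
  have c: "c > 0" using e(1) N by (simp add: c_def)
  have "c * norm (mat 1 :: real^'n^'n) \<le> c * N" using c by (intro mult_left_mono) (auto simp: N_def)
  also have "\<dots> = e / 2" using N by (simp add: c_def)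
  also have "\<dots> < e" using e(1) by simp
  finally have "dist (A - c *\<^sub>R mat 1) A < e" using c by (simp add: dist_norm)
  then have "A - c *\<^sub>R mat 1 \<in> F" using A by (intro e(2) sym_mats_diff sym_mats_scaleR sym_mats_mat)
  then show ?thesis using c by blast
qed

lemma sym_interior_scaleR:
  assumes F: "cone_subequation F" and t: "t > 0" and A: "A \<in> sym_interior F"
  shows "t *\<^sub>R A \<in> sym_interior F"
proof -
  obtain c where c: "c > 0" "A - c *\<^sub>R mat 1 \<in> F" using sym_interior_minus_mat[OF A] by blast
  have "t *\<^sub>R (A - c *\<^sub>R mat 1) \<in> F" using cone_subequationD(4)[OF F t c(2)] .
  moreover have "t *\<^sub>R A \<in> sym_mats" using A by (auto simp: sym_interior_def sym_mats_scaleR)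
  ultimately show ?thesis
  proof (rule sym_interior_if_strictly_above[OF F, where c = "t * c"])
    fix x
    show "x \<bullet> (t *\<^sub>R (A - c *\<^sub>R mat 1) *v x) + t * c * (norm x)\<^sup>2 \<le> x \<bullet> (t *\<^sub>R A *v x)"
      by (simp add: scaleR_matrix_vector_assoc[symmetric] matrix_vector_mult_diff_rdistrib scaleR_mat_vec
          inner_diff_right power2_norm_eq_inner algebra_simps)
  qed (use t c in auto)
qed

text \<open>The algebra behind comparison: the bound puts \<open>- B\<close> strictly above
  \<open>A\<close>, hence into the interior of \<open>F\<close>.\<close>

lemma dual_contradiction:
  assumes F: "cone_subequation F" and A: "A \<in> F" and B: "B \<in> dual_subeq F" and c: "c > 0"
    and le: "\<And>x. x \<bullet> (A *v x) + x \<bullet> (B *v x) \<le> - c * (norm x)\<^sup>2"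
  shows False
proof -
  have "- B \<in> sym_interior F"
  proof (rule sym_interior_if_strictly_above[OF F A _ c])
    show "- B \<in> sym_mats" using B by (auto simp: dual_subeq_def sym_mats_uminus)
    show "x \<bullet> (A *v x) + c * (norm x)\<^sup>2 \<le> x \<bullet> (- B *v x)" for x
      using le[of x] by (simp add: uminus_matrix_vector)
  qed
  then show False using B by (simp add: dual_subeq_def)
qed

lemma cone_subequation_dual:
  assumes F: "cone_subequation F"
  shows "cone_subequation (dual_subeq F)"
  unfolding cone_subequation_def
proof (intro conjI ballI allI impI)
  show "dual_subeq F \<subseteq> sym_mats" by (auto simp: dual_subeq_def)
  show "closed (dual_subeq F)"
    unfolding closed_sequential_limits
  proof (intro allI impI)
    fix X A assume X: "(\<forall>n. X n \<in> dual_subeq F) \<and> X \<longlonglongrightarrow> A"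
    then have A: "A \<in> sym_mats" using closed_sequentially[OF closed_sym_mats, of X A] by (auto simp: dual_subeq_def)
    have "- A \<notin> sym_interior F"
    proof
      assume "- A \<in> sym_interior F"
      then obtain e where e: "e > 0" "\<And>B. B \<in> sym_mats \<Longrightarrow> dist B (- A) < e \<Longrightarrow> B \<in> F"
        unfolding sym_interior_def by blast
      obtain n where n: "dist (X n) A < e / 2" using X e(1) unfolding lim_sequentially by (meson half_gt_zero order_refl)
      then have n': "dist (- X n) (- A) < e / 2" by (simp add: dist_norm norm_minus_commute)
      have "B \<in> F" if "B \<in> sym_mats" "dist B (- X n) < e / 2" for B
        by (rule e(2)[OF that(1) dist_triangle_half_l[OF that(2), of "- A"]]) (use n' in \<open>simp add: dist_commute\<close>)
      moreover have "- X n \<in> sym_mats" using X by (auto simp: dual_subeq_def sym_mats_uminus)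
      ultimately have "- X n \<in> sym_interior F" unfolding sym_interior_def using e(1) half_gt_zero by blast
      then show False using X by (auto simp: dual_subeq_def)
    qed
    then show "A \<in> dual_subeq F" using A by (simp add: dual_subeq_def)
  qed
  have up: "B + P \<in> sym_interior F" if B: "B \<in> sym_interior F" and P: "psd P" for B P
  proof -
    obtain c where c: "c > 0" "B - c *\<^sub>R mat 1 \<in> F" using sym_interior_minus_mat[OF B] by blast
    show ?thesis
    proof (rule sym_interior_if_strictly_above[OF F c(2) _ c(1)])
      show "B + P \<in> sym_mats" using B P by (auto simp: sym_interior_def psd_def intro: sym_mats_add)
      show "x \<bullet> ((B - c *\<^sub>R mat 1) *v x) + c * (norm x)\<^sup>2 \<le> x \<bullet> ((B + P) *v x)" for x
        using P by (simp add: psd_def matrix_vector_mult_diff_rdistrib matrix_vector_mult_add_rdistrib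
            scaleR_mat_vec inner_diff_right inner_add_right power2_norm_eq_inner)
    qed
  qed
  show "A + P \<in> dual_subeq F" if A: "A \<in> dual_subeq F" and P: "psd P" for A P
  proof -
    have "- A \<in> sym_interior F" if "- (A + P) \<in> sym_interior F" using up[OF that P] by simp
    then show ?thesis using A P by (auto simp: dual_subeq_def psd_def intro: sym_mats_add)
  qed
  show "(\<lambda>A. t *\<^sub>R A) ` dual_subeq F = dual_subeq F" if t: "t > 0" for t
  proof -
    have *: "s *\<^sub>R A \<in> dual_subeq F" if s: "s > 0" and A: "A \<in> dual_subeq F" for s A
    proof -
      have "- A \<in> sym_interior F" if "- (s *\<^sub>R A) \<in> sym_interior F"
        using sym_interior_scaleR[OF F, of "1 / s" "- (s *\<^sub>R A)"] that s by simp
      then show ?thesis using A by (auto simp: dual_subeq_def sym_mats_scaleR)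
    qed
    show ?thesis
    proof
      show "(\<lambda>A. t *\<^sub>R A) ` dual_subeq F \<subseteq> dual_subeq F" using *[OF t] by blast
      show "dual_subeq F \<subseteq> (\<lambda>A. t *\<^sub>R A) ` dual_subeq F"
      proof
        fix A assume "A \<in> dual_subeq F"
        then have "(1 / t) *\<^sub>R A \<in> dual_subeq F" using * t by simp
        then show "A \<in> (\<lambda>A. t *\<^sub>R A) ` dual_subeq F" using t by (intro image_eqI[of _ _ "(1 / t) *\<^sub>R A"]) auto
      qed
    qed
  qed
qed

section \<open>Upper semicontinuity, and operations that preserve subharmonicity\<close>

lemma usc_on_subset: "usc_on X u \<Longrightarrow> Y \<subseteq> X \<Longrightarrow> usc_on Y u"
  unfolding usc_on_def by (meson subsetD)

lemma continuous_imp_usc_on: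
  assumes "continuous_on X (u :: real^'n \<Rightarrow> real)" shows "usc_on X u"
  unfolding usc_on_def
proof (intro ballI allI impI)
  fix x and e :: real assume x: "x \<in> X" "e > 0"
  then obtain d where d: "d > 0" "\<And>y. y \<in> X \<Longrightarrow> dist y x < d \<Longrightarrow> dist (u y) (u x) < e"
    using assms unfolding continuous_on_iff by blast
  then show "\<exists>d>0. \<forall>y\<in>X. dist y x < d \<longrightarrow> u y < u x + e"
    by (intro exI[of _ d]) (force simp: dist_real_def)
qed

lemma usc_on_diff_continuous:
  assumes u: "usc_on X u" and g: "continuous_on X (g :: real^'n \<Rightarrow> real)"
  shows "usc_on X (\<lambda>x. u x - g x)"
  unfolding usc_on_def
proof (intro ballI allI impI)
  fix x and e :: real assume x: "x \<in> X" "e > 0"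
  obtain d1 where d1: "d1 > 0" "\<And>y. y \<in> X \<Longrightarrow> dist y x < d1 \<Longrightarrow> u y < u x + e / 2"
    using u x half_gt_zero[OF x(2)] unfolding usc_on_def by blast
  obtain d2 where d2: "d2 > 0" "\<And>y. y \<in> X \<Longrightarrow> dist y x < d2 \<Longrightarrow> dist (g y) (g x) < e / 2"
    using g x half_gt_zero[OF x(2)] unfolding continuous_on_iff by blast
  have "u y - g y < u x - g x + e" if "y \<in> X" "dist y x < min d1 d2" for y
  proof -
    have "\<bar>g y - g x\<bar> < e / 2" using d2(2)[of y] that by (simp add: dist_real_def)
    moreover have "u y < u x + e / 2" using d1(2)[of y] that by simp
    ultimately show ?thesis by linarith
  qed
  then show "\<exists>d>0. \<forall>y\<in>X. dist y x < d \<longrightarrow> u y - g y < u x - g x + e"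
    using d1(1) d2(1) by (intro exI[of _ "min d1 d2"]) auto
qed

text \<open>Without a maximum, the relatively open sets where \<open>u\<close> is below
  \<open>u y\<close> would cover \<open>C\<close>; in a finite subcover the centre with the largest
  value is left uncovered.\<close>

lemma usc_on_attains_sup:
  assumes C: "compact C" "C \<noteq> {}" and u: "usc_on C u"
  shows "\<exists>x\<in>C. \<forall>y\<in>C. u y \<le> u x"
proof (rule ccontr)
  assume "\<not> ?thesis"
  then have above: "\<forall>x\<in>C. \<exists>y\<in>C. u x < u y" by force
  have "\<exists>V. open V \<and> {x \<in> C. u x < a} = C \<inter> V" for a
  proof -
    have "\<forall>x\<in>{x \<in> C. u x < a}. \<exists>d>0. \<forall>y\<in>C. dist y x < d \<longrightarrow> u y < a"
      using u unfolding usc_on_def by (metis (no_types, lifting) add.commute diff_add_cancel diff_gt_0_iff_gt mem_Collect_eq)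
    then obtain d where d: "\<And>x. x \<in> C \<Longrightarrow> u x < a \<Longrightarrow> d x > 0 \<and> (\<forall>y\<in>C. dist y x < d x \<longrightarrow> u y < a)"
      by (metis (no_types, lifting) mem_Collect_eq)
    let ?V = "\<Union>x\<in>{x \<in> C. u x < a}. ball x (d x)"
    have "{x \<in> C. u x < a} = C \<inter> ?V"
    proof
      show "{x \<in> C. u x < a} \<subseteq> C \<inter> ?V" using d by (auto intro: centre_in_ball[THEN iffD2])
      show "C \<inter> ?V \<subseteq> {x \<in> C. u x < a}"
      proof
        fix y assume y: "y \<in> C \<inter> ?V"
        then obtain x where x: "x \<in> C" "u x < a" "y \<in> ball x (d x)" by auto
        then have "dist y x < d x" by (simp add: dist_commute)
        then show "y \<in> {x \<in> C. u x < a}" using d[OF x(1,2)] y by blast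
      qed
    qed
    moreover have "open ?V" by auto
    ultimately show ?thesis by blast
  qed
  then obtain V where V: "\<And>a. open (V a)" "\<And>a. {x \<in> C. u x < a} = C \<inter> V a" by metis
  have "C \<subseteq> (\<Union>y\<in>C. V (u y))" using above V(2) by blast
  then obtain C' where C': "C' \<subseteq> C" "finite C'" "C \<subseteq> (\<Union>y\<in>C'. V (u y))"
    using compactE_image[OF C(1), of C "\<lambda>y. V (u y)"] V(1) by blast
  have "C' \<noteq> {}" using C(2) C'(3) by auto
  then have "Max (u ` C') \<in> u ` C'" using C'(2) by (intro Max_in) auto
  then obtain y where y: "y \<in> C'" "u y = Max (u ` C')" by auto
  then obtain z where z: "z \<in> C'" "y \<in> V (u z)" using C' by blast
  then have "u y < u z" using V(2)[of "u z"] y(1) C'(1) by blast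
  moreover have "u z \<le> Max (u ` C')" using C'(2) z(1) by (intro Max_ge) auto
  ultimately show False using y(2) by simp
qed

lemma subh_subset:
  assumes u: "subh F X u" and Y: "open Y" "Y \<subseteq> X"
  shows "subh F Y u"
  unfolding subh_def
proof (intro conjI ballI allI impI)
  show "usc_on Y u" using u Y(2) usc_on_subset unfolding subh_def by blast
  fix y p A assume y: "y \<in> Y" and A: "A \<in> sym_mats"
    and "\<exists>r>0. \<forall>x\<in>ball y r \<inter> Y. u x - qform p A x \<le> u y - qform p A y"
  then obtain r where r: "r > 0" "\<And>x. x \<in> ball y r \<inter> Y \<Longrightarrow> u x - qform p A x \<le> u y - qform p A y" by blast
  obtain s where s: "s > 0" "ball y s \<subseteq> Y" using Y(1) y open_contains_ball by blast
  show "A \<in> F"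
    by (rule subhD[OF u _ A, of y "min r s" p]) (use r s y Y in auto)
qed

lemma subh_cong:
  assumes "subh F X u" "\<And>x. x \<in> X \<Longrightarrow> u x = v x"
  shows "subh F X v"
proof -
  have "usc_on X v" using assms unfolding subh_def usc_on_def by simp
  moreover have "A \<in> F" if "y \<in> X" "A \<in> sym_mats" "r > 0" "\<forall>x\<in>ball y r \<inter> X. v x - qform p A x \<le> v y - qform p A y" for y p A r
    by (rule subhD[OF assms(1) that(1,2,3), of p]) (use that assms(2) in auto)
  ultimately show ?thesis unfolding subh_def by blast
qed

lemma subh_add_const:
  assumes "subh F X u" shows "subh F X (\<lambda>x. u x + c)"
proof -
  have "usc_on X (\<lambda>x. u x + c)"
    using usc_on_diff_continuous[of X u "\<lambda>x. - c"] assms unfolding subh_def by simp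
  moreover have "A \<in> F" if "y \<in> X" "A \<in> sym_mats" "r > 0"
    "\<forall>x\<in>ball y r \<inter> X. u x + c - qform p A x \<le> u y + c - qform p A y" for y p A r
    by (rule subhD[OF assms that(1,2,3), of p]) (use that in force)
  ultimately show ?thesis unfolding subh_def by blast
qed

lemma subh_scale:
  assumes F: "cone_subequation F" and u: "subh F X u" and t: "t > 0"
  shows "subh F X (\<lambda>x. t * u x)"
proof -
  have "usc_on X (\<lambda>x. t * u x)"
    unfolding usc_on_def
  proof (intro ballI allI impI)
    fix x and e :: real assume x: "x \<in> X" "e > 0"
    have "e / t > 0" using x(2) t by simp
    then obtain d where d: "d > 0" "\<And>y. y \<in> X \<Longrightarrow> dist y x < d \<Longrightarrow> u y < u x + e / t"
      using u x(1) unfolding subh_def usc_on_def by blast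
    have "t * u y < t * u x + e" if "y \<in> X" "dist y x < d" for y
      using mult_strict_left_mono[OF d(2)[OF that] t] t by (simp add: distrib_left)
    then show "\<exists>d>0. \<forall>y\<in>X. dist y x < d \<longrightarrow> t * u y < t * u x + e" using d(1) by blast
  qed
  moreover have "A \<in> F" if y: "y \<in> X" and A: "A \<in> sym_mats" and r: "r > 0"
    and le: "\<forall>x\<in>ball y r \<inter> X. t * u x - qform p A x \<le> t * u y - qform p A y" for y p A r
  proof -
    have "(1 / t) *\<^sub>R A \<in> F"
    proof (rule subhD[OF u y sym_mats_scaleR[OF A] r, of "(1 / t) *\<^sub>R p"])
      fix x assume "x \<in> ball y r" "x \<in> X"
      then have "(1 / t) * (t * u x - qform p A x) \<le> (1 / t) * (t * u y - qform p A y)"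
        using le t by (intro mult_left_mono) auto
      then show "u x - qform ((1 / t) *\<^sub>R p) ((1 / t) *\<^sub>R A) x \<le> u y - qform ((1 / t) *\<^sub>R p) ((1 / t) *\<^sub>R A) y"
        unfolding qform_scaleR using t by (simp add: right_diff_distrib)
    qed
    then have "t *\<^sub>R ((1 / t) *\<^sub>R A) \<in> F" by (rule cone_subequationD(4)[OF F t])
    then show ?thesis using t by simp
  qed
  ultimately show ?thesis unfolding subh_def by blast
qed

lemma subh_translate:
  assumes u: "subh F X u"
  shows "subh F {x. x + a \<in> X} (\<lambda>x. u (x + a))"
proof -
  have "usc_on {x. x + a \<in> X} (\<lambda>x. u (x + a))"
    unfolding usc_on_def
  proof (intro ballI allI impI)
    fix x and e :: real assume x: "x \<in> {x. x + a \<in> X}" "e > 0"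
    then obtain d where d: "d > 0" "\<And>y. y \<in> X \<Longrightarrow> dist y (x + a) < d \<Longrightarrow> u y < u (x + a) + e"
      using u unfolding subh_def usc_on_def by blast
    then show "\<exists>d>0. \<forall>y\<in>{x. x + a \<in> X}. dist y x < d \<longrightarrow> u (y + a) < u (x + a) + e"
      by (intro exI[of _ d]) auto
  qed
  moreover have "A \<in> F" if y: "y + a \<in> X" and A: "A \<in> sym_mats" and r: "r > 0"
    and le: "\<forall>x\<in>ball y r \<inter> {x. x + a \<in> X}. u (x + a) - qform p A x \<le> u (y + a) - qform p A y" for y p A r
  \<comment> \<open>Shifting a polynomial by \<open>a\<close> turns its linear part \<open>p\<close>
    into \<open>p - A *v a\<close>.\<close>
  proof (rule subhD[OF u y A r, of "p - A *v a"])
    fix x assume x: "x \<in> ball (y + a) r" "x \<in> X"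
    have "dist y (x - a) = dist (y + a) x" by (simp add: dist_norm algebra_simps)
    then have "u x - qform p A (x - a) \<le> u (y + a) - qform p A y"
      using bspec[OF le, of "x - a"] x by simp
    moreover have "qform p A (x - a) - qform p A y = qform (p - A *v a) A x - qform (p - A *v a) A (y + a)"
      unfolding qform_diff_eq[OF A] by (simp add: matrix_vector_right_distrib algebra_simps)
    ultimately show "u x - qform (p - A *v a) A x \<le> u (y + a) - qform (p - A *v a) A (y + a)" by linarith
  qed
  ultimately show ?thesis unfolding subh_def by blast
qed

text \<open>Around points of \<open>D\<close> outside \<open>W\<close> the condition makes the glued
  function equal to \<open>u\<close>; inside \<open>W\<close> it is a maximum of two subharmonic
  functions. Obstacles, bumps, lowered translates and boundary barriers are all glued in this
  way.\<close>

lemma subh_glue_max: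
  assumes W: "open W" "W \<subseteq> D" and u: "subh F D u" and w: "subh F W w"
    and out: "\<And>x. x \<in> D \<Longrightarrow> x \<notin> W \<Longrightarrow> \<exists>r>0. \<forall>z\<in>ball x r \<inter> W. w z \<le> u z"
  shows "subh F D (\<lambda>x. if x \<in> W then max (u x) (w x) else u x)" (is "subh F D ?v")
proof -
  have uscu: "usc_on D u" and uscw: "usc_on W w" using u w by (auto simp: subh_def)
  have "usc_on D ?v"
    unfolding usc_on_def
  proof (intro ballI allI impI)
    fix x and e :: real assume x: "x \<in> D" "e > 0"
    obtain d1 where d1: "d1 > 0" "\<And>y. y \<in> D \<Longrightarrow> dist y x < d1 \<Longrightarrow> u y < u x + e"
      using uscu x unfolding usc_on_def by blast
    show "\<exists>d>0. \<forall>y\<in>D. dist y x < d \<longrightarrow> ?v y < ?v x + e"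
    proof (cases "x \<in> W")
      case True
      obtain d2 where d2: "d2 > 0" "\<And>y. y \<in> W \<Longrightarrow> dist y x < d2 \<Longrightarrow> w y < w x + e"
        using uscw True x(2) unfolding usc_on_def by blast
      obtain d3 where d3: "d3 > 0" "ball x d3 \<subseteq> W" using W(1) True open_contains_ball by blast
      have "?v y < ?v x + e" if "y \<in> D" "dist y x < min d1 (min d2 d3)" for y
      proof -
        have "y \<in> W" using d3(2) that(2) by (auto simp: dist_commute)
        then show ?thesis using d1(2)[of y] d2(2)[of y] that True by auto
      qed
      then show ?thesis using d1(1) d2(1) d3(1) by (intro exI[of _ "min d1 (min d2 d3)"]) auto
    next
      case False
      obtain r where r: "r > 0" "\<And>z. z \<in> ball x r \<Longrightarrow> z \<in> W \<Longrightarrow> w z \<le> u z" using out[OF x(1) False] by blast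
      have "?v y < ?v x + e" if "y \<in> D" "dist y x < min d1 r" for y
        using d1(2)[of y] r(2)[of y] that False by (auto simp: dist_commute max_def)
      then show ?thesis using d1(1) r(1) by (intro exI[of _ "min d1 r"]) auto
    qed
  qed
  moreover have "A \<in> F" if y: "y \<in> D" and A: "A \<in> sym_mats" and r: "r > 0"
    and le: "\<forall>x\<in>ball y r \<inter> D. ?v x - qform p A x \<le> ?v y - qform p A y" for y p A r
  proof (cases "y \<in> W \<and> u y < w y")
    case True
    obtain d3 where d3: "d3 > 0" "ball y d3 \<subseteq> W" using W(1) True open_contains_ball by blast
    show ?thesis
    proof (rule subhD[OF w _ A, of y "min r d3" p])
      fix x assume x: "x \<in> ball y (min r d3)" "x \<in> W"
      then have "x \<in> ball y r \<inter> D" using W(2) by auto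
      then have "?v x - qform p A x \<le> ?v y - qform p A y" using le by blast
      then show "w x - qform p A x \<le> w y - qform p A y" using True x(2) by (auto simp: max_def split: if_splits)
    qed (use True r d3 in auto)
  next
    case False
    show ?thesis
    proof (rule subhD[OF u y A r, of p])
      fix x assume x: "x \<in> ball y r" "x \<in> D"
      then have "?v x - qform p A x \<le> ?v y - qform p A y" using le by blast
      moreover have "u x \<le> ?v x" by simp
      moreover have "?v y = u y" using False by (auto simp: max_def)
      ultimately show "u x - qform p A x \<le> u y - qform p A y" by linarith
    qed
  qed
  ultimately show ?thesis unfolding subh_def by blast
qed

text \<open>Of two polynomials in contact, the upper one has the larger Hessian: adding the contact
  inequalities for the displacements \<open>k\<close> and \<open>- k\<close> cancels the linear
  terms.\<close>

lemma subh_qform: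
  fixes F :: "(real^'n^'n) set"
  assumes F: "cone_subequation F" and B: "B \<in> F" and X: "open X"
  shows "subh F X (\<lambda>x. c + qform p B x)"
proof -
  have Bs: "B \<in> sym_mats" using B cone_subequationD(1)[OF F] by blast
  have "usc_on X (\<lambda>x. c + qform p B x)"
    by (intro continuous_imp_usc_on continuous_intros continuous_on_qform)
  moreover have "A \<in> F" if y: "y \<in> X" and A: "A \<in> sym_mats" and r: "r > 0"
    and le: "\<forall>x\<in>ball y r \<inter> X. c + qform p B x - qform q A x \<le> c + qform p B y - qform q A y" for y q A r
  proof (rule cone_subequation_mono[OF F B A])
    fix x
    show "x \<bullet> (B *v x) \<le> x \<bullet> (A *v x)"
    proof (cases "x = 0")
      case False
      obtain s where s: "s > 0" "ball y s \<subseteq> X" using X y open_contains_ball by blast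
      define t where "t = min r s / (2 * norm x)"
      have "norm (t *\<^sub>R x) = min r s / 2" using False r s by (simp add: t_def)
      then have t: "t > 0" "norm (t *\<^sub>R x) < r" "norm (t *\<^sub>R x) < s" using False r s(1) by (auto simp: t_def)
      have *: "c + qform p B (y + h) - qform q A (y + h) \<le> c + qform p B y - qform q A y"
        if "norm h < r" "norm h < s" for h
      proof -
        have "dist y (y + h) = norm h" by (simp add: dist_norm)
        then have "y + h \<in> ball y r \<inter> X" using s(2) that by auto
        then show ?thesis using le by blast
      qed
      define k where "k = t *\<^sub>R x"
      have neg: "M *v (- k) = - (M *v k)" for M :: "real^'n^'n" using matrix_vector_mult_scaleR[of M "-1" k] by simp
      from *[of k] *[of "- k"] t have "k \<bullet> (B *v k) \<le> k \<bullet> (A *v k)"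
        unfolding qform_add[OF A] qform_add[OF Bs] neg inner_minus_right inner_minus_left norm_minus_cancel k_def[symmetric]
        by linarith
      then have "(t *\<^sub>R x) \<bullet> (B *v (t *\<^sub>R x)) \<le> (t *\<^sub>R x) \<bullet> (A *v (t *\<^sub>R x))" by (simp add: k_def)
      then have "t * t * (x \<bullet> (B *v x)) \<le> t * t * (x \<bullet> (A *v x))" by (simp add: matrix_vector_mult_scaleR)
      then show ?thesis using t(1) by simp
    qed simp
  qed
  ultimately show ?thesis unfolding subh_def by blast
qed

text \<open>A violation survives the addition of a small multiple of the squared norm; at the
  resulting interior maximum a polynomial with Hessian \<open>- c *\<^sub>R mat 1\<close> touches
  \<open>v\<close> from above.\<close>

lemma subh_maximum_principle:
  fixes F :: "(real^'n^'n) set"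
  assumes C: "compact C" and D: "open D" "D \<subseteq> C" and v: "usc_on C v" "subh F D v"
    and neg: "\<And>c. c > 0 \<Longrightarrow> - c *\<^sub>R mat 1 \<notin> F" and M: "\<And>x. x \<in> C - D \<Longrightarrow> v x \<le> M" and x: "x \<in> C"
  shows "v x \<le> M"
proof (rule ccontr)
  assume "\<not> v x \<le> M"
  then have gt: "v x - M > 0" by simp
  obtain b where b: "b > 0" "\<And>x. x \<in> C \<Longrightarrow> norm x \<le> b" using compact_imp_bounded[OF C] bounded_pos by blast
  \<comment> \<open>With this value \<open>c / 2 * (norm y)\<^sup>2\<close> uses up at most half of
    the excess \<open>v x - M\<close>.\<close>
  define c where "c = (v x - M) / b\<^sup>2"
  have c: "c > 0" "c * b\<^sup>2 = v x - M" using gt b by (auto simp: c_def)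
  have q: "qform 0 (- c *\<^sub>R mat 1) y = - (c / 2 * (norm y)\<^sup>2)" for y :: "real^'n"
    unfolding qform_def scaleR_mat_vec by (simp add: power2_norm_eq_inner)
  have "usc_on C (\<lambda>y. v y - qform 0 (- c *\<^sub>R mat 1) y)"
    by (intro usc_on_diff_continuous v continuous_on_qform)
  then obtain y where y: "y \<in> C" "\<And>z. z \<in> C \<Longrightarrow> v z - qform 0 (- c *\<^sub>R mat 1) z \<le> v y - qform 0 (- c *\<^sub>R mat 1) y"
    using usc_on_attains_sup[OF C, of "\<lambda>y. v y - qform 0 (- c *\<^sub>R mat 1) y"] x by blast
  have "y \<in> D"
  proof (rule ccontr)
    assume "y \<notin> D"
    then have "v y \<le> M" using M y(1) by blast
    moreover have "c / 2 * (norm y)\<^sup>2 \<le> c / 2 * b\<^sup>2" using b(2)[OF y(1)] c(1) by (intro mult_left_mono power_mono) auto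
    moreover have "0 \<le> c / 2 * (norm x)\<^sup>2" using c(1) by simp
    ultimately show False using y(2)[OF x] c(2) gt unfolding q by linarith
  qed
  moreover obtain r where "r > 0" "ball y r \<subseteq> D" using D(1) \<open>y \<in> D\<close> open_contains_ball by blast
  moreover have "- c *\<^sub>R mat 1 \<in> (sym_mats :: (real^'n^'n) set)" by (intro sym_mats_scaleR sym_mats_mat)
  ultimately have "- c *\<^sub>R mat 1 \<in> F"
    by (intro subhD[OF v(2), of y _ r 0]) (use y(2) D(2) in blast)+
  then show False using neg c(1) by blast
qed

section \<open>Comparison\<close>

text \<open>The sup-convolution is \<open>f x - k / 2 * (norm x)\<^sup>2\<close>. Expanding the
  square, \<open>f\<close> is a maximum over y of functions affine in x with slopes
  \<open>k *\<^sub>R y\<close>; so it is convex, with subgradient \<open>k *\<^sub>R Y x\<close> at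
  x, and the bound \<open>b\<close> on \<open>C\<close> bounds the slopes.\<close>

lemma sup_convolution:
  fixes u :: "real^'n \<Rightarrow> real"
  assumes C: "compact C" "C \<noteq> {}" and u: "continuous_on C u" and k: "k > 0" and b: "\<And>x. x \<in> C \<Longrightarrow> norm x \<le> b"
  shows "\<exists>f Y. bounded_subgrads (k * b) f \<and> (\<forall>x. Y x \<in> C) \<and>
    (\<forall>x. f x - k / 2 * (norm x)\<^sup>2 = u (Y x) - k / 2 * (norm (x - Y x))\<^sup>2) \<and>
    (\<forall>x. \<forall>y\<in>C. u y - k / 2 * (norm (x - y))\<^sup>2 \<le> f x - k / 2 * (norm x)\<^sup>2)"
proof -
  have "\<exists>y\<in>C. \<forall>y'\<in>C. u y' - k / 2 * (norm (x - y'))\<^sup>2 \<le> u y - k / 2 * (norm (x - y))\<^sup>2" for x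
    by (intro continuous_attains_sup C continuous_intros u)
  then obtain Y where Y: "\<And>x. Y x \<in> C"
    "\<And>x y. y \<in> C \<Longrightarrow> u y - k / 2 * (norm (x - y))\<^sup>2 \<le> u (Y x) - k / 2 * (norm (x - Y x))\<^sup>2" by metis
  define f where "f x = u (Y x) - k / 2 * (norm (x - Y x))\<^sup>2 + k / 2 * (norm x)\<^sup>2" for x
  have sq: "k / 2 * (norm (x - y))\<^sup>2 = k / 2 * (norm x)\<^sup>2 - k * (y \<bullet> x) + k / 2 * (norm y)\<^sup>2" for x y :: "real^'n"
    by (simp add: power2_norm_eq_inner inner_diff_left inner_diff_right inner_commute[of x y] distrib_left right_diff_distrib)
  have "subgrad f x (k *\<^sub>R Y x)" for x
    unfolding subgrad_def
  proof
    fix z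
    show "f x + (k *\<^sub>R Y x) \<bullet> (z - x) \<le> f z"
      using Y(2)[OF Y(1)[of x], of z] unfolding f_def sq by (simp add: inner_diff_right right_diff_distrib)
  qed
  moreover have "norm (k *\<^sub>R Y x) \<le> k * b" for x using b[OF Y(1)] k by simp
  ultimately have "bounded_subgrads (k * b) f" unfolding bounded_subgrads_def by blast
  then show ?thesis by (intro exI[of _ f] exI[of _ Y]) (use Y in \<open>auto simp: f_def\<close>)
qed

text \<open>The penalty depends on \<open>x - y\<close> alone, so moving both points by the same
  \<open>h\<close> leaves it unchanged. An expansion of the sup-convolution at x thus becomes a test
  polynomial for \<open>u\<close> at the maximizing point y.\<close>

lemma jet_of_sup_convolution:
  fixes u :: "real^'n \<Rightarrow> real"
  assumes F: "closed F" and u: "subh F D u" and D: "open D" "D \<subseteq> C" and y: "y \<in> D"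
    and eq: "f x - k / 2 * (norm x)\<^sup>2 = u y - k / 2 * (norm (x - y))\<^sup>2"
    and le: "\<And>x y. y \<in> C \<Longrightarrow> u y - k / 2 * (norm (x - y))\<^sup>2 \<le> f x - k / 2 * (norm x)\<^sup>2"
    and M: "second_order_expansion f x p M"
  shows "\<exists>A\<in>F. \<forall>h. h \<bullet> (A *v h) = h \<bullet> M h - k * (norm h)\<^sup>2"
proof -
  \<comment> \<open>The symmetric part of \<open>M\<close> has the same quadratic form and may serve
    as a Hessian.\<close>
  define N where "N = (1 / 2) *\<^sub>R (matrix M + transpose (matrix M))"
  have Ns: "N \<in> sym_mats" by (simp add: N_def sym_mats_iff transpose_def add.commute)
  have linM: "linear M" using M by (simp add: second_order_expansion_def)
  have hN: "h \<bullet> (N *v h) = h \<bullet> M h" for h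
  proof -
    have "h \<bullet> (transpose (matrix M) *v h) = h \<bullet> (matrix M *v h)"
      by (metis dot_lmul_matrix inner_commute transpose_matrix_vector)
    then show ?thesis
      by (simp add: N_def scaleR_matrix_vector_assoc[symmetric] matrix_vector_mult_add_rdistrib inner_add_right
          matrix_works[OF linear_matrix_vector_mul_eq[THEN iffD2, OF linM]] del: transpose_matrix_vector)
  qed
  define A where "A = N - k *\<^sub>R mat 1"
  have As: "A \<in> sym_mats" unfolding A_def by (intro sym_mats_diff sym_mats_scaleR sym_mats_mat Ns)
  have hA: "h \<bullet> (A *v h) = h \<bullet> M h - k * (norm h)\<^sup>2" for h
    by (simp add: A_def matrix_vector_mult_diff_rdistrib scaleR_mat_vec inner_diff_right hN power2_norm_eq_inner)
  have "A \<in> F"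
  proof (rule closed_add_small_mat[OF F])
    fix e :: real assume e: "e > 0"
    let ?A = "A + e *\<^sub>R mat 1"
    have A': "?A \<in> sym_mats" by (intro sym_mats_add sym_mats_scaleR sym_mats_mat As)
    obtain d where d: "d > 0" "\<And>h. norm h < d \<Longrightarrow> \<bar>f (x + h) - f x - p \<bullet> h - (h \<bullet> M h) / 2\<bar> \<le> e / 2 * (norm h)\<^sup>2"
      using second_order_expansionD[OF M, of "e / 2"] e by (metis half_gt_zero)
    define q where "q = p - k *\<^sub>R x - ?A *v y"
    show "?A \<in> F"
    proof (rule subhD[OF u y A' d(1), of q])
      fix w assume w: "w \<in> ball y d" "w \<in> D"
      define h where "h = w - y"
      have h: "norm h < d" "w = y + h" using w(1) by (auto simp: h_def dist_norm norm_minus_commute)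
      have xw: "x + h - w = x - y" by (simp add: h_def)
      have "u w - k / 2 * (norm (x - y))\<^sup>2 \<le> f (x + h) - k / 2 * (norm (x + h))\<^sup>2"
        using le[of w "x + h", unfolded xw] w(2) D(2) by blast
      moreover have "k / 2 * (norm (x + h))\<^sup>2 = k / 2 * (norm x)\<^sup>2 + k * (x \<bullet> h) + k / 2 * (norm h)\<^sup>2"
        using norm_add_scaleR_sq[of x 1 h] by (simp add: distrib_left)
      ultimately have "u w - u y \<le> f (x + h) - f x - k * (x \<bullet> h) - k / 2 * (norm h)\<^sup>2" using eq by linarith
      also have "\<dots> \<le> p \<bullet> h + (h \<bullet> M h) / 2 + e / 2 * (norm h)\<^sup>2 - k * (x \<bullet> h) - k / 2 * (norm h)\<^sup>2"
        using d(2)[OF h(1)] by linarith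
      also have "\<dots> = (q + ?A *v y) \<bullet> h + (h \<bullet> (?A *v h)) / 2"
        by (simp add: q_def inner_diff_left matrix_vector_mult_add_rdistrib scaleR_mat_vec inner_add_right hA
            power2_norm_eq_inner diff_divide_distrib add_divide_distrib)
      also have "\<dots> = qform q ?A w - qform q ?A y" unfolding qform_diff_eq[OF A'] h_def ..
      finally show "u w - qform q ?A w \<le> u y - qform q ?A y" by linarith
    qed
  qed
  then show ?thesis using hA by blast
qed

text \<open>The strictness gained from the term in \<open>\<eta>\<close> makes the Hessians found by Jensen's
  argument contradict duality.\<close>

theorem comparison:
  fixes u v :: "real^'n \<Rightarrow> real"
  assumes F: "cone_subequation F" and C: "compact C" and D: "open D" "D \<subseteq> C"
    and u: "continuous_on C u" "subh F D u" and v: "continuous_on C v" "subh (dual_subeq F) D v"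
    and bd: "\<And>x. x \<in> C - D \<Longrightarrow> u x + v x \<le> 0" and x: "x \<in> C"
  shows "u x + v x \<le> 0"
proof (rule ccontr)
  assume "\<not> u x + v x \<le> 0"
  define z0 where "z0 = x"
  define m where "m = u z0 + v z0"
  have m: "m > 0" and z0: "z0 \<in> C" using \<open>\<not> u x + v x \<le> 0\<close> x by (auto simp: m_def z0_def)
  obtain b where b: "b > 0" "\<And>x. x \<in> C \<Longrightarrow> norm x \<le> b" using compact_imp_bounded[OF C] bounded_pos by blast
  \<comment> \<open>On \<open>C\<close> the added term is at most \<open>m / 4\<close>, too little
    to carry the maximum to \<open>C - D\<close>.\<close>
  define \<eta> where "\<eta> = m / (2 * b\<^sup>2)"
  have \<eta>: "\<eta> > 0" "\<eta> / 2 * b\<^sup>2 = m / 4" using m b(1) by (auto simp: \<eta>_def)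
  have quad: "0 \<le> \<eta> / 2 * (norm x)\<^sup>2" "\<eta> / 2 * (norm x)\<^sup>2 \<le> m / 4" if "x \<in> C" for x
  proof -
    show "0 \<le> \<eta> / 2 * (norm x)\<^sup>2" using \<eta>(1) by simp
    have "\<eta> / 2 * (norm x)\<^sup>2 \<le> \<eta> / 2 * b\<^sup>2" using \<eta>(1) b(2)[OF that] by (intro mult_left_mono power_mono) auto
    then show "\<eta> / 2 * (norm x)\<^sup>2 \<le> m / 4" using \<eta>(2) by simp
  qed
  define w0 where "w0 x = u x + v x + \<eta> / 2 * (norm x)\<^sup>2" for x
  have w0c: "continuous_on C w0" unfolding w0_def by (intro continuous_intros u v)
  have "\<exists>\<delta>>0. \<forall>x\<in>C. \<forall>y\<in>C. dist y x < \<delta> \<longrightarrow> \<bar>g y - g x\<bar> < m / 16" if "continuous_on C g" for g :: "real^'n \<Rightarrow> real"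
  proof -
    have "m / 16 > 0" using m by simp
    then show ?thesis
      using compact_uniformly_continuous[OF that C] unfolding uniformly_continuous_on_def dist_real_def by blast
  qed
  from this[OF u(1)] this[OF v(1)] this[OF w0c]
  obtain \<delta>1 \<delta>2 \<delta>3 where \<delta>s: "\<delta>1 > 0" "\<forall>x\<in>C. \<forall>y\<in>C. dist y x < \<delta>1 \<longrightarrow> \<bar>u y - u x\<bar> < m / 16"
    "\<delta>2 > 0" "\<forall>x\<in>C. \<forall>y\<in>C. dist y x < \<delta>2 \<longrightarrow> \<bar>v y - v x\<bar> < m / 16"
    "\<delta>3 > 0" "\<forall>x\<in>C. \<forall>y\<in>C. dist y x < \<delta>3 \<longrightarrow> \<bar>w0 y - w0 x\<bar> < m / 16" by blast
  define \<delta> where "\<delta> = min \<delta>1 (min \<delta>2 \<delta>3)"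
  have \<delta>: "\<delta> > 0" using \<delta>s by (simp add: \<delta>_def)
  have \<delta>u: "\<bar>u y - u x\<bar> < m / 16" and \<delta>v: "\<bar>v y - v x\<bar> < m / 16" and \<delta>w: "\<bar>w0 y - w0 x\<bar> < m / 16"
    if "x \<in> C" "y \<in> C" "norm (x - y) < \<delta>" for x y
    using \<delta>s that by (auto simp: \<delta>_def dist_norm norm_minus_commute)
  have "bounded (u ` C)" "bounded (v ` C)" using C u(1) v(1) compact_continuous_image compact_imp_bounded by blast+
  then obtain B1 B2 where "\<forall>x\<in>C. \<bar>u x\<bar> \<le> B1" "\<forall>x\<in>C. \<bar>v x\<bar> \<le> B2" unfolding bounded_iff by auto
  define B where "B = max 0 (max B1 B2)"
  have B: "B \<ge> 0" "\<And>x. x \<in> C \<Longrightarrow> \<bar>u x\<bar> \<le> B" "\<And>x. x \<in> C \<Longrightarrow> \<bar>v x\<bar> \<le> B"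
    using \<open>\<forall>x\<in>C. \<bar>u x\<bar> \<le> B1\<close> \<open>\<forall>x\<in>C. \<bar>v x\<bar> \<le> B2\<close> by (force simp: B_def)+
  \<comment> \<open>The first summand makes the penalty at distance \<open>\<delta>\<close> exceed
    the oscillation \<open>2 * B\<close>, so maximizers stay within \<open>\<delta>\<close>; the
    second makes \<open>2 * k - \<eta>\<close> positive.\<close>
  define k where "k = (4 * B + 1) / \<delta>\<^sup>2 + \<eta>"
  have k\<eta>: "k > \<eta>" using B(1) \<delta> by (simp add: k_def add_nonneg_pos)
  then have k: "k > 0" using \<eta>(1) by simp
  have k\<delta>: "k / 2 * \<delta>\<^sup>2 > 2 * B"
  proof -
    have "(4 * B + 1) / \<delta>\<^sup>2 * \<delta>\<^sup>2 \<le> k * \<delta>\<^sup>2" using \<eta>(1) by (intro mult_right_mono) (auto simp: k_def)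
    then show ?thesis using \<delta> by simp
  qed
  have near: "norm (x - Y) < \<delta> \<and> \<bar>g Y - g x\<bar> \<le> 2 * B"
    if "x \<in> C" "Y \<in> C" "\<And>x. x \<in> C \<Longrightarrow> \<bar>g x\<bar> \<le> B" "g x \<le> g Y - k / 2 * (norm (x - Y))\<^sup>2" for g :: "real^'n \<Rightarrow> real" and x Y
  proof -
    have g2: "\<bar>g Y - g x\<bar> \<le> 2 * B" using that(3)[OF that(1)] that(3)[OF that(2)] by linarith
    then have "k / 2 * (norm (x - Y))\<^sup>2 < k / 2 * \<delta>\<^sup>2" using that(4) k\<delta> by linarith
    then have "(norm (x - Y))\<^sup>2 < \<delta>\<^sup>2" using k by simp
    then have "norm (x - Y) < \<delta>" using \<delta> by (simp add: power2_less_imp_less)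
    then show ?thesis using g2 by blast
  qed
  have Cne: "C \<noteq> {}" using z0 by blast
  obtain f Y where f: "bounded_subgrads (k * b) f" "\<And>x. Y x \<in> C"
    "\<And>x. f x - k / 2 * (norm x)\<^sup>2 = u (Y x) - k / 2 * (norm (x - Y x))\<^sup>2"
    "\<And>x y. y \<in> C \<Longrightarrow> u y - k / 2 * (norm (x - y))\<^sup>2 \<le> f x - k / 2 * (norm x)\<^sup>2"
    using sup_convolution[OF C Cne u(1) k b(2)] by blast
  obtain g Z where g: "bounded_subgrads (k * b) g" "\<And>x. Z x \<in> C"
    "\<And>x. g x - k / 2 * (norm x)\<^sup>2 = v (Z x) - k / 2 * (norm (x - Z x))\<^sup>2"
    "\<And>x y. y \<in> C \<Longrightarrow> v y - k / 2 * (norm (x - y))\<^sup>2 \<le> g x - k / 2 * (norm x)\<^sup>2"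
    using sup_convolution[OF C Cne v(1) k b(2)] by blast
  have u_le: "u x \<le> f x - k / 2 * (norm x)\<^sup>2" and v_le: "v x \<le> g x - k / 2 * (norm x)\<^sup>2" if "x \<in> C" for x
    using f(4)[OF that, of x] g(4)[OF that, of x] by auto
  have Yn: "norm (x - Y x) < \<delta>" and Zn: "norm (x - Z x) < \<delta>" if "x \<in> C" for x

    using near[of x "Y x" u, OF that f(2) B(2)] near[of x "Z x" v, OF that g(2) B(3)] u_le[OF that] v_le[OF that]
    unfolding f(3) g(3) by auto
  have f_le: "f x - k / 2 * (norm x)\<^sup>2 \<le> u x + m / 16" and g_le: "g x - k / 2 * (norm x)\<^sup>2 \<le> v x + m / 16" if "x \<in> C" for x
  proof -
    have "0 \<le> k / 2 * (norm (x - Y x))\<^sup>2" "0 \<le> k / 2 * (norm (x - Z x))\<^sup>2" using k by auto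
    then show "f x - k / 2 * (norm x)\<^sup>2 \<le> u x + m / 16" "g x - k / 2 * (norm x)\<^sup>2 \<le> v x + m / 16"
      using \<delta>u[OF that f(2) Yn[OF that]] \<delta>v[OF that g(2) Zn[OF that]] f(3)[of x] g(3)[of x] by linarith+
  qed
  \<comment> \<open>Outside \<open>D'\<close> the function \<open>w0\<close> is at most
    \<open>m / 2\<close>, while \<open>w0 z0 \<ge> m\<close>; regularization adds at most
    \<open>m / 8\<close> and cannot close this gap.\<close>
  define D' where "D' = D \<inter> w0 -` {m / 2<..}"
  have D': "open D'" "D' \<subseteq> C"
    using continuous_on_open_vimage[OF D(1), of w0] continuous_on_subset[OF w0c D(2)] D(2)
    by (auto simp: D'_def Int_commute)
  have z0m: "w0 z0 \<ge> m" using quad(1)[OF z0] by (simp add: w0_def m_def)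
  have "z0 \<in> D" using bd[of z0] z0 m by (force simp: m_def)
  then have z0D': "z0 \<in> D'" using z0m m by (simp add: D'_def)
  \<comment> \<open>\<open>f\<close> and \<open>g\<close> each contain
    \<open>k / 2 * (norm x)\<^sup>2\<close>, so subtracting \<open>c / 2 * (norm x)\<^sup>2\<close>
    leaves the two sup-convolutions plus the term in \<open>\<eta>\<close>.\<close>
  define c where "c = 2 * k - \<eta>"
  have c: "c > 0" using k\<eta> k by (simp add: c_def)
  have Wc: "f x + g x - c / 2 * (norm x)\<^sup>2 = (f x - k / 2 * (norm x)\<^sup>2) + (g x - k / 2 * (norm x)\<^sup>2) + \<eta> / 2 * (norm x)\<^sup>2" for x
    by (simp add: c_def field_simps)
  have out: "w0 x \<le> m / 2" if "x \<in> C - D'" for x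
  proof (cases "x \<in> D")
    case True
    then show ?thesis using that by (auto simp: D'_def)
  next
    case False
    then show ?thesis using bd[of x] quad(2)[of x] that m by (auto simp: w0_def)
  qed
  obtain x p q M M' where J: "x \<in> D'" "second_order_expansion f x p M" "second_order_expansion g x q M'"
    "\<And>h. h \<bullet> M h + h \<bullet> M' h \<le> c * (norm h)\<^sup>2"
  proof (rule Jensen_maximum_principle[OF f(1) g(1) c C D' z0D'])
    fix x assume x: "x \<in> C - D'"
    then have xC: "x \<in> C" by blast
    have "f x + g x - c / 2 * (norm x)\<^sup>2 \<le> w0 x + m / 8" unfolding Wc w0_def using f_le[OF xC] g_le[OF xC] by linarith
    moreover have "w0 z0 \<le> f z0 + g z0 - c / 2 * (norm z0)\<^sup>2" unfolding Wc w0_def using u_le[OF z0] v_le[OF z0] by linarith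
    ultimately show "f x + g x - c / 2 * (norm x)\<^sup>2 < f z0 + g z0 - c / 2 * (norm z0)\<^sup>2"
      using out[OF x] z0m m by linarith
  qed blast
  have xC: "x \<in> C" and xm: "w0 x > m / 2" using J(1) D'(2) by (auto simp: D'_def)
  \<comment> \<open>The points where \<open>u\<close> and \<open>v\<close> are touched lie within
    \<open>\<delta>\<close> of x, where \<open>w0\<close> is still too large for a point of
    \<open>C - D\<close>.\<close>
  have inD: "y \<in> D" if "y \<in> C" "norm (x - y) < \<delta>" for y
  proof (rule ccontr)
    assume "y \<notin> D"
    then have "w0 y \<le> m / 4" using bd[of y] quad(2)[of y] that(1) by (auto simp: w0_def)
    then show False using \<delta>w[OF xC that] xm m by linarith
  qed
  obtain A where A: "A \<in> F" "\<And>h. h \<bullet> (A *v h) = h \<bullet> M h - k * (norm h)\<^sup>2"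
    using jet_of_sup_convolution[OF cone_subequationD(2)[OF F] u(2) D inD[OF f(2) Yn[OF xC]] f(3) f(4) J(2)] by blast
  obtain A' where A': "A' \<in> dual_subeq F" "\<And>h. h \<bullet> (A' *v h) = h \<bullet> M' h - k * (norm h)\<^sup>2"
    using jet_of_sup_convolution[OF cone_subequationD(2)[OF cone_subequation_dual[OF F]] v(2) D
        inD[OF g(2) Zn[OF xC]] g(3) g(4) J(3)] by blast
  \<comment> \<open>The two convexifications cost \<open>2 * k\<close> and Jensen's bound returns
    \<open>c\<close>; the difference is \<open>- \<eta>\<close>.\<close>
  show False
  proof (rule dual_contradiction[OF F A(1) A'(1) \<eta>(1)])
    show "h \<bullet> (A *v h) + h \<bullet> (A' *v h) \<le> - \<eta> * (norm h)\<^sup>2" for h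
      unfolding A(2) A'(2) using J(4)[of h] by (simp add: c_def algebra_simps)
  qed
qed

section \<open>Perron's method\<close>

text \<open>\<open>w\<close> is the upper semicontinuous envelope of the pointwise supremum, written
  as an infimum of local upper bounds. Adding \<open>c\<close> to the Hessian makes a contact of
  \<open>w\<close> strict; a member that nearly attains \<open>w\<close> close to y then has its own
  contact close to y.\<close>

lemma subh_usc_envelope_Sup:
  fixes F :: "(real^'n^'n) set"
  assumes F: "closed F" and D: "open D" and ne: "\<F> \<noteq> {}" and sub: "\<And>v. v \<in> \<F> \<Longrightarrow> subh F D v"
    and G: "continuous_on D G" and le: "\<And>v x. v \<in> \<F> \<Longrightarrow> x \<in> D \<Longrightarrow> v x \<le> G x"
  shows "\<exists>w. subh F D w \<and> (\<forall>x\<in>D. w x \<le> G x \<and> (\<forall>v\<in>\<F>. v x \<le> w x))"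
proof -
  define S where "S x = {a. \<exists>r>0. \<forall>y\<in>ball x r \<inter> D. \<forall>v\<in>\<F>. v y \<le> a}" for x
  define w where "w x = Inf (S x)" for x
  obtain v0 where v0: "v0 \<in> \<F>" using ne by blast
  have GS: "G x + e \<in> S x" if x: "x \<in> D" and e: "e > 0" for x e
  proof -
    obtain r where r: "r > 0" "\<And>y. y \<in> D \<Longrightarrow> dist y x < r \<Longrightarrow> dist (G y) (G x) < e"
      using G x e unfolding continuous_on_iff by blast
    have "v y \<le> G x + e" if "y \<in> ball x r \<inter> D" "v \<in> \<F>" for y v
    proof -
      have "\<bar>G y - G x\<bar> < e" using r(2)[of y] that by (auto simp: dist_commute dist_real_def)
      then show ?thesis using le[OF that(2), of y] that(1) by auto
    qed
    then show ?thesis using r(1) by (auto simp: S_def)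
  qed
  have lb: "v x \<le> a" if "x \<in> D" "v \<in> \<F>" "a \<in> S x" for x v a using that by (auto simp: S_def)
  have bdd: "bdd_below (S x)" if "x \<in> D" for x using lb[OF that v0] by (rule bdd_belowI)
  have Sne: "S x \<noteq> {}" if "x \<in> D" for x using GS[OF that, of 1] by auto
  have vw: "v x \<le> w x" if "x \<in> D" "v \<in> \<F>" for x v
    unfolding w_def using lb[OF that] by (intro cInf_greatest Sne that)
  have wG: "w x \<le> G x" if "x \<in> D" for x
  proof (rule field_le_epsilon)
    fix e :: real assume "e > 0"
    then show "w x \<le> G x + e" unfolding w_def by (intro cInf_lower GS bdd that)
  qed
  have wup: "\<exists>r>0. \<forall>y\<in>ball x r \<inter> D. \<forall>v\<in>\<F>. v y \<le> w x + e" if x: "x \<in> D" and e: "e > 0" for x e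
  proof -
    have "Inf (S x) < w x + e" using e by (simp add: w_def)
    then obtain a where a: "a \<in> S x" "a < w x + e" using cInf_lessD[OF Sne[OF x]] by blast
    then obtain r where "r > 0" "\<forall>y\<in>ball x r \<inter> D. \<forall>v\<in>\<F>. v y \<le> a" by (auto simp: S_def)
    then show ?thesis using a(2) by (meson less_imp_le order_trans)
  qed
  have wlow: "\<exists>y\<in>ball x r \<inter> D. \<exists>v\<in>\<F>. v y > w x - e" if x: "x \<in> D" and e: "e > 0" and r: "r > 0" for x e r
  proof (rule ccontr)
    assume "\<not> ?thesis"
    then have "w x - e \<in> S x" using r by (force simp: S_def not_less)
    then have "w x \<le> w x - e" unfolding w_def using bdd[OF x] by (intro cInf_lower) (auto simp: w_def)
    then show False using e by simp
  qed
  have "usc_on D w"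
    unfolding usc_on_def
  proof (intro ballI allI impI)
    fix x and e :: real assume x: "x \<in> D" "e > 0"
    obtain r where r: "r > 0" "\<And>y v. y \<in> ball x r \<inter> D \<Longrightarrow> v \<in> \<F> \<Longrightarrow> v y \<le> w x + e / 2"
      using wup[OF x(1) half_gt_zero[OF x(2)]] by blast
    have "w y < w x + e" if y: "y \<in> D" "dist y x < r" for y
    proof -
      have "ball y (r - dist y x) \<subseteq> ball x r" by (simp add: ball_subset_ball_iff dist_commute)
      then have "w x + e / 2 \<in> S y" unfolding S_def using r(2) y(2)
        by (intro CollectI exI[of _ "r - dist y x"]) auto
      then have "w y \<le> w x + e / 2" unfolding w_def[of y] by (intro cInf_lower bdd y)
      then show ?thesis using x(2) by simp
    qed
    then show "\<exists>d>0. \<forall>y\<in>D. dist y x < d \<longrightarrow> w y < w x + e" using r(1) by blast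
  qed
  moreover have "A \<in> F" if y: "y \<in> D" and A: "A \<in> sym_mats" and r: "r > 0"
    and t: "\<forall>x\<in>ball y r \<inter> D. w x - qform p A x \<le> w y - qform p A y" for y p A r
  proof (rule closed_add_small_mat[OF F])
    fix c :: real assume c: "c > 0"
    let ?A = "A + c *\<^sub>R mat 1"
    have A': "?A \<in> sym_mats" by (intro sym_mats_add sym_mats_scaleR sym_mats_mat A)
    obtain r0 where r0: "r0 > 0" "ball y r0 \<subseteq> D" using D y open_contains_ball by blast
    define s where "s = min r r0 / 2"
    have s: "s > 0" "s < r" "s < r0" using r r0(1) by (auto simp: s_def)
    have cs: "cball y s \<subseteq> ball y r \<inter> D" using s r0(2) by force
    define Q where "Q x = qform (p - c *\<^sub>R y) ?A x" for x
    have Q: "Q x - Q y = qform p A x - qform p A y + c / 2 * (norm (x - y))\<^sup>2" for x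
      unfolding Q_def qform_add_scaled_mat by simp
    \<comment> \<open>A loss below \<open>2 * \<epsilon>\<close> confines the maximum point to
      distance \<open>s / 2\<close> of y, so the ball of that radius around it stays in
      \<open>cball y s\<close>.\<close>
    define \<epsilon> where "\<epsilon> = c * s\<^sup>2 / 16"
    have \<epsilon>: "\<epsilon> > 0" using c s(1) by (simp add: \<epsilon>_def)
    have "isCont Q y" unfolding Q_def using continuous_on_qform[of UNIV] continuous_on_eq_continuous_at by blast
    then obtain r1 where r1: "r1 > 0" "\<And>x. dist x y < r1 \<Longrightarrow> \<bar>Q x - Q y\<bar> < \<epsilon>"
      using \<epsilon> unfolding continuous_at_eps_delta dist_real_def by blast
    have "min s r1 > 0" using s(1) r1(1) by simp
    from wlow[OF y \<epsilon> this] obtain x1 v where x1: "x1 \<in> ball y (min s r1) \<inter> D" and v: "v \<in> \<F>" "v x1 > w y - \<epsilon>" by blast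
    have x1c: "x1 \<in> cball y s" and x1Q: "\<bar>Q x1 - Q y\<bar> < \<epsilon>" using x1 r1(2)[of x1] by (auto simp: dist_commute)
    have "usc_on (cball y s) (\<lambda>x. v x - Q x)"
    proof (rule usc_on_diff_continuous)
      show "usc_on (cball y s) v" using sub[OF v(1)] usc_on_subset cs unfolding subh_def by blast
      show "continuous_on (cball y s) Q" unfolding Q_def by (rule continuous_on_qform)
    qed
    then obtain z where z: "z \<in> cball y s" "\<And>x. x \<in> cball y s \<Longrightarrow> v x - Q x \<le> v z - Q z"
      using usc_on_attains_sup[OF compact_cball, of y s "\<lambda>x. v x - Q x"] s(1) by auto
    have zD: "z \<in> D" "z \<in> ball y r" using z(1) cs by auto
    have "v x1 - Q x1 \<le> v z - Q z" using z(2)[OF x1c] .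
    moreover have "v z - Q z \<le> w y - Q y - c / 2 * (norm (z - y))\<^sup>2"
      using vw[OF zD(1) v(1)] bspec[OF t, of z] zD Q[of z] by auto
    ultimately have "c / 2 * (norm (z - y))\<^sup>2 < 2 * \<epsilon>" using v(2) x1Q by linarith
    then have "c * (norm (z - y))\<^sup>2 < c * (s / 2)\<^sup>2" by (simp add: \<epsilon>_def power_divide)
    then have "(norm (z - y))\<^sup>2 < (s / 2)\<^sup>2" using c by simp
    then have zy: "norm (z - y) < s / 2" by (rule power2_less_imp_less) (use s(1) in simp)
    have "s / 2 > 0" using s(1) by simp
    then show "?A \<in> F"
    proof (rule subhD[OF sub[OF v(1)] zD(1) A', of _ "p - c *\<^sub>R y"])
      fix x assume "x \<in> ball z (s / 2)"
      then have "dist y x \<le> s" using dist_triangle[of y x z] zy by (simp add: dist_norm norm_minus_commute)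
      then show "v x - qform (p - c *\<^sub>R y) ?A x \<le> v z - qform (p - c *\<^sub>R y) ?A z"
        using z(2)[of x] by (simp add: Q_def)
    qed
  qed
  ultimately have "subh F D w" unfolding subh_def by blast
  then show ?thesis using vw wG by blast
qed

text \<open>The segment from x to \<open>x + a\<close> leaves \<open>D\<close> through its frontier,
  which lies in \<open>C\<close> but outside the open set \<open>D\<close>.\<close>

lemma dist_boundary_le:
  fixes C :: "'a::real_normed_vector set"
  assumes C: "closed C" "D \<subseteq> C" and x: "x \<in> D" "x + a \<notin> D" and D: "open D"
  shows "\<exists>t\<in>C - D. dist x t \<le> norm a"
proof -
  have "closed_segment x (x + a) \<inter> frontier D \<noteq> {}"
    using connected_Int_frontier[OF connected_segment(1), of x "x + a" D] x by auto
  then obtain t where t: "t \<in> closed_segment x (x + a)" "t \<in> frontier D" by blast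
  have "t \<in> C - D"
    using t(2) closure_minimal[OF C(2,1)] D by (auto simp: frontier_def interior_open)
  moreover have "dist x t \<le> norm a" using segment_bound1[OF t(1)] by (simp add: dist_norm norm_minus_commute)
  ultimately show ?thesis by blast
qed

text \<open>\<open>C - D\<close> is whatever counts as boundary, isolated points included.
  \<open>G\<close> bounds the family from above and prescribes the boundary values, so barriers are
  asked for only from below.\<close>

theorem Perron:
  fixes F :: "(real^'n^'n) set"
  assumes F: "cone_subequation F" and C: "compact C" and D: "open D" "D \<subseteq> C" and T: "C - D \<noteq> {}"
    and G: "continuous_on C G" and superG: "subh (dual_subeq F) D (\<lambda>x. - G x)"
    and \<psi>: "subh F D \<psi>" "\<And>x. x \<in> C \<Longrightarrow> \<psi> x \<le> G x"
    and barrier: "\<And>x e. x \<in> C - D \<Longrightarrow> e > 0 \<Longrightarrow> \<exists>v. subh F D v \<and> (\<forall>y\<in>C. v y \<le> G y) \<and>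
      (\<exists>d>0. \<forall>y\<in>C. dist y x < d \<longrightarrow> G x - e \<le> v y)"
  shows "\<exists>u. continuous_on C u \<and> subh F D u \<and> subh (dual_subeq F) D (\<lambda>x. - u x)
    \<and> (\<forall>x\<in>C. \<psi> x \<le> u x \<and> u x \<le> G x) \<and> (\<forall>x\<in>C - D. u x = G x)"
proof -
  define \<F> where "\<F> = {v. subh F D v \<and> (\<forall>x\<in>C. v x \<le> G x)}"
  define u where "u x = (SUP v\<in>\<F>. v x)" for x
  have \<psi>\<F>: "\<psi> \<in> \<F>" using \<psi> by (auto simp: \<F>_def)
  have vG: "v x \<le> G x" if "v \<in> \<F>" "x \<in> C" for v x using that by (auto simp: \<F>_def)
  have vu: "v x \<le> u x" if "v \<in> \<F>" "x \<in> C" for v x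
    unfolding u_def using vG that by (intro cSUP_upper bdd_aboveI2[of _ _ "G x"]) auto
  have uG: "u x \<le> G x" if "x \<in> C" for x
    unfolding u_def using vG that \<psi>\<F> by (intro cSUP_least) auto
  obtain w where w: "subh F D w" "\<And>x. x \<in> D \<Longrightarrow> w x \<le> G x" "\<And>x v. x \<in> D \<Longrightarrow> v \<in> \<F> \<Longrightarrow> v x \<le> w x"
  proof -
    have "\<exists>w. subh F D w \<and> (\<forall>x\<in>D. w x \<le> G x \<and> (\<forall>v\<in>\<F>. v x \<le> w x))"
    proof (rule subh_usc_envelope_Sup[OF cone_subequationD(2)[OF F] D(1)])
      show "\<F> \<noteq> {}" using \<psi>\<F> by blast
      show "subh F D v" if "v \<in> \<F>" for v using that by (simp add: \<F>_def)
      show "continuous_on D G" using continuous_on_subset[OF G D(2)] .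
      show "v x \<le> G x" if "v \<in> \<F>" "x \<in> D" for v x using vG[OF that(1)] that(2) D(2) by blast
    qed
    then show ?thesis using that by blast
  qed
  \<comment> \<open>Extended by \<open>G\<close> outside \<open>D\<close>, the envelope is itself a
    competitor. It therefore coincides on \<open>D\<close> with the supremum, which is thus
    subharmonic.\<close>
  have "(\<lambda>x. if x \<in> D then w x else G x) \<in> \<F>"
    unfolding \<F>_def using subh_cong[OF w(1), of "\<lambda>x. if x \<in> D then w x else G x"] w(2) by auto
  then have wu: "w x \<le> u x" if "x \<in> D" for x
    using vu[of "\<lambda>x. if x \<in> D then w x else G x" x] that D(2) by auto
  have uw: "u x \<le> w x" if "x \<in> D" for x
    unfolding u_def using w(3)[OF that] \<psi>\<F> by (intro cSUP_least) auto
  have subu: "subh F D u" using w(1) wu uw by (intro subh_cong[of F D w u]) (auto intro: antisym)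
  have bu: "\<exists>d>0. \<forall>y\<in>C. dist y x < d \<longrightarrow> G x - e \<le> u y" if xe: "x \<in> C - D" "e > 0" for x e
  proof -
    obtain v d where v: "v \<in> \<F>" "d > 0" "\<forall>y\<in>C. dist y x < d \<longrightarrow> G x - e \<le> v y"
      using barrier[OF xe] unfolding \<F>_def by blast
    then show ?thesis using vu[OF v(1)] by (intro exI[of _ d]) (auto intro: order_trans)
  qed
  have uT: "u x = G x" if "x \<in> C - D" for x
  proof (rule antisym)
    show "G x \<le> u x"
    proof (rule field_le_epsilon)
      fix e :: real assume "e > 0"
      then show "G x \<le> u x + e" using bu[OF that] that by fastforce
    qed
  qed (use uG that in auto)
  have Tc: "compact (C - D)" using C D(1) by (rule compact_diff)
  have Gunif: "\<exists>d>0. \<forall>x\<in>C. \<forall>y\<in>C. dist y x < d \<longrightarrow> \<bar>G y - G x\<bar> < e" if "e > 0" for e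
    using compact_uniformly_continuous[OF G C] that unfolding uniformly_continuous_on_def dist_real_def by blast
  \<comment> \<open>A Lebesgue number for the balls of the individual barriers gives one
    \<open>\<delta>\<close> for the whole of \<open>C - D\<close>.\<close>
  have near: "\<exists>\<delta>>0. \<forall>x\<in>C - D. \<forall>y\<in>C. dist y x < \<delta> \<longrightarrow> G y - e \<le> u y" if e: "e > 0" for e
  proof -
    have e2: "e / 2 > 0" using e by simp
    obtain d0 where d0: "d0 > 0" "\<And>x y. x \<in> C \<Longrightarrow> y \<in> C \<Longrightarrow> dist y x < d0 \<Longrightarrow> \<bar>G y - G x\<bar> < e / 2"
      using Gunif[OF e2] by blast
    have "\<forall>x\<in>C - D. \<exists>d>0. \<forall>y\<in>C. dist y x < d \<longrightarrow> G x - e / 2 \<le> u y" using bu e2 by blast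
    then obtain d where d: "\<And>x. x \<in> C - D \<Longrightarrow> d x > 0" "\<And>x y. x \<in> C - D \<Longrightarrow> y \<in> C \<Longrightarrow> dist y x < d x \<Longrightarrow> G x - e / 2 \<le> u y"
      by metis
    let ?B = "(\<lambda>x. ball x (min (d x) d0)) ` (C - D)"
    have "C - D \<subseteq> \<Union> ?B" using d(1) d0(1) by force
    then obtain \<delta> where \<delta>: "\<delta> > 0" "\<And>x. x \<in> C - D \<Longrightarrow> \<exists>B\<in>?B. ball x \<delta> \<subseteq> B"
    proof (rule Heine_Borel_lemma[OF Tc, of ?B])
      show "open U" if "U \<in> ?B" for U using that by auto
    qed blast+
    have "G y - e \<le> u y" if xy: "x \<in> C - D" "y \<in> C" "dist y x < \<delta>" for x y
    proof -
      obtain x' where x': "x' \<in> C - D" "ball x \<delta> \<subseteq> ball x' (min (d x') d0)" using \<delta>(2)[OF xy(1)] by blast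
      have "y \<in> ball x' (min (d x') d0)" using x'(2) xy(3) by (auto simp: dist_commute subset_iff)
      then have "dist y x' < d x'" "dist y x' < d0" by (auto simp: dist_commute)
      then have "G x' - e / 2 \<le> u y" "\<bar>G y - G x'\<bar> < e / 2"
        using d(2)[OF x'(1) xy(2)] d0(2)[of x' y] x'(1) xy(2) by auto
      then show ?thesis by linarith
    qed
    then show ?thesis using \<delta>(1) by blast
  qed
  \<comment> \<open>Walsh: a translate of u, lowered by e, still competes in the Perron family.\<close>
  have walsh: "\<exists>\<delta>>0. \<forall>x\<in>C. \<forall>z\<in>C. dist x z < \<delta> \<longrightarrow> u z \<le> u x + e" if e: "e > 0" for e
  proof -
    have e2: "e / 2 > 0" using e by simp
    obtain \<delta>1 where \<delta>1: "\<delta>1 > 0" "\<And>x y. x \<in> C - D \<Longrightarrow> y \<in> C \<Longrightarrow> dist y x < \<delta>1 \<Longrightarrow> G y - e / 2 \<le> u y"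
      using near[OF e2] by blast
    obtain \<delta>2 where \<delta>2: "\<delta>2 > 0" "\<And>x y. x \<in> C \<Longrightarrow> y \<in> C \<Longrightarrow> dist y x < \<delta>2 \<Longrightarrow> \<bar>G y - G x\<bar> < e / 2"
      using Gunif[OF e2] by blast
    define \<delta> where "\<delta> = min \<delta>1 \<delta>2 / 2"
    have \<delta>: "\<delta> > 0" "2 * \<delta> \<le> \<delta>1" "\<delta> < \<delta>2" using \<delta>1(1) \<delta>2(1) by (auto simp: \<delta>_def)
    have nearT: "\<exists>t\<in>C - D. dist x t \<le> \<delta>" if "infdist x (C - D) \<le> \<delta>" for x
      using infdist_attains_inf[OF compact_imp_closed[OF Tc] T, of x] that by metis
    have "u z \<le> u x + e" if x: "x \<in> C" and z: "z \<in> C" and xz: "dist x z < \<delta>" for x z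
    proof -
      define a where "a = z - x"
      have a: "norm a < \<delta>" "z = x + a" using xz by (auto simp: a_def dist_norm norm_minus_commute)
      \<comment> \<open>Points farther than \<open>\<delta>\<close> from \<open>C - D\<close> cannot
        be carried out of \<open>D\<close> by \<open>a\<close>, whose norm is below
        \<open>\<delta>\<close>.\<close>
      define W where "W = {y \<in> D. \<delta> < infdist y (C - D)}"
      have "open (D \<inter> {y. \<delta> < infdist y (C - D)})"
        by (intro open_Int D(1) open_Collect_less continuous_intros)
      then have W: "open W" "W \<subseteq> D" by (auto simp: W_def Int_def)
      have Wa: "y + a \<in> D" if yW: "y \<in> W" for y
      proof (rule ccontr)
        assume "y + a \<notin> D"
        then obtain t where "t \<in> C - D" "dist y t \<le> norm a"
          using dist_boundary_le[OF compact_imp_closed[OF C] D(2) _ _ D(1), of y a] yW W(2) by blast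
        then have "infdist y (C - D) \<le> norm a" using infdist_le[of t "C - D" y] by simp
        then show False using yW a(1) by (simp add: W_def)
      qed
      define v where "v y = (if y \<in> W then max (u y) (u (y + a) - e) else u y)" for y
      have "subh F D v"
        unfolding v_def
      proof (rule subh_glue_max[OF W subu])
        have "subh F W (\<lambda>y. u (y + a))" using subh_subset[OF subh_translate[OF subu, of a] W(1)] Wa by blast
        then show "subh F W (\<lambda>y. u (y + a) - e)" using subh_add_const[of F W "\<lambda>y. u (y + a)" "- e"] by simp
        fix y assume y: "y \<in> D" "y \<notin> W"
        then obtain t where t: "t \<in> C - D" "dist y t \<le> \<delta>" using nearT[of y] by (auto simp: W_def not_less)
        \<comment> \<open>Near \<open>C - D\<close> the barriers give
          \<open>u \<ge> G - e / 2\<close>; as \<open>u \<le> G\<close> and \<open>G\<close> varies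
          by less than \<open>e / 2\<close> under the translation, the lowered translate stays below
          \<open>u\<close>.\<close>
        have "u (y' + a) - e \<le> u y'" if y': "y' \<in> ball y \<delta> \<inter> W" for y'
        proof -
          have "dist y' t < 2 * \<delta>" using dist_triangle[of y' t y] t(2) y' by (auto simp: dist_commute)
          moreover have "y' \<in> C" "y' + a \<in> C" using y' W(2) D(2) Wa by auto
          ultimately have "G y' - e / 2 \<le> u y'" "u (y' + a) \<le> G (y' + a)" "\<bar>G (y' + a) - G y'\<bar> < e / 2"
            using \<delta>1(2)[OF t(1)] uG \<delta>2(2)[of y' "y' + a"] a(1) \<delta> by (auto simp: dist_norm)
          then show ?thesis by linarith
        qed
        then show "\<exists>r>0. \<forall>z\<in>ball y r \<inter> W. u (z + a) - e \<le> u z" using \<delta>(1) by blast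
      qed
      moreover have "v y \<le> G y" if y: "y \<in> C" for y
      proof (cases "y \<in> W")
        case True
        then have ya: "y + a \<in> C" using Wa D(2) by blast
        have "u (y + a) \<le> G (y + a)" "\<bar>G (y + a) - G y\<bar> < e / 2"
          using uG[OF ya] \<delta>2(2)[OF y ya] a(1) \<delta>(3) by (auto simp: dist_norm)
        then have "u (y + a) - e \<le> G y" using e by linarith
        then show ?thesis using uG[OF y] by (simp add: v_def)
      qed (use uG[OF y] in \<open>simp add: v_def\<close>)
      ultimately have "v \<in> \<F>" by (simp add: \<F>_def)
      then have vux: "v x \<le> u x" using x by (rule vu)
      show "u z \<le> u x + e"
      proof (cases "x \<in> W")
        case True
        then show ?thesis using vux a(2) by (simp add: v_def)
      next
        case False
        obtain t where t: "t \<in> C - D" "dist x t \<le> \<delta>"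
        proof (cases "x \<in> D")
          case True
          then show ?thesis using nearT[of x] False that by (auto simp: W_def not_less)
        next
          case False
          then show ?thesis using that[of x] x \<delta>(1) by simp
        qed
        have "G x - e / 2 \<le> u x" using \<delta>1(2)[OF t(1) x] t(2) \<delta> by auto
        moreover have "\<bar>G z - G x\<bar> < e / 2" using \<delta>2(2)[OF x z] xz \<delta>(3) by (simp add: dist_commute)
        ultimately show ?thesis using uG[OF z] by linarith
      qed
    qed
    then show ?thesis using \<delta>(1) by blast
  qed
  have contu: "continuous_on C u"
    unfolding continuous_on_iff
  proof (intro ballI allI impI)
    fix x and e :: real assume x: "x \<in> C" and e: "e > 0"
    then obtain \<delta> where \<delta>: "\<delta> > 0" "\<And>x z. x \<in> C \<Longrightarrow> z \<in> C \<Longrightarrow> dist x z < \<delta> \<Longrightarrow> u z \<le> u x + e / 2"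
      using walsh[OF half_gt_zero[OF e]] by blast
    have "dist (u y) (u x) < e" if "y \<in> C" "dist y x < \<delta>" for y
      using \<delta>(2)[of x y] \<delta>(2)[of y x] that x e by (auto simp: dist_real_def dist_commute abs_less_iff)
    then show "\<exists>d>0. \<forall>y\<in>C. dist y x < d \<longrightarrow> dist (u y) (u x) < e" using \<delta>(1) by blast
  qed
  have "subh (dual_subeq F) D (\<lambda>x. - u x)"
    unfolding subh_def
  proof (intro conjI ballI allI impI)
    show "usc_on D (\<lambda>x. - u x)"
      by (intro continuous_imp_usc_on continuous_intros continuous_on_subset[OF contu D(2)])
    fix y p A assume y: "y \<in> D" and A: "A \<in> sym_mats"
      and "\<exists>r>0. \<forall>x\<in>ball y r \<inter> D. - u x - qform p A x \<le> - u y - qform p A y"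
    then obtain r where r: "r > 0" "\<And>x. x \<in> ball y r \<inter> D \<Longrightarrow> - u x - qform p A x \<le> - u y - qform p A y" by blast
    show "A \<in> dual_subeq F"
    proof (rule ccontr)
      assume "A \<notin> dual_subeq F"
      then have "- A \<in> sym_interior F" using A by (simp add: dual_subeq_def)
      then obtain c where c: "c > 0" "- A - c *\<^sub>R mat 1 \<in> F" using sym_interior_minus_mat by blast
      have yC: "y \<in> C" using y D(2) by blast
      \<comment> \<open>Where \<open>u\<close> meets the obstacle, a test polynomial for
        \<open>- u\<close> also tests \<open>- G\<close>. Below the obstacle there is room to raise
        \<open>u\<close> by a bump.\<close>
      show False
      proof (cases "u y < G y")
        case False
        then have "u y = G y" using uG[OF yC] by simp
        have "A \<in> dual_subeq F"
        proof (rule subhD[OF superG y A r(1), of p])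
          fix x assume "x \<in> ball y r" "x \<in> D"
          then show "- G x - qform p A x \<le> - G y - qform p A y"
            using r(2)[of x] uG[of x] D(2) \<open>u y = G y\<close> by auto
        qed
        then show False using \<open>A \<notin> dual_subeq F\<close> by blast
      next
        case True
        \<comment> \<open>The polynomial \<open>q\<close> with this Hessian stays below
          \<open>u - u y\<close> by \<open>c / 2\<close> times the squared distance from y; raised
          slightly, it still drops below \<open>u\<close> before the edge of a small ball.\<close>
        define B where "B = - A + (- c) *\<^sub>R mat 1"
        have BF: "B \<in> F" using c(2) by (simp add: B_def)
        define q where "q x = - (qform p A x - qform p A y) - c / 2 * (norm (x - y))\<^sup>2" for x
        have "q x = qform (- p - (- c) *\<^sub>R y) B x + (qform p A y + (- c) / 2 * (norm y)\<^sup>2)" for x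
        proof -
          have "qform (- p) (- A) x = - qform p A x" using qform_scaleR[of "-1" p A x] by simp
          then show ?thesis unfolding q_def B_def qform_add_scaled_mat by simp
        qed
        then have qeq: "q = (\<lambda>x. (qform p A y + (- c) / 2 * (norm y)\<^sup>2) + qform (- p - (- c) *\<^sub>R y) B x)"
          by (simp add: fun_eq_iff)
        have contq: "continuous_on UNIV q" unfolding qeq by (intro continuous_intros continuous_on_qform)
        have qy: "q y = 0" by (simp add: q_def)
        define g where "g = (G y - u y) / 3"
        have g: "g > 0" using True by (simp add: g_def)
        obtain d1 where d1: "d1 > 0" "\<And>x. x \<in> C \<Longrightarrow> dist x y < d1 \<Longrightarrow> \<bar>G x - G y\<bar> < g"
          using G yC g unfolding continuous_on_iff dist_real_def by blast
        obtain d2 where d2: "d2 > 0" "\<And>x. dist x y < d2 \<Longrightarrow> \<bar>q x - q y\<bar> < g"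
          using contq g unfolding continuous_on_iff dist_real_def by blast
        obtain d3 where d3: "d3 > 0" "ball y d3 \<subseteq> D" using D(1) y open_contains_ball by blast
        define s where "s = min (min r d1) (min d2 d3)"
        have s: "s > 0" "s \<le> r" "s \<le> d1" "s \<le> d2" "s \<le> d3" using r(1) d1(1) d2(1) d3(1) by (auto simp: s_def)
        \<comment> \<open>\<open>g\<close> keeps the bump below \<open>G\<close>, and
          \<open>c * s\<^sup>2 / 8\<close> is the margin available at distance \<open>s / 2\<close>
          from y.\<close>
        define \<sigma> where "\<sigma> = min g (c * s\<^sup>2 / 8)"
        have \<sigma>: "\<sigma> > 0" "\<sigma> \<le> g" "\<sigma> \<le> c / 2 * (s / 2)\<^sup>2" using g c(1) s(1) by (auto simp: \<sigma>_def power_divide)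
        define w where "w x = u y + q x + \<sigma>" for x
        define v where "v x = (if x \<in> ball y s then max (u x) (w x) else u x)" for x
        have bD: "ball y s \<subseteq> D" using s(5) d3(2) by auto
        have "subh F D v"
          unfolding v_def
        proof (rule subh_glue_max[OF open_ball bD subu])
          have "subh F (ball y s) q" unfolding qeq by (rule subh_qform[OF F BF open_ball])
          then show "subh F (ball y s) w"
            using subh_add_const[of F "ball y s" q "u y + \<sigma>"] by (simp add: w_def[abs_def] algebra_simps)
          fix x assume x: "x \<in> D" "x \<notin> ball y s"
          have "w z \<le> u z" if z: "z \<in> ball x (s / 2) \<inter> ball y s" for z
          proof -
            have "s / 2 \<le> norm (z - y)" using x(2) z dist_triangle[of y x z] by (auto simp: dist_norm norm_minus_commute)
            then have "c / 2 * (s / 2)\<^sup>2 \<le> c / 2 * (norm (z - y))\<^sup>2" using c(1) s(1) by (intro mult_left_mono power_mono) auto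
            moreover have "- u z - qform p A z \<le> - u y - qform p A y" using r(2)[of z] z s(2) bD by auto
            ultimately show ?thesis using \<sigma>(3) unfolding w_def q_def by linarith
          qed
          then show "\<exists>r>0. \<forall>z\<in>ball x r \<inter> ball y s. w z \<le> u z" using s(1) by (intro exI[of _ "s / 2"]) auto
        qed
        moreover have "v x \<le> G x" if x: "x \<in> C" for x
        proof (cases "x \<in> ball y s")
          case True
          then have "dist x y < d1" "dist x y < d2" using s by (auto simp: dist_commute)
          then have "\<bar>G x - G y\<bar> < g" "\<bar>q x - q y\<bar> < g" using d1(2)[OF x] d2(2) by auto
          moreover have "3 * g = G y - u y" by (simp add: g_def)
          ultimately have "w x \<le> G x" using \<sigma>(2) qy unfolding w_def by linarith
          then show ?thesis using uG[OF x] by (simp add: v_def)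
        qed (use uG[OF x] in \<open>simp add: v_def\<close>)
        ultimately have "v \<in> \<F>" by (simp add: \<F>_def)
        then have "v y \<le> u y" using yC by (rule vu)
        moreover have "w y > u y" using \<sigma>(1) qy by (simp add: w_def)
        ultimately show False using s(1) by (auto simp: v_def)
      qed
    qed
  qed
  then show ?thesis using contu subu vu[OF \<psi>\<F>] uG uT by blast
qed

section \<open>Boundary barriers\<close>

lemma proj_line_quadratic: "d \<bullet> (proj_line e *v d) = (e \<bullet> d)\<^sup>2"
proof -
  have "proj_line e *v d = (e \<bullet> d) *\<^sub>R e"
    by (simp add: vec_eq_iff proj_line_def matrix_vector_mult_def inner_vec_def sum_distrib_left mult_ac)
  then show ?thesis by (simp add: inner_commute power2_eq_square)
qed

text \<open>The paraboloid is the second order Taylor polynomial of \<open>\<rho> + s \<rho>\<^sup>2\<close>, bent down slightly.\<close>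

lemma boundary_paraboloid:
  fixes F :: "(real^'n^'n) set"
  assumes F: "cone_subequation F" and \<Omega>: "open \<Omega>" and bd: "strictly_F_convex_boundary F \<Omega>" and x: "x \<in> frontier \<Omega>"
  shows "\<exists>B\<in>F. \<exists>p c r. c > 0 \<and> r > 0 \<and>
    (\<forall>y\<in>\<Omega> \<inter> ball x r. qform p B y - qform p B x \<le> - c * (norm (y - x))\<^sup>2)"
proof -
  obtain U \<rho> where \<rho>: "local_defining_fun \<Omega> x U \<rho>"
    using bd x unfolding strictly_F_convex_boundary_def smooth_boundary_def by blast
  have U: "open U" "x \<in> U" and sm: "smooth_on U \<rho>" and neg: "\<Omega> \<inter> U = {y\<in>U. \<rho> y < 0}"
    using \<rho> by (auto simp: local_defining_fun_def)
  have C2: "Ck_on 2 U \<rho>" using sm by (simp add: smooth_on_def)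
  define g where "g = grad \<rho> x"
  define H where "H = hess \<rho> x"
  define \<nu> where "\<nu> = (1 / norm g) *\<^sub>R g"
  have Hs: "H \<in> sym_mats" unfolding H_def by (rule hess_symmetric[OF C2 U])
  obtain T where T: "\<And>t. t \<ge> T \<Longrightarrow> H + t *\<^sub>R proj_line \<nu> \<in> sym_interior F"
    using bd x \<rho> unfolding strictly_F_convex_boundary_def H_def g_def \<nu>_def by blast
  define t where "t = max T 0"
  obtain c where c: "c > 0" "H + t *\<^sub>R proj_line \<nu> - c *\<^sub>R mat 1 \<in> F"
    using sym_interior_minus_mat[OF T[of t]] by (auto simp: t_def)
  define B where "B = H + t *\<^sub>R proj_line \<nu> - c *\<^sub>R mat 1"
  have BF: "B \<in> F" and Bs: "B \<in> sym_mats" using c(2) cone_subequationD(1)[OF F] by (auto simp: B_def)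
  \<comment> \<open>Chosen so that \<open>s * (g \<bullet> d)\<^sup>2\<close> is the share of
    \<open>t *\<^sub>R proj_line \<nu>\<close> in half the quadratic form.\<close>
  define s where "s = t / (2 * (norm g)\<^sup>2)"
  have s0: "s \<ge> 0" by (simp add: s_def t_def)
  have Bq: "(d \<bullet> (B *v d)) / 2 = (d \<bullet> (H *v d)) / 2 + s * (g \<bullet> d)\<^sup>2 - c / 2 * (norm d)\<^sup>2" for d
    by (simp add: B_def matrix_vector_mult_diff_rdistrib matrix_vector_mult_add_rdistrib scaleR_mat_vec
        scaleR_matrix_vector_assoc[symmetric] inner_add_right inner_diff_right proj_line_quadratic \<nu>_def s_def
        power2_norm_eq_inner[of d] power_mult_distrib power_divide diff_divide_distrib add_divide_distrib)
  define K where "K = CARD('n) * norm H / 2"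
  have K0: "K \<ge> 0" by (simp add: K_def)
  have K: "\<bar>(d \<bullet> (H *v d)) / 2\<bar> \<le> K * (norm d)\<^sup>2" for d
    using inner_matrix_vector_le[of d H] by (simp add: K_def)
  \<comment> \<open>Two errors of \<open>c / 8\<close> per squared distance leave
    \<open>- c / 4\<close> of the downward bend \<open>- c / 2\<close>.\<close>
  define e where "e = c / 8"
  have e: "e > 0" using c(1) by (simp add: e_def)
  obtain \<delta> where \<delta>: "\<delta> > 0" "\<And>h. norm h < \<delta> \<Longrightarrow> \<bar>\<rho> (x + h) - \<rho> x - g \<bullet> h - (h \<bullet> (H *v h)) / 2\<bar> \<le> e * (norm h)\<^sup>2"
    using hess_Taylor[OF C2 U e] unfolding g_def H_def by blast
  obtain r0 where r0: "r0 > 0" "ball x r0 \<subseteq> U" using U open_contains_ball by blast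
  define K' where "K' = 2 * K + e"
  have K'0: "K' > 0" using K0 e by (simp add: K'_def)
  define L where "L = s * norm g + 1"
  have L0: "L > 0" using s0 by (simp add: L_def add_nonneg_pos)
  define r where "r = min (min \<delta> r0) (min (1 / (2 * L)) (e / (L * K')))"
  have r: "r > 0" using \<delta>(1) r0(1) L0 e K'0 by (simp add: r_def)
  have main: "qform (g - B *v x) B y - qform (g - B *v x) B x \<le> - (c / 4) * (norm (y - x))\<^sup>2"
    if y: "y \<in> \<Omega> \<inter> ball x r" for y
  proof -
    define d where "d = y - x"
    define a where "a = g \<bullet> d"
    define n2 where "n2 = (norm d)\<^sup>2"
    define hd where "hd = (d \<bullet> (H *v d)) / 2"
    have n20: "n2 \<ge> 0" by (simp add: n2_def)
    have d: "norm d < \<delta>" "norm d < r0" "norm d < 1 / (2 * L)" "norm d < e / (L * K')" "y = x + d"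
      using y by (auto simp: d_def r_def dist_norm norm_minus_commute)
    have "y \<in> U" using y r0(2) by (auto simp: r_def)
    then have "\<rho> y < 0" using y neg by blast
    moreover have "\<rho> x \<ge> 0"
    proof -
      have "x \<notin> \<Omega>" using x \<Omega> by (simp add: frontier_def interior_open)
      then show ?thesis using neg U(2) by force
    qed
    ultimately have up: "a + hd \<le> e * n2"
      using \<delta>(2)[OF d(1)] d(5) unfolding a_def hd_def n2_def by (simp add: abs_le_iff)
    have hdK: "\<bar>hd\<bar> \<le> K * n2" using K unfolding hd_def n2_def .
    have "\<bar>a\<bar> \<le> norm g * norm d" unfolding a_def by (rule Cauchy_Schwarz_ineq2)
    then have "s * \<bar>a\<bar> \<le> s * (norm g * norm d)" using s0 by (intro mult_left_mono)
    also have "\<dots> \<le> L * norm d" by (simp add: L_def distrib_right)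
    finally have sa: "s * \<bar>a\<bar> \<le> L * norm d" .
    have sa1: "s * \<bar>a\<bar> \<le> 1 / 2" using sa d(3) L0 by (simp add: field_simps)
    have sa2: "s * \<bar>a\<bar> * K' \<le> e"
    proof -
      have "s * \<bar>a\<bar> * K' \<le> L * norm d * K'" using sa K'0 by (intro mult_right_mono) auto
      also have "\<dots> \<le> e" using d(4) L0 K'0 by (simp add: field_simps)
      finally show ?thesis .
    qed
    \<comment> \<open>In \<open>\<Omega>\<close> the linear term \<open>a\<close> is negative up to
      second order. If it is itself of second order, \<open>s * a\<^sup>2\<close> is negligible near
      x; otherwise half of \<open>a\<close> absorbs \<open>s * a\<^sup>2\<close> and the other half
      the Hessian term.\<close>
    have "a + hd + s * a\<^sup>2 \<le> 2 * (e * n2)"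
    proof (cases "\<bar>a\<bar> \<le> K' * n2")
      case True
      have "s * a\<^sup>2 = s * \<bar>a\<bar> * \<bar>a\<bar>" by (simp add: power2_eq_square)
      also have "\<dots> \<le> s * \<bar>a\<bar> * (K' * n2)" using True s0 by (intro mult_left_mono) auto
      also have "\<dots> \<le> e * n2" using mult_right_mono[OF sa2 n20] by (simp add: mult.assoc)
      finally show ?thesis using up by linarith
    next
      case False
      have Kn: "K' * n2 = 2 * (K * n2) + e * n2" by (simp add: K'_def algebra_simps)
      have en: "e * n2 \<ge> 0" "K * n2 \<ge> 0" using e n20 K0 by auto
      have "a < 0" using False up hdK Kn en by linarith
      have "s * a\<^sup>2 = (s * \<bar>a\<bar>) * \<bar>a\<bar>" by (simp add: power2_eq_square)
      also have "\<dots> \<le> 1 / 2 * \<bar>a\<bar>" using sa1 by (intro mult_right_mono) auto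
      finally show ?thesis using False \<open>a < 0\<close> hdK Kn en by linarith
    qed
    moreover have "qform (g - B *v x) B y - qform (g - B *v x) B x = a + (hd + s * a\<^sup>2 - c / 2 * n2)"
      unfolding qform_diff_eq[OF Bs] d_def[symmetric] Bq a_def hd_def n2_def by simp
    moreover have "2 * (e * n2) = c / 4 * n2" by (simp add: e_def)
    ultimately show ?thesis unfolding d_def[symmetric] n2_def[symmetric] by linarith
  qed
  show ?thesis
    by (intro bexI[OF _ BF] exI[of _ "g - B *v x"] exI[of _ "c / 4"] exI[of _ r]) (use main r c(1) in auto)
qed

text \<open>The paraboloid, steepened by \<open>K\<close> and raised to the value
  \<open>G x - e / 2\<close> at x, is glued to the competitor \<open>\<psi>\<close>. Allowing a
  smaller \<open>D\<close> inside \<open>\<Omega>\<close> admits punctures.\<close>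

lemma boundary_barrier:
  fixes F :: "(real^'n^'n) set"
  assumes F: "cone_subequation F" and \<Omega>: "open \<Omega>" "bounded \<Omega>" and bd: "strictly_F_convex_boundary F \<Omega>"
    and x: "x \<in> frontier \<Omega>" and D: "open D" "D \<subseteq> \<Omega>" and G: "continuous_on (closure \<Omega>) G"
    and \<psi>: "subh F D \<psi>" "continuous_on (closure \<Omega>) \<psi>" "\<And>y. y \<in> closure \<Omega> \<Longrightarrow> \<psi> y \<le> G y" and e: "e > 0"
  shows "\<exists>v. subh F D v \<and> (\<forall>y\<in>closure \<Omega>. v y \<le> G y) \<and>
    (\<exists>d>0. \<forall>y\<in>closure \<Omega>. dist y x < d \<longrightarrow> G x - e \<le> v y)"
proof -
  let ?C = "closure \<Omega>"
  have xC: "x \<in> ?C" using x by (simp add: frontier_def)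
  have C: "compact ?C" using \<Omega>(2) by (simp add: compact_closure)
  obtain B p c r where B: "B \<in> F" and c: "c > 0" and r: "r > 0"
    and q0: "\<And>y. y \<in> \<Omega> \<inter> ball x r \<Longrightarrow> qform p B y - qform p B x \<le> - c * (norm (y - x))\<^sup>2"
    using boundary_paraboloid[OF F \<Omega>(1) bd x] by blast
  define q where "q y = qform p B y - qform p B x" for y
  have qcont: "continuous_on UNIV q" unfolding q_def by (intro continuous_intros continuous_on_qform)
  have q: "q y \<le> - c * (norm (y - x))\<^sup>2" if y: "y \<in> ?C" "dist y x < r" for y
  proof -
    have "closed {y. q y \<le> - c * (norm (y - x))\<^sup>2}"
      by (intro closed_Collect_le continuous_intros qcont)
    moreover have "ball x r \<inter> \<Omega> \<subseteq> {y. q y \<le> - c * (norm (y - x))\<^sup>2}" using q0 by (auto simp: q_def)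
    ultimately have "closure (ball x r \<inter> \<Omega>) \<subseteq> {y. q y \<le> - c * (norm (y - x))\<^sup>2}" by (intro closure_minimal)
    moreover have "y \<in> closure (ball x r \<inter> \<Omega>)"
      using open_Int_closure_subset[OF open_ball, of x r \<Omega>] y by (auto simp: dist_commute)
    ultimately show ?thesis by blast
  qed
  have e2: "e / 2 > 0" using e by simp
  obtain r0 where r0: "r0 > 0" "\<And>y. y \<in> ?C \<Longrightarrow> dist y x < r0 \<Longrightarrow> \<bar>G y - G x\<bar> < e / 2"
    using G xC e2 unfolding continuous_on_iff dist_real_def by blast
  define r1 where "r1 = min r r0"
  have r1: "r1 > 0" "r1 \<le> r" "r1 \<le> r0" using r r0(1) by (auto simp: r1_def)
  have "bounded (\<psi> ` ?C)" using compact_continuous_image[OF \<psi>(2) C] compact_imp_bounded by blast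
  then obtain M where M: "\<And>y. y \<in> ?C \<Longrightarrow> \<bar>\<psi> y\<bar> \<le> M" unfolding bounded_iff by auto
  have M0: "M \<ge> 0" using M[OF xC] by linarith
  define k where "k = c * (r1 / 2)\<^sup>2"
  have k: "k > 0" using c r1(1) by (simp add: k_def)
  \<comment> \<open>From distance \<open>r1 / 2\<close> on, \<open>K * q\<close> is at most
    \<open>- (K * k)\<close>, which takes the barrier below \<open>- M\<close> and so below
    \<open>\<psi>\<close>.\<close>
  define K where "K = (\<bar>G x - e / 2\<bar> + M) / k + 1"
  have K: "K > 0" using M0 k by (simp add: K_def add_nonneg_pos)
  have Kk: "K * k \<ge> \<bar>G x - e / 2\<bar> + M"
  proof -
    have "(\<bar>G x - e / 2\<bar> + M) / k * k = \<bar>G x - e / 2\<bar> + M" using k by simp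
    then show ?thesis unfolding K_def distrib_right using k by linarith
  qed
  define w where "w y = G x - e / 2 + K * q y" for y
  have KB: "K *\<^sub>R B \<in> F" using cone_subequationD(4)[OF F K B] .
  have weq: "w = (\<lambda>y. (G x - e / 2 - K * qform p B x) + qform (K *\<^sub>R p) (K *\<^sub>R B) y)"
    by (simp add: w_def q_def qform_scaleR fun_eq_iff algebra_simps)
  define W where "W = ball x r1 \<inter> D"
  have W: "open W" "W \<subseteq> D" using D(1) by (auto simp: W_def)
  have WC: "y \<in> ?C" "dist y x < r1" if "y \<in> W" for y
    using that D(2) closure_subset by (auto simp: W_def dist_commute)
  have wq: "w y \<le> G x - e / 2 - K * (c * (norm (y - x))\<^sup>2)" if "y \<in> W" for y
    using mult_left_mono[OF q[of y], of K] WC[OF that] r1(2) K by (simp add: w_def)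
  define v0 where "v0 y = (if y \<in> W then max (\<psi> y) (w y) else \<psi> y)" for y
  have "subh F D v0"
    unfolding v0_def
  proof (rule subh_glue_max[OF W \<psi>(1)])
    show "subh F W w" unfolding weq by (rule subh_qform[OF F KB W(1)])
    fix y assume y: "y \<in> D" "y \<notin> W"
    have "w z \<le> \<psi> z" if z: "z \<in> ball y (r1 / 2) \<inter> W" for z
    proof -
      have "r1 / 2 \<le> norm (z - x)"
        using y z dist_triangle[of x y z] by (auto simp: W_def dist_norm norm_minus_commute)
      then have "K * (c * (r1 / 2)\<^sup>2) \<le> K * (c * (norm (z - x))\<^sup>2)"
        using K c r1(1) by (intro mult_left_mono power_mono) auto
      then have "w z \<le> - M" using wq[of z] z Kk unfolding k_def by auto
      then show ?thesis using M[of z] WC(1)[of z] z by auto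
    qed
    then show "\<exists>r>0. \<forall>z\<in>ball y r \<inter> W. w z \<le> \<psi> z" using r1(1) by (intro exI[of _ "r1 / 2"]) auto
  qed
  \<comment> \<open>Off \<open>D\<close> the barrier is redefined as \<open>G\<close>: the upper
    bound is then trivial, and the lower one is continuity of \<open>G\<close>.\<close>
  then have sv: "subh F D (\<lambda>y. if y \<in> D then v0 y else G y)" by (rule subh_cong) simp
  have vG: "(if y \<in> D then v0 y else G y) \<le> G y" if y: "y \<in> ?C" for y
  proof (cases "y \<in> W")
    case True
    have "0 \<le> K * (c * (norm (y - x))\<^sup>2)" using K c by simp
    then have "w y \<le> G x - e / 2" using wq[OF True] by linarith
    also have "\<dots> \<le> G y"
    proof -
      have "\<bar>G y - G x\<bar> < e / 2" using r0(2)[OF y] WC(2)[OF True] r1(3) by auto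
      then show ?thesis by linarith
    qed
    finally show ?thesis using \<psi>(3)[OF y] by (simp add: v0_def)
  qed (use \<psi>(3)[OF y] in \<open>simp add: v0_def\<close>)
  have qx: "q x = 0" by (simp add: q_def)
  have "e / 2 / K > 0" using e K by simp
  then obtain d where d: "d > 0" "\<And>y. dist y x < d \<Longrightarrow> \<bar>q y - q x\<bar> < e / 2 / K"
    using qcont unfolding continuous_on_iff dist_real_def by blast
  have "G x - e \<le> (if y \<in> D then v0 y else G y)" if y: "y \<in> ?C" "dist y x < min d r1" for y
  proof (cases "y \<in> D")
    case True
    then have "y \<in> W" using y(2) by (auto simp: W_def dist_commute)
    have "\<bar>q y\<bar> < e / 2 / K" using d(2)[of y] y(2) qx by simp
    then have "K * \<bar>q y\<bar> < e / 2" using K by (simp add: field_simps)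
    moreover have "- (K * q y) \<le> K * \<bar>q y\<bar>" using K by (simp add: abs_if)
    ultimately have "G x - e \<le> w y" unfolding w_def by linarith
    then show ?thesis using True \<open>y \<in> W\<close> by (simp add: v0_def)
  next
    case False
    have "\<bar>G y - G x\<bar> < e / 2" using r0(2)[OF y(1)] y(2) r1(3) by auto
    then have "G x - e \<le> G y" using e by linarith
    then show ?thesis using False by simp
  qed
  then show ?thesis using sv vG d(1) r1(1)
    by (intro exI[of _ "\<lambda>y. if y \<in> D then v0 y else G y"] conjI ballI exI[of _ "min d r1"]) auto
qed

section \<open>Excluding negative multiples of the identity for the maximum principle\<close>

text \<open>\<open>- mat 1\<close> lies below the negative of every line projection, so its
  membership would pass upwards to an excluded matrix. This yields \<open>h \<le> 1\<close>.\<close>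

lemma neg_mat_notin_if_no_neg_line:
  fixes F :: "(real^'n^'n) set"
  assumes F: "cone_subequation F" and nl: "\<forall>e. norm e = 1 \<longrightarrow> - proj_line e \<notin> F" and c: "c > 0"
  shows "- c *\<^sub>R mat 1 \<notin> F"
proof
  assume A: "- c *\<^sub>R mat 1 \<in> F"
  define e :: "real^'n" where "e = axis undefined 1"
  have e: "norm e = 1" by (simp add: e_def)
  have "(1 / c) *\<^sub>R (- c *\<^sub>R mat 1) \<in> F" using cone_subequationD(4)[OF F _ A, of "1 / c"] c by simp
  then have I: "- mat 1 \<in> F" using c by simp
  have "- proj_line e \<in> F"
  proof (rule cone_subequation_mono[OF F I])
    show "- proj_line e \<in> sym_mats" by (simp add: sym_mats_iff proj_line_def mult.commute)
    fix x :: "real^'n"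
    have "(e \<bullet> x)\<^sup>2 \<le> (norm e)\<^sup>2 * (norm x)\<^sup>2" using Cauchy_Schwarz_ineq[of e x] by (simp add: power2_norm_eq_inner)
    then show "x \<bullet> (- mat 1 *v x) \<le> x \<bullet> (- proj_line e *v x)"
      by (simp add: uminus_matrix_vector proj_line_quadratic e power2_norm_eq_inner)
  qed
  then show False using nl e by blast
qed

text \<open>A nonempty closed cone contains 0, so positive multiples of the identity are interior to
  \<open>F\<close>. This yields \<open>h \<ge> 0\<close>.\<close>

lemma neg_mat_notin_dual:
  fixes F :: "(real^'n^'n) set"
  assumes F: "cone_subequation F" and ne: "F \<noteq> {}" and c: "c > 0"
  shows "- c *\<^sub>R mat 1 \<notin> dual_subeq F"
proof -
  obtain A where A: "A \<in> F" using ne by blast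
  define X where "X n = inverse (real (Suc n)) *\<^sub>R A" for n
  have "X \<longlonglongrightarrow> 0 *\<^sub>R A"
    unfolding X_def by (intro tendsto_intros LIMSEQ_inverse_real_of_nat)
  moreover have "X n \<in> F" for n unfolding X_def by (rule cone_subequationD(4)[OF F _ A]) simp
  ultimately have "0 *\<^sub>R A \<in> F" using cone_subequationD(2)[OF F] unfolding closed_sequential_limits by blast
  then have 0: "0 \<in> F" by simp
  have "c *\<^sub>R mat 1 \<in> sym_interior F"
    by (rule sym_interior_if_strictly_above[OF F 0 _ c])
       (simp_all add: sym_mats_scaleR sym_mats_mat scaleR_mat_vec power2_norm_eq_inner)
  then show ?thesis by (simp add: dual_subeq_def)
qed

theorem theorem7p1:
  fixes F :: "(real^'n^'n) set" and \<Omega> :: "(real^'n) set" and x0 :: "real^'n"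
    and \<phi> h H0 :: "real^'n \<Rightarrow> real"
  assumes F: "cone_subequation F"
    and nonneg_dir: "\<forall>e. norm e = 1 \<longrightarrow> - proj_line e \<notin> F"
    and dom: "open \<Omega>" "connected \<Omega>" "bounded \<Omega>"
    and bdry: "strictly_F_convex_boundary F \<Omega>"
    and x0: "x0 \<in> \<Omega>"
    and phi: "continuous_on (frontier \<Omega>) \<phi>"
    and h_cont: "continuous_on (closure \<Omega>) h"
    and h_harm: "F_harmonic F (\<Omega> - {x0}) h"
    and h_sub_near: "\<exists>r>0. F_subharmonic F (ball x0 r) h"
    and h_min: "\<exists>r>0. \<forall>x\<in>ball x0 r. x \<noteq> x0 \<longrightarrow> h x > h x0"
    and h_notest: "\<not> (\<exists>psi. upper_test h UNIV x0 psi)"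
    and h_x0: "h x0 = 0"
    and h_inf: "(INF x\<in>frontier \<Omega>. h x) > 0"
    and h_sup: "(SUP x\<in>frontier \<Omega>. h x) = 1"
    and H0_cont: "continuous_on (closure \<Omega>) H0"
    and H0_harm: "F_harmonic F \<Omega> H0"
    and H0_bd: "\<forall>x\<in>frontier \<Omega>. H0 x = \<phi> x"
    and H0_sub: "\<forall>t\<ge>0. F_subharmonic F \<Omega> (\<lambda>x. H0 x + t * h x)"
  shows "\<forall>t\<ge>(0::real). \<exists>Ht :: real^'n \<Rightarrow> real.
           continuous_on (closure \<Omega>) Ht
         \<and> F_harmonic F (\<Omega> - {x0}) Ht
         \<and> (\<forall>x\<in>frontier \<Omega>. Ht x = \<phi> x)
         \<and> (\<forall>x\<in>closure \<Omega>. H0 x + t * (h x - 1) \<le> Ht x)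
         \<and> Ht x0 = H0 x0 + t * (h x0 - 1)
         \<and> (\<exists>Lam. \<forall>lam\<ge>Lam. \<forall>x\<in>closure \<Omega>. Ht x \<le> lam * h x + H0 x0 + t * (h x - 1))
         \<and> (\<forall>lam. Ht x0 = lam * h x0 + H0 x0 + t * (h x0 - 1))"
proof (intro allI impI)
  fix t :: real assume t: "t \<ge> 0"
  define C where "C = closure \<Omega>"
  define D where "D = \<Omega> - {x0}"
  have C: "compact C" using dom(3) by (simp add: C_def compact_closure)
  have D: "open D" "D \<subseteq> C" using dom(1) closure_subset by (auto simp: D_def C_def)
  have D\<Omega>: "D \<subseteq> \<Omega>" by (auto simp: D_def)
  have fr: "frontier \<Omega> \<subseteq> C" by (auto simp: C_def frontier_def)
  \<comment> \<open>The puncture joins the frontier as a boundary point with prescribed value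
    \<open>G x0\<close>.\<close>
  have T: "C - D = insert x0 (frontier \<Omega>)"
    using x0 dom(1) closure_subset by (auto simp: C_def D_def frontier_def interior_open)
  have x0C: "x0 \<in> C" using T by blast
  have "\<Omega> \<noteq> UNIV" using dom(3) not_bounded_UNIV by auto
  then have fne: "frontier \<Omega> \<noteq> {}" using x0 frontier_not_empty[of \<Omega>] by blast
  have Fcl: "closed F" using cone_subequationD(2)[OF F] .
  have F': "cone_subequation (dual_subeq F)" using cone_subequation_dual[OF F] .
  have F'cl: "closed (dual_subeq F)" using cone_subequationD(2)[OF F'] .
  \<comment> \<open>A bounded domain has a frontier point, and the paraboloid there has its Hessian
    in \<open>F\<close>.\<close>
  have Fne: "F \<noteq> {}" using fne boundary_paraboloid[OF F dom(1) bdry] by blast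
  note hC = h_cont[folded C_def] and HC = H0_cont[folded C_def]
  have h: "subh F D h" "subh (dual_subeq F) D (\<lambda>x. - h x)"
    using h_harm F_subharmonic_iff_subh[OF D(1) Fcl] F_subharmonic_iff_subh[OF D(1) F'cl]
    by (auto simp: F_harmonic_def D_def)
  have "subh F \<Omega> H0" "subh (dual_subeq F) \<Omega> (\<lambda>x. - H0 x)"
    using H0_harm F_subharmonic_iff_subh[OF dom(1) Fcl] F_subharmonic_iff_subh[OF dom(1) F'cl]
    by (auto simp: F_harmonic_def)
  then have H: "subh F D H0" "subh (dual_subeq F) D (\<lambda>x. - H0 x)" using subh_subset[OF _ D(1) D\<Omega>] by blast+
  define \<psi> where "\<psi> x = H0 x + t * (h x - 1)" for x
  have "subh F \<Omega> (\<lambda>x. H0 x + t * h x)" using H0_sub t F_subharmonic_iff_subh[OF dom(1) Fcl] by blast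
  then have "subh F D (\<lambda>x. H0 x + t * h x + (- t))" by (intro subh_add_const subh_subset[OF _ D(1) D\<Omega>])
  then have sub\<psi>: "subh F D \<psi>" by (rule subh_cong) (simp add: \<psi>_def algebra_simps)
  have \<psi>C: "continuous_on C \<psi>" unfolding \<psi>_def by (intro continuous_intros HC hC)
  have frc: "compact (frontier \<Omega>)" using dom(3) by (rule compact_frontier_bounded)
  have hfr: "compact (h ` frontier \<Omega>)" using compact_continuous_image[OF continuous_on_subset[OF hC fr] frc] .
  define m where "m = (INF x\<in>frontier \<Omega>. h x)"
  have m: "m > 0" using h_inf by (simp add: m_def)
  have hm: "m \<le> h x" "h x \<le> 1" if "x \<in> frontier \<Omega>" for x
  proof -
    show "m \<le> h x" unfolding m_def using hfr that
      by (intro cINF_lower bounded_imp_bdd_below compact_imp_bounded)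
    show "h x \<le> 1" unfolding h_sup[symmetric] using hfr that
      by (intro cSUP_upper bounded_imp_bdd_above compact_imp_bounded)
  qed
  have h1: "h x \<le> 1" if "x \<in> C" for x
  proof (rule subh_maximum_principle[OF C D continuous_imp_usc_on[OF hC] h(1) _ _ that])
    show "- c *\<^sub>R mat 1 \<notin> F" if "c > 0" for c using neg_mat_notin_if_no_neg_line[OF F nonneg_dir that] .
    show "h y \<le> 1" if "y \<in> C - D" for y using that hm(2) h_x0 unfolding T by auto
  qed
  have h0: "0 \<le> h x" if "x \<in> C" for x
  proof -
    have "- h x \<le> 0"
    proof (rule subh_maximum_principle[OF C D _ h(2) _ _ that])
      show "usc_on C (\<lambda>x. - h x)" by (intro continuous_imp_usc_on continuous_intros hC)
      show "- c *\<^sub>R mat 1 \<notin> dual_subeq F" if "c > 0" for c using neg_mat_notin_dual[OF F Fne that] .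
      show "- h y \<le> 0" if "y \<in> C - D" for y using that hm(1) m h_x0 unfolding T by fastforce
    qed
    then show ?thesis by simp
  qed
  have "compact (H0 ` frontier \<Omega>)" using compact_continuous_image[OF continuous_on_subset[OF HC fr] frc] .
  then have "bounded (H0 ` frontier \<Omega>)" by (rule compact_imp_bounded)
  then obtain b where b: "\<And>x. x \<in> frontier \<Omega> \<Longrightarrow> \<bar>H0 x\<bar> \<le> b"
    unfolding bounded_iff by auto
  \<comment> \<open>The part \<open>\<bar>b - H0 x0\<bar>\<close> serves the comparison with
    \<open>\<Lambda> * h\<close>; the further \<open>t\<close> offsets
    \<open>t * (h x - 1) \<ge> - t\<close>, so that \<open>G\<close> equals \<open>H0\<close> on the
    frontier.\<close>
  define \<Lambda> where "\<Lambda> = (\<bar>b - H0 x0\<bar> + t) / m + 1"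
  have \<Lambda>: "\<Lambda> > 0" using t m by (simp add: \<Lambda>_def add_nonneg_pos)
  have \<Lambda>fr: "\<bar>b - H0 x0\<bar> + t \<le> \<Lambda> * h x" if "x \<in> frontier \<Omega>" for x
  proof -
    have "\<bar>b - H0 x0\<bar> + t = (\<bar>b - H0 x0\<bar> + t) / m * m" using m by simp
    also have "\<dots> \<le> \<Lambda> * m" using m by (intro mult_right_mono) (auto simp: \<Lambda>_def)
    also have "\<dots> \<le> \<Lambda> * h x" using \<Lambda> hm(1)[OF that] by (intro mult_left_mono) auto
    finally show ?thesis .
  qed
  define hbar where "hbar x = \<Lambda> * h x + H0 x0 + t * (h x - 1)" for x
  have key: "H0 x \<le> \<Lambda> * h x + H0 x0" if "x \<in> C" for x
  proof -
    have "(H0 x + (- H0 x0)) + \<Lambda> * (- h x) \<le> 0"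
    proof (rule comparison[OF F C D _ subh_add_const[OF H(1)] _ subh_scale[OF F' h(2) \<Lambda>] _ that])
      show "continuous_on C (\<lambda>x. H0 x + (- H0 x0))" "continuous_on C (\<lambda>x. \<Lambda> * (- h x))"
        by (intro continuous_intros HC hC)+
      show "(H0 y + (- H0 x0)) + \<Lambda> * (- h y) \<le> 0" if "y \<in> C - D" for y
      proof (cases "y = x0")
        case False
        then have y: "y \<in> frontier \<Omega>" using that unfolding T by blast
        show ?thesis using \<Lambda>fr[OF y] b[OF y] t by (simp add: abs_le_iff) linarith
      qed (simp add: h_x0)
    qed
    then show ?thesis by simp
  qed
  define G where "G x = min (H0 x) (hbar x)" for x
  have hbarC: "continuous_on C hbar" unfolding hbar_def by (intro continuous_intros HC hC)
  have GC: "continuous_on C G" unfolding G_def by (intro continuous_on_min HC hbarC)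
  \<comment> \<open>\<open>hbar\<close> is a positive multiple of \<open>h\<close> plus a constant;
    the maximum of \<open>- H0\<close> and \<open>- hbar\<close> is \<open>- G\<close>.\<close>
  have superG: "subh (dual_subeq F) D (\<lambda>x. - G x)"
  proof -
    have "\<Lambda> + t > 0" using \<Lambda> t by simp
    then have "subh (dual_subeq F) D (\<lambda>x. (\<Lambda> + t) * (- h x) + (t - H0 x0))"
      by (intro subh_add_const subh_scale[OF F' h(2)])
    then have "subh (dual_subeq F) D (\<lambda>x. - hbar x)"
      by (rule subh_cong) (simp add: hbar_def algebra_simps)
    from subh_glue_max[OF D(1) order_refl H(2) this]
    have "subh (dual_subeq F) D (\<lambda>x. if x \<in> D then max (- H0 x) (- hbar x) else - H0 x)" by blast
    then show ?thesis by (rule subh_cong) (simp add: G_def max_def min_def)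
  qed
  have \<psi>G: "\<psi> x \<le> G x" if "x \<in> C" for x
  proof -
    have "t * (h x - 1) \<le> 0" using t h1[OF that] by (simp add: mult_nonneg_nonpos)
    then show ?thesis using key[OF that] by (simp add: G_def \<psi>_def hbar_def)
  qed
  have Gx0: "G x0 = \<psi> x0" using t by (simp add: G_def hbar_def \<psi>_def h_x0)
  have Gfr: "G x = \<phi> x" if "x \<in> frontier \<Omega>" for x
  proof -
    have "t * (h x - 1) \<ge> - t"
      using mult_left_mono[OF h0[of x] t] fr that by (auto simp: right_diff_distrib)
    then have "H0 x \<le> hbar x" using \<Lambda>fr[OF that] b[OF that] unfolding hbar_def by linarith
    then show ?thesis using H0_bd that by (simp add: G_def)
  qed
  obtain u where u: "continuous_on C u" "subh F D u" "subh (dual_subeq F) D (\<lambda>x. - u x)"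
    "\<And>x. x \<in> C \<Longrightarrow> \<psi> x \<le> u x" "\<And>x. x \<in> C \<Longrightarrow> u x \<le> G x" "\<And>x. x \<in> C - D \<Longrightarrow> u x = G x"
  proof -
    have "\<exists>v. subh F D v \<and> (\<forall>y\<in>C. v y \<le> G y) \<and> (\<exists>d>0. \<forall>y\<in>C. dist y x < d \<longrightarrow> G x - e \<le> v y)"
      if x: "x \<in> C - D" and e: "e > 0" for x e
    proof (cases "x = x0")
      case True
      \<comment> \<open>At the puncture \<open>\<psi>\<close> itself is the lower barrier, being
        continuous with the value of \<open>G\<close> there.\<close>
      obtain d where d: "d > 0" "\<And>y. y \<in> C \<Longrightarrow> dist y x0 < d \<Longrightarrow> \<bar>\<psi> y - \<psi> x0\<bar> < e"
        using \<psi>C x0C e unfolding continuous_on_iff dist_real_def by blast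
      have "G x - e \<le> \<psi> y" if "y \<in> C" "dist y x < d" for y
        using d(2)[OF that(1)] that(2) True Gx0 by (auto simp: abs_less_iff)
      then show ?thesis using sub\<psi> \<psi>G d(1) by blast
    next
      case False
      then have "x \<in> frontier \<Omega>" using x unfolding T by blast
      then show ?thesis
        using boundary_barrier[OF F dom(1,3) bdry _ D(1) D\<Omega> GC[unfolded C_def] sub\<psi> \<psi>C[unfolded C_def] _ e] \<psi>G
        unfolding C_def by blast
    qed
    moreover have "C - D \<noteq> {}" using T by blast
    ultimately show ?thesis using Perron[OF F C D _ GC superG sub\<psi> \<psi>G] that by blast
  qed
  have ux0: "u x0 = H0 x0 + t * (h x0 - 1)" using u(6)[of x0] Gx0 T by (simp add: \<psi>_def)
  have "F_harmonic F D u"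
    unfolding F_harmonic_def F_subharmonic_iff_subh[OF D(1) Fcl] F_subharmonic_iff_subh[OF D(1) F'cl]
    using u(2,3) continuous_on_subset[OF u(1) D(2)] by blast
  moreover have "u x = \<phi> x" if "x \<in> frontier \<Omega>" for x using u(6)[of x] Gfr[OF that] that T by simp
  \<comment> \<open>\<open>h \<ge> 0\<close> makes the bound increase with \<open>lam\<close>, so
    the case of \<open>\<Lambda>\<close> settles all larger ones.\<close>
  moreover have "u x \<le> lam * h x + H0 x0 + t * (h x - 1)" if "lam \<ge> \<Lambda>" "x \<in> C" for lam x
  proof -
    have "\<Lambda> * h x \<le> lam * h x" using that h0 by (intro mult_right_mono) auto
    moreover have "u x \<le> hbar x" using u(5)[OF that(2)] by (simp add: G_def)
    ultimately show ?thesis unfolding hbar_def by linarith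
  qed
  ultimately show "\<exists>Ht :: real^'n \<Rightarrow> real.
           continuous_on (closure \<Omega>) Ht
         \<and> F_harmonic F (\<Omega> - {x0}) Ht
         \<and> (\<forall>x\<in>frontier \<Omega>. Ht x = \<phi> x)
         \<and> (\<forall>x\<in>closure \<Omega>. H0 x + t * (h x - 1) \<le> Ht x)
         \<and> Ht x0 = H0 x0 + t * (h x0 - 1)
         \<and> (\<exists>Lam. \<forall>lam\<ge>Lam. \<forall>x\<in>closure \<Omega>. Ht x \<le> lam * h x + H0 x0 + t * (h x - 1))
         \<and> (\<forall>lam. Ht x0 = lam * h x0 + H0 x0 + t * (h x0 - 1))"
    using u(1,4) ux0 h_x0 unfolding C_def D_def \<psi>_def
    by (intro exI[of _ u] conjI ballI allI exI[of _ \<Lambda>] impI) auto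
qed

end
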